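(* Let $G$ be a locally compact topological group. Then $G\text{-Mod}^{\mathrm{iso}}$ is equivalent to the category of coalgebras (in $\mathrm{IndBan}_k$) over the monoidal comonad $C_b^{\mathrm{lu}}(G,-)$ on $\mathrm{IndBan}_k$.
   Context: $k$ is a field complete with respect to a non-trivial valuation. $\mathrm{Ban}_k$ is the category of $k$-Banach spaces and bounded linear maps (for non-Archimedean $k$ one may use either the usual or the strong triangle inequality; both conventions are allowed). $\mathrm{IndBan}_k$ is its Ind-completion: objects are formal filtered colimits $\text{"colim"}_{i\in I}V_i$ of Banach spaces, with $\mathrm{Hom}(\text{"colim"}_iX_i,\text{"colim"}_jY_j)=\lim_i\mathrm{colim}_j\mathrm{Hom}(X_i,Y_j)$; it is monoidal under the completed projective tensor product $\hat\otimes$, extended by $(\text{"colim"}_iX_i)\hat\otimes(\text{"colim"}_jY_j)=\text{"colim"}_{i,j}X_i\hat\otimes Y_j$. $G\text{-Mod}^{\mathrm{iso}}$ is the category of strongly continuous IndBanach $G$-modules for which $G$ acts by isometries: the action of $G$ on $V=\text{"colim"}_{i\in I}V_i$ is determined by continuous maps $G\to\mathrm{Hom}(V_i,V_{i'})$ for each $i\in I$ and for some $i'\in I$ depending on $i$, where $\mathrm{Hom}(V_i,V_{i'})$ has the strong operator topology, with images in the subspace of isometries. Morphisms are $G$-equivariant morphisms in $\mathrm{IndBan}_k$. It is monoidal via the diagonal action. $F:G\text{-Mod}^{\mathrm{iso}}\to\mathrm{IndBan}_k$ is the forgetful functor. For a Banach space $V$, $C_b^{\mathrm{lu}}(G,V)$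 is the Banach space (sup norm) of bounded continuous functions $f:G\to V$ that are left uniformly continuous: for every net $(h_\lambda)$ in $G$ converging to the identity, $\sup_{x\in G}\|f(h_\lambda x)-f(x)\|\to0$. For $V=\text{"colim"}_iV_i$ set $C_b^{\mathrm{lu}}(G,V)=\text{"colim"}_iC_b^{\mathrm{lu}}(G,V_i)$. With $G$ acting by translation, $(g\cdot f)(x)=f(g^{-1}x)$, the functor $C_b^{\mathrm{lu}}(G,-):\mathrm{IndBan}_k\to G\text{-Mod}^{\mathrm{iso}}$ is right adjoint to $F$ (counit: evaluation at $1$; unit: $v\mapsto(x\mapsto x^{-1}v)$). The comonad structure on $C_b^{\mathrm{lu}}(G,-)$ is the one induced by this adjunction: counit $f\mapsto f(1)$ and comultiplication $\Delta(f)(g)(g')=f(gg')$. Its monoidal structure is pointwise, $C_b^{\mathrm{lu}}(G,V)\hat\otimes C_b^{\mathrm{lu}}(G,W)\to C_b^{\mathrm{lu}}(G,V\hat\otimes W)$. *)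

theory Defs
  imports "HOL-Analysis.Analysis" "HOL-Algebra.Module"
begin

section \<open>Categories\<close>

text \<open>
  Hom-sets of different pairs of objects are allowed to overlap, so identities, composition and the
  arrow part of a functor take the objects involved as arguments;
  \<open>cmp C x y z g f\<close> is the composite of \<open>f : x \<rightarrow> y\<close> and \<open>g : y \<rightarrow> z\<close>.
\<close>

record ('o, 'm) cat =
  obs :: "'o set"
  homs :: "'o \<Rightarrow> 'o \<Rightarrow> 'm set"
  idt :: "'o \<Rightarrow> 'm"
  cmp :: "'o \<Rightarrow> 'o \<Rightarrow> 'o \<Rightarrow> 'm \<Rightarrow> 'm \<Rightarrow> 'm"

definition category :: "('o, 'm) cat \<Rightarrow> bool" where
  "category C \<longleftrightarrow>
     (\<forall>x\<in>obs C. idt C x \<in> homs C x x) \<and>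
     (\<forall>x\<in>obs C. \<forall>y\<in>obs C. \<forall>z\<in>obs C. \<forall>f\<in>homs C x y. \<forall>g\<in>homs C y z.
        cmp C x y z g f \<in> homs C x z) \<and>
     (\<forall>x\<in>obs C. \<forall>y\<in>obs C. \<forall>f\<in>homs C x y.
        cmp C x x y f (idt C x) = f \<and> cmp C x y y (idt C y) f = f) \<and>
     (\<forall>w\<in>obs C. \<forall>x\<in>obs C. \<forall>y\<in>obs C. \<forall>z\<in>obs C.
        \<forall>f\<in>homs C w x. \<forall>g\<in>homs C x y. \<forall>h\<in>homs C y z.
        cmp C w y z h (cmp C w x y g f) = cmp C w x z (cmp C x y z h g) f)"

record ('o, 'm, 'p, 'n) fctr =
  omap :: "'o \<Rightarrow> 'p"
  amap :: "'o \<Rightarrow> 'o \<Rightarrow> 'm \<Rightarrow> 'n"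

definition is_functor :: "('o, 'm) cat \<Rightarrow> ('p, 'n) cat \<Rightarrow> ('o, 'm, 'p, 'n) fctr \<Rightarrow> bool" where
  "is_functor C D F \<longleftrightarrow>
     (\<forall>x\<in>obs C. omap F x \<in> obs D) \<and>
     (\<forall>x\<in>obs C. \<forall>y\<in>obs C. \<forall>f\<in>homs C x y. amap F x y f \<in> homs D (omap F x) (omap F y)) \<and>
     (\<forall>x\<in>obs C. amap F x x (idt C x) = idt D (omap F x)) \<and>
     (\<forall>x\<in>obs C. \<forall>y\<in>obs C. \<forall>z\<in>obs C. \<forall>f\<in>homs C x y. \<forall>g\<in>homs C y z.
        amap F x z (cmp C x y z g f) =
        cmp D (omap F x) (omap F y) (omap F z) (amap F y z g) (amap F x y f))"

definition id_functor :: "('o, 'm, 'o, 'm) fctr" where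
  "id_functor = \<lparr>omap = (\<lambda>x. x), amap = (\<lambda>x y f. f)\<rparr>"

definition comp_functor ::
  "('p, 'n, 'q, 'l) fctr \<Rightarrow> ('o, 'm, 'p, 'n) fctr \<Rightarrow> ('o, 'm, 'q, 'l) fctr" where
  "comp_functor G F =
     \<lparr>omap = (\<lambda>x. omap G (omap F x)),
      amap = (\<lambda>x y f. amap G (omap F x) (omap F y) (amap F x y f))\<rparr>"

definition iso_arrow :: "('o, 'm) cat \<Rightarrow> 'o \<Rightarrow> 'o \<Rightarrow> 'm \<Rightarrow> bool" where
  "iso_arrow C x y f \<longleftrightarrow> f \<in> homs C x y \<and>
     (\<exists>g\<in>homs C y x. cmp C x y x g f = idt C x \<and> cmp C y x y f g = idt C y)"

definition natural_iso ::
  "('o, 'm) cat \<Rightarrow> ('p, 'n) cat \<Rightarrow> ('o, 'm, 'p, 'n) fctr \<Rightarrow> ('o, 'm, 'p, 'n) fctr \<Rightarrow> ('o \<Rightarrow> 'n) \<Rightarrow> bool"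
  where
  "natural_iso C D F G \<eta> \<longleftrightarrow>
     (\<forall>x\<in>obs C. iso_arrow D (omap F x) (omap G x) (\<eta> x)) \<and>
     (\<forall>x\<in>obs C. \<forall>y\<in>obs C. \<forall>f\<in>homs C x y.
        cmp D (omap F x) (omap F y) (omap G y) (\<eta> y) (amap F x y f) =
        cmp D (omap F x) (omap G x) (omap G y) (amap G x y f) (\<eta> x))"

definition equivalent_categories :: "('o, 'm) cat \<Rightarrow> ('p, 'n) cat \<Rightarrow> bool" where
  "equivalent_categories C D \<longleftrightarrow> category C \<and> category D \<and>
     (\<exists>F G \<eta> \<epsilon>. is_functor C D F \<and> is_functor D C G \<and>
        natural_iso C C id_functor (comp_functor G F) \<eta> \<and>
        natural_iso D D (comp_functor F G) id_functor \<epsilon>)"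

definition filtered :: "('o, 'm) cat \<Rightarrow> bool" where
  "filtered I \<longleftrightarrow> category I \<and> obs I \<noteq> {} \<and>
     (\<forall>i\<in>obs I. \<forall>j\<in>obs I. \<exists>l\<in>obs I. homs I i l \<noteq> {} \<and> homs I j l \<noteq> {}) \<and>
     (\<forall>i\<in>obs I. \<forall>j\<in>obs I. \<forall>p\<in>homs I i j. \<forall>q\<in>homs I i j.
        \<exists>l\<in>obs I. \<exists>r\<in>homs I j l. cmp I i j l r p = cmp I i j l r q)"

text \<open>
  A monoidal comonad: endofunctor, counit \<open>C x \<rightarrow> x\<close>, comultiplication \<open>C x \<rightarrow> C (C x)\<close>, and
  structure arrows \<open>C x \<otimes> C y \<rightarrow> C (x \<otimes> y)\<close> and \<open>1 \<rightarrow> C 1\<close>. The category of coalgebras depends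
  only on the first three components.
\<close>

record ('o, 'm) monoidal_comonad =
  endo :: "('o, 'm, 'o, 'm) fctr"
  counit :: "'o \<Rightarrow> 'm"
  comult :: "'o \<Rightarrow> 'm"
  mon_mult :: "'o \<Rightarrow> 'o \<Rightarrow> 'm"
  mon_unit :: "'m"

definition coalgebra :: "('o, 'm) cat \<Rightarrow> ('o, 'm) monoidal_comonad \<Rightarrow> 'o \<Rightarrow> 'm \<Rightarrow> bool" where
  "coalgebra C T x \<rho> \<longleftrightarrow> (let Tx = omap (endo T) x; TTx = omap (endo T) Tx in
     x \<in> obs C \<and> \<rho> \<in> homs C x Tx \<and>
     cmp C x Tx x (counit T x) \<rho> = idt C x \<and>
     cmp C x Tx TTx (comult T x) \<rho> = cmp C x Tx TTx (amap (endo T) x Tx \<rho>) \<rho>)"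

definition coalgebras :: "('o, 'm) cat \<Rightarrow> ('o, 'm) monoidal_comonad \<Rightarrow> ('o \<times> 'm, 'm) cat" where
  "coalgebras C T =
     \<lparr>obs = {(x, \<rho>). coalgebra C T x \<rho>},
      homs = (\<lambda>(x, \<rho>) (y, \<sigma>). {f \<in> homs C x y.
        cmp C x y (omap (endo T) y) \<sigma> f =
        cmp C x (omap (endo T) x) (omap (endo T) y) (amap (endo T) x y f) \<rho>}),
      idt = (\<lambda>(x, \<rho>). idt C x),
      cmp = (\<lambda>(x, \<rho>) (y, \<sigma>) (z, \<tau>). cmp C x y z)\<rparr>"


section \<open>Banach spaces over a complete valued field\<close>

definition complete_valued_field :: "('k::field \<Rightarrow> real) \<Rightarrow> bool" where
  "complete_valued_field v \<longleftrightarrow>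
     (\<forall>x. v x \<ge> 0) \<and> (\<forall>x. v x = 0 \<longleftrightarrow> x = 0) \<and>
     (\<forall>x y. v (x * y) = v x * v y) \<and> (\<forall>x y. v (x + y) \<le> v x + v y) \<and>
     (\<exists>x. x \<noteq> 0 \<and> v x \<noteq> 1) \<and>
     (\<forall>X. (\<forall>e>0. \<exists>N::nat. \<forall>m\<ge>N. \<forall>n\<ge>N. v (X m - X n) < e) \<longrightarrow>
        (\<exists>l. (\<lambda>n. v (X n - l)) \<longlonglongrightarrow> 0))"

definition nonarchimedean :: "('k::field \<Rightarrow> real) \<Rightarrow> bool" where
  "nonarchimedean v \<longleftrightarrow> (\<forall>x y. v (x + y) \<le> max (v x) (v y))"

definition field_ring :: "'k::field ring" where
  "field_ring = \<lparr>carrier = UNIV, mult = (*), one = 1, zero = 0, add = (+)\<rparr>"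

text \<open>The multiplicative fields that \<^typ>\<open>('a, 'b) module\<close> inherits from rings carry no meaning.\<close>

record ('k, 'u) nmod = "('k, 'u) module" +
  nrm :: "'u \<Rightarrow> real"

text \<open>The flag \<open>s\<close> selects the strong triangle inequality.\<close>

definition banach :: "('k::field \<Rightarrow> real) \<Rightarrow> bool \<Rightarrow> ('k, 'u) nmod \<Rightarrow> bool" where
  "banach v s V \<longleftrightarrow> Module.module field_ring V \<and>
     (\<forall>x\<in>carrier V. nrm V x \<ge> 0 \<and> (nrm V x = 0 \<longleftrightarrow> x = \<zero>\<^bsub>V\<^esub>)) \<and>
     (\<forall>c. \<forall>x\<in>carrier V. nrm V (c \<odot>\<^bsub>V\<^esub> x) = v c * nrm V x) \<and>
     (\<forall>x\<in>carrier V. \<forall>y\<in>carrier V. nrm V (x \<oplus>\<^bsub>V\<^esub> y) \<le> nrm V x + nrm V y) \<and>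
     (s \<longrightarrow> (\<forall>x\<in>carrier V. \<forall>y\<in>carrier V. nrm V (x \<oplus>\<^bsub>V\<^esub> y) \<le> max (nrm V x) (nrm V y))) \<and>
     (\<forall>X. (\<forall>n. X n \<in> carrier V) \<and>
        (\<forall>e>0. \<exists>N::nat. \<forall>m\<ge>N. \<forall>n\<ge>N. nrm V (X m \<ominus>\<^bsub>V\<^esub> X n) < e) \<longrightarrow>
        (\<exists>l\<in>carrier V. (\<lambda>n. nrm V (X n \<ominus>\<^bsub>V\<^esub> l)) \<longlonglongrightarrow> 0))"

definition bhom :: "('k::field, 'u) nmod \<Rightarrow> ('k, 'u) nmod \<Rightarrow> ('u \<Rightarrow> 'u) set" where
  "bhom V W = {f \<in> carrier V \<rightarrow>\<^sub>E carrier W.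
     (\<forall>x\<in>carrier V. \<forall>y\<in>carrier V. f (x \<oplus>\<^bsub>V\<^esub> y) = f x \<oplus>\<^bsub>W\<^esub> f y) \<and>
     (\<forall>c. \<forall>x\<in>carrier V. f (c \<odot>\<^bsub>V\<^esub> x) = c \<odot>\<^bsub>W\<^esub> f x) \<and>
     (\<exists>M. \<forall>x\<in>carrier V. nrm W (f x) \<le> M * nrm V x)}"

definition Ban :: "('k::field \<Rightarrow> real) \<Rightarrow> bool \<Rightarrow> (('k, 'u) nmod, 'u \<Rightarrow> 'u) cat" where
  "Ban v s =
     \<lparr>obs = {V. banach v s V},
      homs = bhom,
      idt = (\<lambda>V. \<lambda>x\<in>carrier V. x),
      cmp = (\<lambda>V W Z g f. compose (carrier V) g f)\<rparr>"


section \<open>Universes\<close>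

text \<open>
  "Small" means: realised on subsets of the type \<^typ>\<open>'u\<close>. This applies to the underlying sets of
  Banach spaces and to the objects and arrows of the index categories of ind-objects. A universe
  provides injective encodings of \<open>G\<close>-indexed families, of sequences and of scalars, so that
  \<^typ>\<open>'u\<close> is closed under the constructions below.
\<close>

record ('k, 'g, 'u) univ =
  fenc :: "('g \<Rightarrow> 'u) \<Rightarrow> 'u"
  senc :: "(nat \<Rightarrow> 'u) \<Rightarrow> 'u"
  kenc :: "'k \<Rightarrow> 'u"

definition universe :: "('k, 'g, 'u) univ \<Rightarrow> bool" where
  "universe U \<longleftrightarrow> inj (fenc U) \<and> inj (senc U) \<and> inj (kenc U)"

abbreviation fdec :: "('k, 'g, 'u) univ \<Rightarrow> 'u \<Rightarrow> 'g \<Rightarrow> 'u" where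
  "fdec U \<equiv> inv_into UNIV (fenc U)"

abbreviation kdec :: "('k, 'g, 'u) univ \<Rightarrow> 'u \<Rightarrow> 'k" where
  "kdec U \<equiv> inv_into UNIV (kenc U)"

definition penc :: "('k, 'g, 'u) univ \<Rightarrow> 'u \<times> 'u \<Rightarrow> 'u" where
  "penc U p = senc U (\<lambda>n. if n = 0 then fst p else snd p)"

definition pfst :: "('k, 'g, 'u) univ \<Rightarrow> 'u \<Rightarrow> 'u" where
  "pfst U a = fst (inv_into UNIV (penc U) a)"

definition psnd :: "('k, 'g, 'u) univ \<Rightarrow> 'u \<Rightarrow> 'u" where
  "psnd U a = snd (inv_into UNIV (penc U) a)"

text \<open>Universes exist for all \<^typ>\<open>'k\<close> and \<^typ>\<open>'g\<close>, and can be taken arbitrarily large.\<close>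

lemma universe_exists: "\<exists>U :: ('k, 'g, nat \<times> 'g \<Rightarrow> 'k + 'b) univ. universe U"
proof -
  obtain a :: "nat \<times> 'g \<times> 'g \<Rightarrow> nat \<times> 'g" where a: "inj a"
  proof (cases "finite (UNIV :: 'g set)")
    case True
    have "countable ((UNIV :: nat set) \<times> (UNIV :: 'g set) \<times> (UNIV :: 'g set))"
      by (rule countable_SIGMA[OF countableI_type
            countable_SIGMA[OF countable_finite[OF True] countable_finite[OF True]]])
    then obtain t :: "nat \<times> 'g \<times> 'g \<Rightarrow> nat" where t: "inj t"
      unfolding countable_def UNIV_Times_UNIV by (elim exE)
    show ?thesis
      by (rule that[of "\<lambda>x. (t x, undefined)"]) (auto intro!: injI simp: inj_eq[OF t])
  next
    case False
    then obtain t :: "'g \<times> 'g \<Rightarrow> 'g" where t: "inj t"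
      using card_of_Times_same_infinite[OF False]
      unfolding card_of_ordIso[symmetric] bij_betw_def UNIV_Times_UNIV by (elim exE conjE)
    show ?thesis
      by (rule that[of "\<lambda>(n, p). (n, t p)"]) (auto intro!: injI simp: inj_eq[OF t])
  qed
  define F :: "('g \<Rightarrow> nat \<times> 'g \<Rightarrow> 'k + 'b) \<Rightarrow> nat \<times> 'g \<Rightarrow> 'k + 'b" where
    "F = (\<lambda>f p. case inv_into UNIV a p of (n, g, h) \<Rightarrow> f h (n, g))"
  have F: "inj F"
  proof (rule injI, intro ext)
    fix f f' :: "'g \<Rightarrow> nat \<times> 'g \<Rightarrow> 'k + 'b" and h p
    assume "F f = F f'"
    then have "F f (a (fst p, snd p, h)) = F f' (a (fst p, snd p, h))" by simp
    then show "f h p = f' h p" by (simp add: F_def inv_f_f[OF a])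
  qed
  obtain b :: "nat \<times> nat \<Rightarrow> nat" where b: "inj b"
    using that[OF inj_prod_encode] .
  define S :: "(nat \<Rightarrow> nat \<times> 'g \<Rightarrow> 'k + 'b) \<Rightarrow> nat \<times> 'g \<Rightarrow> 'k + 'b" where
    "S = (\<lambda>f p. case inv_into UNIV b (fst p) of (n, m) \<Rightarrow> f m (n, snd p))"
  have S: "inj S"
  proof (rule injI, intro ext)
    fix f f' :: "nat \<Rightarrow> nat \<times> 'g \<Rightarrow> 'k + 'b" and m p
    assume "S f = S f'"
    then have "S f (b (fst p, m), snd p) = S f' (b (fst p, m), snd p)" by simp
    then show "f m p = f' m p" by (simp add: S_def inv_f_f[OF b])
  qed
  have K: "inj (\<lambda>(c::'k) (p::nat \<times> 'g). (Inl c :: 'k + 'b))"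
    by (auto intro!: injI dest: fun_cong)
  show ?thesis
    by (rule exI[of _ "\<lparr>fenc = F, senc = S, kenc = (\<lambda>c p. Inl c)\<rparr>"])
      (simp add: universe_def F S K)
qed


section \<open>Ind-Banach spaces\<close>

record ('k, 'u) ind =
  idx :: "('u, 'u) cat"
  dgm :: "('u, 'u, ('k, 'u) nmod, 'u \<Rightarrow> 'u) fctr"

type_synonym 'u indmap = "'u \<Rightarrow> ('u \<times> ('u \<Rightarrow> 'u)) set"

abbreviation sp :: "('k, 'u) ind \<Rightarrow> 'u \<Rightarrow> ('k, 'u) nmod" where
  "sp X i \<equiv> omap (dgm X) i"

abbreviation ix :: "('k, 'u) ind \<Rightarrow> 'u set" where
  "ix X \<equiv> obs (idx X)"

definition ind_object :: "('k::field \<Rightarrow> real) \<Rightarrow> bool \<Rightarrow> ('k, 'u) ind \<Rightarrow> bool" where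
  "ind_object v s X \<longleftrightarrow> filtered (idx X) \<and> is_functor (idx X) (Ban v s) (dgm X)"

text \<open>
  For sets \<open>H j\<close> of maps from a fixed set \<open>D\<close> to the \<open>j\<close>-th space of \<open>Y\<close>, \<open>colim_set Y D H\<close> is the
  filtered colimit of the \<open>H j\<close>, a quotient of the disjoint union of the \<open>H j\<close>. Two maps are
  identified iff they become equal, on all of \<open>D\<close>, at one common later index.
\<close>

definition ev_eq :: "('k, 'u) ind \<Rightarrow> 'x set \<Rightarrow> 'u \<Rightarrow> ('x \<Rightarrow> 'u) \<Rightarrow> 'u \<Rightarrow> ('x \<Rightarrow> 'u) \<Rightarrow> bool" where
  "ev_eq Y D j f j' f' \<longleftrightarrow>
     (\<exists>l\<in>ix Y. \<exists>p\<in>homs (idx Y) j l. \<exists>q\<in>homs (idx Y) j' l.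
        \<forall>x\<in>D. amap (dgm Y) j l p (f x) = amap (dgm Y) j' l q (f' x))"

definition colim_rel ::
  "('k, 'u) ind \<Rightarrow> 'x set \<Rightarrow> ('u \<Rightarrow> ('x \<Rightarrow> 'u) set) \<Rightarrow> (('u \<times> ('x \<Rightarrow> 'u)) \<times> ('u \<times> ('x \<Rightarrow> 'u))) set"
  where
  "colim_rel Y D H = {((j, f), (j', f')).
     j \<in> ix Y \<and> f \<in> H j \<and> j' \<in> ix Y \<and> f' \<in> H j' \<and> ev_eq Y D j f j' f'}"

definition colim_set ::
  "('k, 'u) ind \<Rightarrow> 'x set \<Rightarrow> ('u \<Rightarrow> ('x \<Rightarrow> 'u) set) \<Rightarrow> ('u \<times> ('x \<Rightarrow> 'u)) set set" where
  "colim_set Y D H = (SIGMA j : ix Y. H j) // colim_rel Y D H"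

text \<open>\<open>ind_cls X Y i j f\<close> is the class of \<open>f : X\<^sub>i \<rightarrow> Y\<^sub>j\<close> in the colimit over \<open>j\<close> of the
  \<open>Hom(X\<^sub>i, Y\<^sub>j)\<close>.\<close>

definition ind_cls ::
  "('k::field, 'u) ind \<Rightarrow> ('k, 'u) ind \<Rightarrow> 'u \<Rightarrow> 'u \<Rightarrow> ('u \<Rightarrow> 'u) \<Rightarrow> ('u \<times> ('u \<Rightarrow> 'u)) set" where
  "ind_cls X Y i j f =
     colim_rel Y (carrier (sp X i)) (\<lambda>j. bhom (sp X i) (sp Y j)) `` {(j, f)}"

definition ind_hom :: "('k::field, 'u) ind \<Rightarrow> ('k, 'u) ind \<Rightarrow> 'u indmap set" where
  "ind_hom X Y =
     {\<phi> \<in> (\<Pi>\<^sub>E i\<in>ix X. colim_set Y (carrier (sp X i)) (\<lambda>j. bhom (sp X i) (sp Y j))).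
        \<forall>i\<in>ix X. \<forall>i'\<in>ix X. \<forall>u\<in>homs (idx X) i i'. \<forall>(j, f)\<in>\<phi> i'.
          (j, compose (carrier (sp X i)) f (amap (dgm X) i i' u)) \<in> \<phi> i}"

text \<open>The morphism given by maps \<open>f i : X\<^sub>i \<rightarrow> Y\<^sub>i\<close> between ind-objects with the same index category.\<close>

definition level_map ::
  "('k::field, 'u) ind \<Rightarrow> ('k, 'u) ind \<Rightarrow> ('u \<Rightarrow> 'u \<Rightarrow> 'u) \<Rightarrow> 'u indmap" where
  "level_map X Y f = (\<lambda>i\<in>ix X. ind_cls X Y i i (f i))"

text \<open>The unions below run over all representatives; each of them contributes the same class.\<close>

definition ind_comp ::
  "('k::field, 'u) ind \<Rightarrow> ('k, 'u) ind \<Rightarrow> ('k, 'u) ind \<Rightarrow> 'u indmap \<Rightarrow> 'u indmap \<Rightarrow> 'u indmap" where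
  "ind_comp X Y Z \<psi> \<phi> =
     (\<lambda>i\<in>ix X. \<Union>(j, f)\<in>\<phi> i. \<Union>(l, h)\<in>\<psi> j. ind_cls X Z i l (compose (carrier (sp X i)) h f))"

definition IndBan :: "('k::field \<Rightarrow> real) \<Rightarrow> bool \<Rightarrow> (('k, 'u) ind, 'u indmap) cat" where
  "IndBan v s =
     \<lparr>obs = {X. ind_object v s X},
      homs = ind_hom,
      idt = (\<lambda>X. level_map X X (\<lambda>i. \<lambda>x\<in>carrier (sp X i). x)),
      cmp = ind_comp\<rparr>"


section \<open>Completed projective tensor product\<close>

definition bounded_bilinear_map ::
  "('k::field, 'u) nmod \<Rightarrow> ('k, 'u) nmod \<Rightarrow> ('k, 'u) nmod \<Rightarrow> ('u \<Rightarrow> 'u \<Rightarrow> 'u) \<Rightarrow> real \<Rightarrow> bool" where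
  "bounded_bilinear_map V W Z \<beta> M \<longleftrightarrow> M \<ge> 0 \<and>
     (\<forall>x\<in>carrier V. \<forall>y\<in>carrier W. \<beta> x y \<in> carrier Z \<and> nrm Z (\<beta> x y) \<le> M * (nrm V x * nrm W y)) \<and>
     (\<forall>x\<in>carrier V. \<forall>x'\<in>carrier V. \<forall>y\<in>carrier W. \<beta> (x \<oplus>\<^bsub>V\<^esub> x') y = \<beta> x y \<oplus>\<^bsub>Z\<^esub> \<beta> x' y) \<and>
     (\<forall>x\<in>carrier V. \<forall>y\<in>carrier W. \<forall>y'\<in>carrier W. \<beta> x (y \<oplus>\<^bsub>W\<^esub> y') = \<beta> x y \<oplus>\<^bsub>Z\<^esub> \<beta> x y') \<and>
     (\<forall>c. \<forall>x\<in>carrier V. \<forall>y\<in>carrier W.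
        \<beta> (c \<odot>\<^bsub>V\<^esub> x) y = c \<odot>\<^bsub>Z\<^esub> \<beta> x y \<and> \<beta> x (c \<odot>\<^bsub>W\<^esub> y) = c \<odot>\<^bsub>Z\<^esub> \<beta> x y)"

text \<open>The universal bounded bilinear map of norm at most 1; it determines \<open>(T, \<tau>)\<close> up to unique
  isometric isomorphism.\<close>

definition is_tensor ::
  "('k::field \<Rightarrow> real) \<Rightarrow> bool \<Rightarrow> ('k, 'u) nmod \<Rightarrow> ('k, 'u) nmod \<Rightarrow>
     ('k, 'u) nmod \<times> ('u \<Rightarrow> 'u \<Rightarrow> 'u) \<Rightarrow> bool" where
  "is_tensor v s V W = (\<lambda>(T, \<tau>). banach v s T \<and> bounded_bilinear_map V W T \<tau> 1 \<and>
     (\<forall>Z \<beta> M. banach v s Z \<and> bounded_bilinear_map V W Z \<beta> M \<longrightarrow>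
        (\<exists>\<phi>\<in>bhom T Z. (\<forall>x\<in>carrier V. \<forall>y\<in>carrier W. \<phi> (\<tau> x y) = \<beta> x y) \<and>
           (\<forall>t\<in>carrier T. nrm Z (\<phi> t) \<le> M * nrm T t) \<and>
           (\<forall>\<psi>\<in>bhom T Z. (\<forall>x\<in>carrier V. \<forall>y\<in>carrier W. \<psi> (\<tau> x y) = \<beta> x y) \<longrightarrow> \<psi> = \<phi>))))"

definition ban_tensor ::
  "('k::field \<Rightarrow> real) \<Rightarrow> bool \<Rightarrow> ('k, 'u) nmod \<Rightarrow> ('k, 'u) nmod \<Rightarrow> ('k, 'u) nmod" where
  "ban_tensor v s V W = fst (SOME p. is_tensor v s V W p)"

definition pure_tensor ::
  "('k::field \<Rightarrow> real) \<Rightarrow> bool \<Rightarrow> ('k, 'u) nmod \<Rightarrow> ('k, 'u) nmod \<Rightarrow> 'u \<Rightarrow> 'u \<Rightarrow> 'u" where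
  "pure_tensor v s V W = snd (SOME p. is_tensor v s V W p)"

text \<open>The bounded linear map out of the tensor product that corresponds to \<open>\<beta>\<close>.\<close>

definition tensor_lift ::
  "('k::field \<Rightarrow> real) \<Rightarrow> bool \<Rightarrow> ('k, 'u) nmod \<Rightarrow> ('k, 'u) nmod \<Rightarrow> ('k, 'u) nmod \<Rightarrow>
     ('u \<Rightarrow> 'u \<Rightarrow> 'u) \<Rightarrow> 'u \<Rightarrow> 'u" where
  "tensor_lift v s V W Z \<beta> = (THE \<phi>. \<phi> \<in> bhom (ban_tensor v s V W) Z \<and>
     (\<forall>x\<in>carrier V. \<forall>y\<in>carrier W. \<phi> (pure_tensor v s V W x y) = \<beta> x y))"

definition product_cat ::
  "('k, 'g, 'u) univ \<Rightarrow> ('u, 'u) cat \<Rightarrow> ('u, 'u) cat \<Rightarrow> ('u, 'u) cat" where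
  "product_cat U I J =
     \<lparr>obs = penc U ` (obs I \<times> obs J),
      homs = (\<lambda>a b. penc U ` (homs I (pfst U a) (pfst U b) \<times> homs J (psnd U a) (psnd U b))),
      idt = (\<lambda>a. penc U (idt I (pfst U a), idt J (psnd U a))),
      cmp = (\<lambda>a b c g f. penc U
        (cmp I (pfst U a) (pfst U b) (pfst U c) (pfst U g) (pfst U f),
         cmp J (psnd U a) (psnd U b) (psnd U c) (psnd U g) (psnd U f)))\<rparr>"

definition ind_tensor ::
  "('k::field \<Rightarrow> real) \<Rightarrow> bool \<Rightarrow> ('k, 'g, 'u) univ \<Rightarrow> ('k, 'u) ind \<Rightarrow> ('k, 'u) ind \<Rightarrow> ('k, 'u) ind"
  where
  "ind_tensor v s U X Y =
     \<lparr>idx = product_cat U (idx X) (idx Y),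
      dgm = \<lparr>omap = (\<lambda>a. ban_tensor v s (sp X (pfst U a)) (sp Y (psnd U a))),
             amap = (\<lambda>a b w.
               let X1 = sp X (pfst U a); Y1 = sp Y (psnd U a);
                   X2 = sp X (pfst U b); Y2 = sp Y (psnd U b)
               in tensor_lift v s X1 Y1 (ban_tensor v s X2 Y2)
                    (\<lambda>x y. pure_tensor v s X2 Y2
                       (amap (dgm X) (pfst U a) (pfst U b) (pfst U w) x)
                       (amap (dgm Y) (psnd U a) (psnd U b) (psnd U w) y)))\<rparr>\<rparr>"

definition scalar_space :: "('k::field \<Rightarrow> real) \<Rightarrow> ('k, 'g, 'u) univ \<Rightarrow> ('k, 'u) nmod" where
  "scalar_space v U =
     \<lparr>carrier = range (kenc U), mult = undefined, one = undefined, zero = kenc U 0,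
      add = (\<lambda>x y. kenc U (kdec U x + kdec U y)), smult = (\<lambda>c x. kenc U (c * kdec U x)),
      nrm = (\<lambda>x. v (kdec U x))\<rparr>"

text \<open>The tensor unit is indexed by a category with one object and one arrow.\<close>

definition ind_unit :: "('k::field \<Rightarrow> real) \<Rightarrow> ('k, 'g, 'u) univ \<Rightarrow> ('k, 'u) ind" where
  "ind_unit v U =
     \<lparr>idx = \<lparr>obs = {kenc U 0}, homs = (\<lambda>_ _. {kenc U 0}), idt = (\<lambda>_. kenc U 0),
             cmp = (\<lambda>_ _ _ _ _. kenc U 0)\<rparr>,
      dgm = \<lparr>omap = (\<lambda>_. scalar_space v U),
             amap = (\<lambda>_ _ _. \<lambda>x\<in>carrier (scalar_space v U). x)\<rparr>\<rparr>"


section \<open>The monoidal comonad of bounded left uniformly continuous functions\<close>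

text \<open>
  The group \<open>G\<close> is a type of class \<^class>\<open>topological_group_add\<close> (not assumed commutative or
  Hausdorff), hence written additively: \<open>g + h\<close> is the product, \<open>- g\<close> the inverse and \<open>0\<close> the
  identity. Convergence along every net \<open>h\<^sub>\<lambda>\<close> tending to the identity is convergence along the
  neighbourhood filter of the identity.
\<close>

definition cblu_funs :: "('k::field, 'u) nmod \<Rightarrow> ('g::topological_group_add \<Rightarrow> 'u) set" where
  "cblu_funs V = {f. (\<forall>x. f x \<in> carrier V) \<and>
     (\<exists>M. \<forall>x. nrm V (f x) \<le> M) \<and>
     (\<forall>x. ((\<lambda>y. nrm V (f y \<ominus>\<^bsub>V\<^esub> f x)) \<longlongrightarrow> 0) (nhds x)) \<and>
     ((\<lambda>h. SUP x. nrm V (f (h + x) \<ominus>\<^bsub>V\<^esub> f x)) \<longlongrightarrow> 0) (nhds 0)}"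

definition cblu_space ::
  "('k::field, 'g::topological_group_add, 'u) univ \<Rightarrow> ('k, 'u) nmod \<Rightarrow> ('k, 'u) nmod" where
  "cblu_space U V =
     \<lparr>carrier = fenc U ` cblu_funs V, mult = undefined, one = undefined,
      zero = fenc U (\<lambda>x. \<zero>\<^bsub>V\<^esub>),
      add = (\<lambda>a b. fenc U (\<lambda>x. fdec U a x \<oplus>\<^bsub>V\<^esub> fdec U b x)),
      smult = (\<lambda>c a. fenc U (\<lambda>x. c \<odot>\<^bsub>V\<^esub> fdec U a x)),
      nrm = (\<lambda>a. SUP x. nrm V (fdec U a x))\<rparr>"

definition cblu_map ::
  "('k::field, 'g::topological_group_add, 'u) univ \<Rightarrow> ('k, 'u) nmod \<Rightarrow> ('u \<Rightarrow> 'u) \<Rightarrow> 'u \<Rightarrow> 'u" where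
  "cblu_map U V f = (\<lambda>a\<in>carrier (cblu_space U V). fenc U (\<lambda>x. f (fdec U a x)))"

definition cblu_obj ::
  "('k::field, 'g::topological_group_add, 'u) univ \<Rightarrow> ('k, 'u) ind \<Rightarrow> ('k, 'u) ind" where
  "cblu_obj U X =
     \<lparr>idx = idx X,
      dgm = \<lparr>omap = (\<lambda>i. cblu_space U (sp X i)),
             amap = (\<lambda>i j u. cblu_map U (sp X i) (amap (dgm X) i j u))\<rparr>\<rparr>"

definition Cblu ::
  "('k::field \<Rightarrow> real) \<Rightarrow> bool \<Rightarrow> ('k, 'g::topological_group_add, 'u) univ \<Rightarrow>
     (('k, 'u) ind, 'u indmap) monoidal_comonad" where
  "Cblu v s U =
     \<lparr>endo = \<lparr>omap = cblu_obj U,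
              amap = (\<lambda>X Y \<phi>. \<lambda>i\<in>ix X. \<Union>(j, f)\<in>\<phi> i.
                ind_cls (cblu_obj U X) (cblu_obj U Y) i j (cblu_map U (sp X i) f))\<rparr>,
      counit = (\<lambda>X. level_map (cblu_obj U X) X
        (\<lambda>i. \<lambda>a\<in>carrier (cblu_space U (sp X i)). fdec U a 0)),
      comult = (\<lambda>X. level_map (cblu_obj U X) (cblu_obj U (cblu_obj U X))
        (\<lambda>i. \<lambda>a\<in>carrier (cblu_space U (sp X i)). fenc U (\<lambda>g. fenc U (\<lambda>h. fdec U a (g + h))))),
      mon_mult = (\<lambda>X Y. level_map (ind_tensor v s U (cblu_obj U X) (cblu_obj U Y))
        (cblu_obj U (ind_tensor v s U X Y))
        (\<lambda>i. let V = sp X (pfst U i); W = sp Y (psnd U i) in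
          tensor_lift v s (cblu_space U V) (cblu_space U W) (cblu_space U (ban_tensor v s V W))
            (\<lambda>a b. fenc U (\<lambda>x. pure_tensor v s V W (fdec U a x) (fdec U b x))))),
      mon_unit = level_map (ind_unit v U) (cblu_obj U (ind_unit v U))
        (\<lambda>i. \<lambda>c\<in>carrier (scalar_space v U). fenc U (\<lambda>x. c))\<rparr>"


section \<open>Strongly continuous isometric modules\<close>

type_synonym ('g, 'u) ind_action = "'u \<Rightarrow> ('u \<times> ('g \<times> 'u \<Rightarrow> 'u)) set"

text \<open>Families of bounded maps \<open>V \<rightarrow> W\<close> indexed by \<open>G\<close>, in uncurried form.\<close>

definition families :: "('k::field, 'u) nmod \<Rightarrow> ('k, 'u) nmod \<Rightarrow> ('g \<times> 'u \<Rightarrow> 'u) set" where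
  "families V W = {a. \<forall>g. (\<lambda>x. a (g, x)) \<in> bhom V W}"

definition isometric_family :: "('k::field, 'u) nmod \<Rightarrow> ('k, 'u) nmod \<Rightarrow> ('g \<times> 'u \<Rightarrow> 'u) \<Rightarrow> bool" where
  "isometric_family V W a \<longleftrightarrow> (\<forall>g. \<forall>x\<in>carrier V. nrm W (a (g, x)) = nrm V x)"

definition strongly_continuous_family ::
  "('k::field, 'u) nmod \<Rightarrow> ('k, 'u) nmod \<Rightarrow> ('g::topological_space \<times> 'u \<Rightarrow> 'u) \<Rightarrow> bool" where
  "strongly_continuous_family V W a \<longleftrightarrow>
     (\<forall>x\<in>carrier V. \<forall>g. ((\<lambda>h. nrm W (a (h, x) \<ominus>\<^bsub>W\<^esub> a (g, x))) \<longlongrightarrow> 0) (nhds g))"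

text \<open>
  An action of \<open>G\<close> on \<open>V\<close> is an element \<open>\<alpha>\<close> of \<open>lim\<^sub>i colim\<^sub>j Map(G, Hom(V\<^sub>i, V\<^sub>j))\<close>: it is determined by
  families \<open>G \<rightarrow> Hom(V\<^sub>i, V\<^sub>j)\<close>, where two presentations that agree after passing to later indices
  define the same action. The unit law, the multiplication law and the equivariance of morphisms
  are identities between maps out of \<open>V\<^sub>i\<close>, \<open>G \<times> G \<times> V\<^sub>i\<close> and \<open>G \<times> V\<^sub>i\<close> in the respective colimits;
  in particular the index at which they hold does not depend on the group elements.
  (A requirement for one group element at a time would be weaker when transition maps
  are not injective.)
\<close>

definition iso_action ::
  "('k::field, 'u) ind \<Rightarrow> ('g::topological_group_add, 'u) ind_action \<Rightarrow> bool" where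
  "iso_action V \<alpha> \<longleftrightarrow>
     \<alpha> \<in> (\<Pi>\<^sub>E i\<in>ix V. colim_set V (UNIV \<times> carrier (sp V i)) (\<lambda>j. families (sp V i) (sp V j))) \<and>
     (\<forall>i\<in>ix V. \<forall>i'\<in>ix V. \<forall>u\<in>homs (idx V) i i'. \<forall>(j, a)\<in>\<alpha> i'.
        (j, \<lambda>(g, x). compose (carrier (sp V i)) (\<lambda>y. a (g, y)) (amap (dgm V) i i' u) x) \<in> \<alpha> i) \<and>
     (\<forall>i\<in>ix V. \<forall>(j, a)\<in>\<alpha> i. ev_eq V (carrier (sp V i)) j (\<lambda>x. a (0, x)) i (\<lambda>x. x)) \<and>
     (\<forall>i\<in>ix V. \<forall>(j, a)\<in>\<alpha> i. \<forall>(l, b)\<in>\<alpha> j.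
        ev_eq V (UNIV \<times> UNIV \<times> carrier (sp V i))
          l (\<lambda>(g, h, x). b (g, a (h, x))) j (\<lambda>(g, h, x). a (g + h, x))) \<and>
     (\<forall>i\<in>ix V. \<exists>(j, a)\<in>\<alpha> i.
        isometric_family (sp V i) (sp V j) a \<and> strongly_continuous_family (sp V i) (sp V j) a)"

definition equivariant ::
  "('k::field, 'u) ind \<Rightarrow> ('g::topological_group_add, 'u) ind_action \<Rightarrow>
     ('k, 'u) ind \<Rightarrow> ('g, 'u) ind_action \<Rightarrow> 'u indmap \<Rightarrow> bool" where
  "equivariant V \<alpha> W \<beta> \<phi> \<longleftrightarrow>
     (\<forall>i\<in>ix V. \<forall>(j, a)\<in>\<alpha> i. \<forall>(l, f)\<in>\<phi> j. \<forall>(m, h)\<in>\<phi> i. \<forall>(n, b)\<in>\<beta> m.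
        ev_eq W (UNIV \<times> carrier (sp V i))
          l (\<lambda>(g, x). f (a (g, x))) n (\<lambda>(g, x). b (g, h x)))"

definition GMod_iso ::
  "('k::field \<Rightarrow> real) \<Rightarrow> bool \<Rightarrow>
     (('k, 'u) ind \<times> ('g::topological_group_add, 'u) ind_action, 'u indmap) cat" where
  "GMod_iso v s =
     \<lparr>obs = {(V, \<alpha>). ind_object v s V \<and> iso_action V \<alpha>},
      homs = (\<lambda>(V, \<alpha>) (W, \<beta>). {\<phi> \<in> homs (IndBan v s) V W. equivariant V \<alpha> W \<beta> \<phi>}),
      idt = (\<lambda>(V, \<alpha>). idt (IndBan v s) V),
      cmp = (\<lambda>(V, \<alpha>) (W, \<beta>) (Z, \<gamma>). cmp (IndBan v s) V W Z)\<rparr>"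

end

theory Submission
  imports Defs
begin

text \<open>
  An action gives the coalgebra \<open>x \<mapsto> (g \<mapsto> g\<inverse> x)\<close>. Its orbit maps are left uniformly continuous because
  \<open>(hg)\<inverse> x - g\<inverse> x = g\<inverse> (h\<inverse> x - x)\<close> and \<open>G\<close> acts isometrically; since the multiplication law holds only
  in the colimit, this requires passing to a later index. Equivariance and compatibility with the
  coactions are the same condition, so this assignment is the identity on morphisms and fully
  faithful.

  Conversely, a coalgebra \<open>(X, \<rho>)\<close> is the equalizer of the comultiplication and \<open>C(\<rho>)\<close> on \<open>C(X)\<close>. This
  equalizer is presented levelwise by closed translation-invariant subspaces of the \<open>C(X\<^sub>i)\<close>, on which
  \<open>G\<close> acts by isometries; the new norms are the reason why \<open>X\<close> itself is only isomorphic to an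
  isometric module.
\<close>

section \<open>Categories\<close>

text \<open>Identities in an ind-category hold only after passing to a later index, so every law is
  treated as an instance of \<open>ev_eq\<close>, with one index for all arguments. Transition maps
  of \<open>cblu_obj U X\<close> act pointwise; hence a map into bounded functions and the uncurried
  map with an extra group variable have the same eventual equalities, and action laws and coaction
  laws translate into each other without loss. The obstacle is the converse. The subspace on which
  comultiplication and C(\<rho>) agree depends on a later index and on the arrows along which they
  are compared. These choices become part of the objects of a new index category, whose arrows are
  the arrows of \<open>idx X\<close> that respect the subspaces. Its filteredness rests on pushing a
  subspace along an arrow and merging two subspaces over one index. That the equalizer is X again is
  the splitting of the fork of a coalgebra: \<rho> corestricts to the equalizer, and evaluation at
  the identity is inverse to it, by the counit law on one side and the defining equation on the
  other.\<close>

lemma category_idt: "category C \<Longrightarrow> x \<in> obs C \<Longrightarrow> idt C x \<in> homs C x x"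
  by (simp add: category_def)

lemma category_cmp:
  "category C \<Longrightarrow> x \<in> obs C \<Longrightarrow> y \<in> obs C \<Longrightarrow> z \<in> obs C \<Longrightarrow> f \<in> homs C x y \<Longrightarrow> g \<in> homs C y z \<Longrightarrow>
    cmp C x y z g f \<in> homs C x z"
  unfolding category_def by blast

lemma category_idt_right:
  "category C \<Longrightarrow> x \<in> obs C \<Longrightarrow> y \<in> obs C \<Longrightarrow> f \<in> homs C x y \<Longrightarrow> cmp C x x y f (idt C x) = f"
  unfolding category_def by blast

lemma category_idt_left:
  "category C \<Longrightarrow> x \<in> obs C \<Longrightarrow> y \<in> obs C \<Longrightarrow> f \<in> homs C x y \<Longrightarrow> cmp C x y y (idt C y) f = f"
  unfolding category_def by blast

lemma category_assoc:
  "category C \<Longrightarrow> w \<in> obs C \<Longrightarrow> x \<in> obs C \<Longrightarrow> y \<in> obs C \<Longrightarrow> z \<in> obs C \<Longrightarrow>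
    f \<in> homs C w x \<Longrightarrow> g \<in> homs C x y \<Longrightarrow> h \<in> homs C y z \<Longrightarrow>
    cmp C w y z h (cmp C w x y g f) = cmp C w x z (cmp C x y z h g) f"
  unfolding category_def by blast

lemma categoryI:
  assumes "\<And>x. x \<in> obs C \<Longrightarrow> idt C x \<in> homs C x x"
    and "\<And>x y z f g. x \<in> obs C \<Longrightarrow> y \<in> obs C \<Longrightarrow> z \<in> obs C \<Longrightarrow> f \<in> homs C x y \<Longrightarrow> g \<in> homs C y z \<Longrightarrow>
      cmp C x y z g f \<in> homs C x z"
    and "\<And>x y f. x \<in> obs C \<Longrightarrow> y \<in> obs C \<Longrightarrow> f \<in> homs C x y \<Longrightarrow> cmp C x x y f (idt C x) = f"
    and "\<And>x y f. x \<in> obs C \<Longrightarrow> y \<in> obs C \<Longrightarrow> f \<in> homs C x y \<Longrightarrow> cmp C x y y (idt C y) f = f"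
    and "\<And>w x y z f g h. w \<in> obs C \<Longrightarrow> x \<in> obs C \<Longrightarrow> y \<in> obs C \<Longrightarrow> z \<in> obs C \<Longrightarrow>
      f \<in> homs C w x \<Longrightarrow> g \<in> homs C x y \<Longrightarrow> h \<in> homs C y z \<Longrightarrow>
      cmp C w y z h (cmp C w x y g f) = cmp C w x z (cmp C x y z h g) f"
  shows "category C"
  unfolding category_def
  by (intro conjI ballI) (rule assms; assumption)+

lemma functor_obs: "is_functor C D F \<Longrightarrow> x \<in> obs C \<Longrightarrow> omap F x \<in> obs D"
  by (simp add: is_functor_def)

lemma functor_homs:
  "is_functor C D F \<Longrightarrow> x \<in> obs C \<Longrightarrow> y \<in> obs C \<Longrightarrow> f \<in> homs C x y \<Longrightarrow>
    amap F x y f \<in> homs D (omap F x) (omap F y)"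
  by (simp add: is_functor_def)

lemma functor_idt:
  "is_functor C D F \<Longrightarrow> x \<in> obs C \<Longrightarrow> amap F x x (idt C x) = idt D (omap F x)"
  by (simp add: is_functor_def)

lemma functor_cmp:
  "is_functor C D F \<Longrightarrow> x \<in> obs C \<Longrightarrow> y \<in> obs C \<Longrightarrow> z \<in> obs C \<Longrightarrow> f \<in> homs C x y \<Longrightarrow> g \<in> homs C y z \<Longrightarrow>
    amap F x z (cmp C x y z g f) =
    cmp D (omap F x) (omap F y) (omap F z) (amap F y z g) (amap F x y f)"
  by (simp add: is_functor_def)

section \<open>Categories of coalgebras\<close>

lemma category_coalgebras:
  assumes C: "category C" and T: "is_functor C C (endo T)"
  shows "category (coalgebras C T)"
proof (rule categoryI)
  show "idt (coalgebras C T) a \<in> homs (coalgebras C T) a a" if "a \<in> obs (coalgebras C T)" for a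
    using that C
    by (auto simp: coalgebras_def coalgebra_def Let_def category_idt functor_idt[OF T]
        category_idt_right category_idt_left functor_obs[OF T])
next
  fix a b c f g
  assume a: "a \<in> obs (coalgebras C T)" and b: "b \<in> obs (coalgebras C T)"
    and c: "c \<in> obs (coalgebras C T)"
    and f: "f \<in> homs (coalgebras C T) a b" and g: "g \<in> homs (coalgebras C T) b c"
  obtain x \<rho> y \<sigma> z \<tau> where abc: "a = (x, \<rho>)" "b = (y, \<sigma>)" "c = (z, \<tau>)"
    by (metis surj_pair)
  let ?T = "omap (endo T)" and ?A = "amap (endo T)"
  have o: "x \<in> obs C" "y \<in> obs C" "z \<in> obs C"
    and r: "\<rho> \<in> homs C x (?T x)" "\<sigma> \<in> homs C y (?T y)" "\<tau> \<in> homs C z (?T z)"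
    using a b c by (simp_all add: abc coalgebras_def coalgebra_def Let_def)
  have f: "f \<in> homs C x y" "cmp C x y (?T y) \<sigma> f = cmp C x (?T x) (?T y) (?A x y f) \<rho>"
    and g: "g \<in> homs C y z" "cmp C y z (?T z) \<tau> g = cmp C y (?T y) (?T z) (?A y z g) \<sigma>"
    using f g by (simp_all add: abc coalgebras_def)
  note t = functor_obs[OF T o(1)] functor_obs[OF T o(2)] functor_obs[OF T o(3)]
  note A = functor_homs[OF T o(1,2) f(1)] functor_homs[OF T o(2,3) g(1)]
  have "cmp C x z (?T z) \<tau> (cmp C x y z g f) = cmp C x y (?T z) (cmp C y z (?T z) \<tau> g) f"
    using category_assoc[OF C o(1-3) t(3) f(1) g(1) r(3)] .
  also have "\<dots> = cmp C x y (?T z) (cmp C y (?T y) (?T z) (?A y z g) \<sigma>) f"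
    by (simp add: g)
  also have "\<dots> = cmp C x (?T y) (?T z) (?A y z g) (cmp C x y (?T y) \<sigma> f)"
    using category_assoc[OF C o(1,2) t(2,3) f(1) r(2) A(2)] by simp
  also have "\<dots> = cmp C x (?T y) (?T z) (?A y z g) (cmp C x (?T x) (?T y) (?A x y f) \<rho>)"
    by (simp add: f)
  also have "\<dots> = cmp C x (?T x) (?T z) (?A x z (cmp C x y z g f)) \<rho>"
    using category_assoc[OF C o(1) t r(1) A] by (simp add: functor_cmp[OF T o f(1) g(1)])
  finally show "cmp (coalgebras C T) a b c g f \<in> homs (coalgebras C T) a c"
    using category_cmp[OF C o f(1) g(1)] by (simp add: abc coalgebras_def)
next
  show "cmp (coalgebras C T) a a b f (idt (coalgebras C T) a) = f"
    if "a \<in> obs (coalgebras C T)" "b \<in> obs (coalgebras C T)" "f \<in> homs (coalgebras C T) a b" for a b f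
    using that C
    by (auto simp: coalgebras_def coalgebra_def Let_def category_idt_right)
next
  show "cmp (coalgebras C T) a b b (idt (coalgebras C T) b) f = f"
    if "a \<in> obs (coalgebras C T)" "b \<in> obs (coalgebras C T)" "f \<in> homs (coalgebras C T) a b" for a b f
    using that C
    by (auto simp: coalgebras_def coalgebra_def Let_def category_idt_left)
next
  show "cmp (coalgebras C T) a c d h (cmp (coalgebras C T) a b c g f) =
      cmp (coalgebras C T) a b d (cmp (coalgebras C T) b c d h g) f"
    if "a \<in> obs (coalgebras C T)" "b \<in> obs (coalgebras C T)" "c \<in> obs (coalgebras C T)"
      "d \<in> obs (coalgebras C T)" "f \<in> homs (coalgebras C T) a b" "g \<in> homs (coalgebras C T) b c"
      "h \<in> homs (coalgebras C T) c d" for a b c d f g h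
    using that C
    by (auto simp: coalgebras_def coalgebra_def Let_def intro!: category_assoc)
qed

text \<open>The inverse g respects the coactions automatically: inserting T(g) T(f) = id in front of
  \<rho> g and moving \<rho> past f turns it into T(g) \<sigma>. So isomorphisms of coalgebras can
  be found in the base category.\<close>

lemma iso_arrow_coalgebras:
  assumes C: "category C" and T: "is_functor C C (endo T)"
    and a: "(x, \<rho>) \<in> obs (coalgebras C T)" and b: "(y, \<sigma>) \<in> obs (coalgebras C T)"
    and f: "f \<in> homs (coalgebras C T) (x, \<rho>) (y, \<sigma>)" and iso: "iso_arrow C x y f"
  shows "iso_arrow (coalgebras C T) (x, \<rho>) (y, \<sigma>) f"
proof -
  let ?T = "omap (endo T)" and ?A = "amap (endo T)"
  obtain g where g: "g \<in> homs C y x" "cmp C x y x g f = idt C x" "cmp C y x y f g = idt C y"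
    using iso by (auto simp: iso_arrow_def)
  have o: "x \<in> obs C" "y \<in> obs C" and r: "\<rho> \<in> homs C x (?T x)" "\<sigma> \<in> homs C y (?T y)"
    using a b by (simp_all add: coalgebras_def coalgebra_def Let_def)
  have fh: "f \<in> homs C x y" and fe: "cmp C x y (?T y) \<sigma> f = cmp C x (?T x) (?T y) (?A x y f) \<rho>"
    using f by (simp_all add: coalgebras_def)
  note t = functor_obs[OF T o(1)] functor_obs[OF T o(2)]
  note A = functor_homs[OF T o(1,2) fh] functor_homs[OF T o(2,1) g(1)]
  have rg: "cmp C y x (?T x) \<rho> g \<in> homs C y (?T x)"
    by (rule category_cmp[OF C o(2,1) t(1) g(1) r(1)])
  have "cmp C y x (?T x) \<rho> g = cmp C y (?T x) (?T x) (idt C (?T x)) (cmp C y x (?T x) \<rho> g)"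
    using category_idt_left[OF C o(2) t(1) rg] by simp
  also have "idt C (?T x) = cmp C (?T x) (?T y) (?T x) (?A y x g) (?A x y f)"
    using functor_cmp[OF T o(1,2,1) fh g(1)] by (simp add: g functor_idt[OF T o(1)])
  also have "cmp C y (?T x) (?T x) \<dots> (cmp C y x (?T x) \<rho> g) =
      cmp C y (?T y) (?T x) (?A y x g) (cmp C y (?T x) (?T y) (?A x y f) (cmp C y x (?T x) \<rho> g))"
    using category_assoc[OF C o(2) t(1,2,1) rg A] by simp
  also have "cmp C y (?T x) (?T y) (?A x y f) (cmp C y x (?T x) \<rho> g) =
      cmp C y x (?T y) (cmp C x (?T x) (?T y) (?A x y f) \<rho>) g"
    using category_assoc[OF C o(2,1) t g(1) r(1) A(1)] .
  also have "cmp C x (?T x) (?T y) (?A x y f) \<rho> = cmp C x y (?T y) \<sigma> f"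
    by (simp add: fe)
  also have "cmp C y x (?T y) (cmp C x y (?T y) \<sigma> f) g = cmp C y y (?T y) \<sigma> (cmp C y x y f g)"
    using category_assoc[OF C o(2,1,2) t(2) g(1) fh r(2)] by simp
  also have "\<dots> = \<sigma>"
    by (simp add: g category_idt_right[OF C o(2) t(2) r(2)])
  finally have "g \<in> homs (coalgebras C T) (y, \<sigma>) (x, \<rho>)"
    using g(1) by (simp add: coalgebras_def)
  then show ?thesis
    using f g by (auto simp: iso_arrow_def coalgebras_def)
qed

text \<open>When hom-sets, identities and composition of C are literally those of D, only essential
  surjectivity is left, and the laws of C are those of D. A quasi-inverse is built from chosen
  isomorphisms \<open>e y\<close> from F (G y) to y.\<close>

lemma equivalent_categoriesI:
  fixes C :: "('o, 'm) cat" and D :: "('p, 'm) cat"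
  assumes D: "category D"
    and F: "\<And>x. x \<in> obs C \<Longrightarrow> F x \<in> obs D"
    and hom: "\<And>x y. x \<in> obs C \<Longrightarrow> y \<in> obs C \<Longrightarrow> homs C x y = homs D (F x) (F y)"
    and idt: "\<And>x. x \<in> obs C \<Longrightarrow> idt C x = idt D (F x)"
    and cmp: "\<And>x y z. x \<in> obs C \<Longrightarrow> y \<in> obs C \<Longrightarrow> z \<in> obs C \<Longrightarrow>
      cmp C x y z = cmp D (F x) (F y) (F z)"
    and surj: "\<And>y. y \<in> obs D \<Longrightarrow> \<exists>x\<in>obs C. \<exists>f. iso_arrow D (F x) y f"
  shows "equivalent_categories C D"
proof -
  have C: "category C"
  proof (rule categoryI)
    show "idt C x \<in> homs C x x" if "x \<in> obs C" for x
      using that by (simp add: hom idt F category_idt[OF D])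
    show "cmp C x y z g f \<in> homs C x z"
      if "x \<in> obs C" "y \<in> obs C" "z \<in> obs C" "f \<in> homs C x y" "g \<in> homs C y z" for x y z f g
      using that category_cmp[OF D F F F] by (simp add: hom cmp)
    show "cmp C x x y f (idt C x) = f"
      if "x \<in> obs C" "y \<in> obs C" "f \<in> homs C x y" for x y f
      using that category_idt_right[OF D F F] by (simp add: hom cmp idt)
    show "cmp C x y y (idt C y) f = f"
      if "x \<in> obs C" "y \<in> obs C" "f \<in> homs C x y" for x y f
      using that category_idt_left[OF D F F] by (simp add: hom cmp idt)
    show "cmp C w y z h (cmp C w x y g f) = cmp C w x z (cmp C x y z h g) f"
      if "w \<in> obs C" "x \<in> obs C" "y \<in> obs C" "z \<in> obs C"
        "f \<in> homs C w x" "g \<in> homs C x y" "h \<in> homs C y z" for w x y z f g h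
      using that category_assoc[OF D F F F F] by (simp add: hom cmp)
  qed
  obtain G e where G: "\<And>y. y \<in> obs D \<Longrightarrow> G y \<in> obs C"
    and e: "\<And>y. y \<in> obs D \<Longrightarrow> iso_arrow D (F (G y)) y (e y)"
    using surj by metis
  have "\<exists>d. d \<in> homs D y (F (G y)) \<and> cmp D (F (G y)) y (F (G y)) d (e y) = idt D (F (G y)) \<and>
      cmp D y (F (G y)) y (e y) d = idt D y" if "y \<in> obs D" for y
    using e[OF that] unfolding iso_arrow_def by blast
  then obtain d where d: "\<And>y. y \<in> obs D \<Longrightarrow> d y \<in> homs D y (F (G y))"
    and de: "\<And>y. y \<in> obs D \<Longrightarrow> cmp D (F (G y)) y (F (G y)) (d y) (e y) = idt D (F (G y))"
    and ed: "\<And>y. y \<in> obs D \<Longrightarrow> cmp D y (F (G y)) y (e y) (d y) = idt D y"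
    by metis
  have eh: "e y \<in> homs D (F (G y)) y" if "y \<in> obs D" for y
    using e[OF that] by (simp add: iso_arrow_def)
  note FG = F[OF G]
  note comp = category_cmp[OF D] and assoc = category_assoc[OF D]
  \<comment> \<open>On arrows the quasi-inverse is forced by naturality: conjugation with the chosen
    isomorphisms.\<close>
  define A where "A y z f = cmp D (F (G y)) z (F (G z)) (d z) (cmp D (F (G y)) y z f (e y))"
    for y z f
  have A_hom: "A y z f \<in> homs D (F (G y)) (F (G z))"
    if "y \<in> obs D" "z \<in> obs D" "f \<in> homs D y z" for y z f
    unfolding A_def
    by (rule comp[OF FG[OF that(1)] that(2) FG[OF that(2)]
          comp[OF FG[OF that(1)] that(1,2) eh[OF that(1)] that(3)] d[OF that(2)]])
  have eA: "cmp D (F (G y)) (F (G z)) z (e z) (A y z f) = cmp D (F (G y)) y z f (e y)"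
    if y: "y \<in> obs D" and z: "z \<in> obs D" and f: "f \<in> homs D y z" for y z f
  proof -
    have h: "cmp D (F (G y)) y z f (e y) \<in> homs D (F (G y)) z"
      by (rule comp[OF FG[OF y] y z eh[OF y] f])
    show ?thesis
      unfolding A_def
      by (simp add: assoc[OF FG[OF y] z FG[OF z] z h d[OF z] eh[OF z]] ed[OF z]
          category_idt_left[OF D FG[OF y] z h])
  qed
  \<comment> \<open>Each \<open>e z\<close> has the left inverse \<open>d z\<close>, so equations
    between arrows into F (G z) may be checked after composing with \<open>e z\<close>.
    Functoriality on composites and naturality of the unit are proved in this way.\<close>
  have cancel: "f = g"
    if x: "x \<in> obs D" and z: "z \<in> obs D" and f: "f \<in> homs D x (F (G z))" and g: "g \<in> homs D x (F (G z))"
      and eq: "cmp D x (F (G z)) z (e z) f = cmp D x (F (G z)) z (e z) g" for x z f g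
  proof -
    have "cmp D x z (F (G z)) (d z) (cmp D x (F (G z)) z (e z) h) = h"
      if h: "h \<in> homs D x (F (G z))" for h
      by (simp add: assoc[OF x FG[OF z] z FG[OF z] h eh[OF z] d[OF z]] de[OF z]
          category_idt_left[OF D x FG[OF z] h])
    from this[OF f] this[OF g] show ?thesis unfolding eq by (rule trans[OF sym])
  qed
  have A_idt: "A y y (idt D y) = idt D (F (G y))" if y: "y \<in> obs D" for y
    by (simp add: A_def category_idt_left[OF D FG[OF y] y eh[OF y]] de[OF y])
  have A_cmp: "A x z (cmp D x y z g f) = cmp D (F (G x)) (F (G y)) (F (G z)) (A y z g) (A x y f)"
    if x: "x \<in> obs D" and y: "y \<in> obs D" and z: "z \<in> obs D"
      and f: "f \<in> homs D x y" and g: "g \<in> homs D y z" for x y z f g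
  proof (rule cancel[OF FG[OF x] z])
    note gf = comp[OF x y z f g]
    show "A x z (cmp D x y z g f) \<in> homs D (F (G x)) (F (G z))" by (rule A_hom[OF x z gf])
    show "cmp D (F (G x)) (F (G y)) (F (G z)) (A y z g) (A x y f) \<in> homs D (F (G x)) (F (G z))"
      by (rule comp[OF FG[OF x] FG[OF y] FG[OF z] A_hom[OF x y f] A_hom[OF y z g]])
    show "cmp D (F (G x)) (F (G z)) z (e z) (A x z (cmp D x y z g f)) =
        cmp D (F (G x)) (F (G z)) z (e z) (cmp D (F (G x)) (F (G y)) (F (G z)) (A y z g) (A x y f))"
      by (simp add: eA[OF x z gf] eA[OF x y f] eA[OF y z g]
          assoc[OF FG[OF x] FG[OF y] FG[OF z] z A_hom[OF x y f] A_hom[OF y z g] eh[OF z]]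
          assoc[OF FG[OF x] x y z eh[OF x] f g, symmetric]
          assoc[OF FG[OF x] FG[OF y] y z A_hom[OF x y f] eh[OF y] g, symmetric])
  qed
  let ?F = "\<lparr>omap = F, amap = \<lambda>x y f. f\<rparr> :: ('o, 'm, 'p, 'm) fctr"
  let ?G = "\<lparr>omap = G, amap = A\<rparr> :: ('p, 'm, 'o, 'm) fctr"
  have 1: "is_functor C D ?F"
    by (simp add: is_functor_def F hom idt cmp)
  have 2: "is_functor D C ?G"
    by (simp add: is_functor_def G hom idt cmp A_hom A_idt A_cmp)
  \<comment> \<open>The unit at x is the inverse isomorphism at F x. It is an arrow of C because the
    hom-sets coincide.\<close>
  have 3: "natural_iso C C id_functor (comp_functor ?G ?F) (\<lambda>x. d (F x))"
    unfolding natural_iso_def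
  proof (intro conjI ballI)
    fix x assume x: "x \<in> obs C"
    note Fx = F[OF x]
    have "iso_arrow C x (G (F x)) (d (F x))"
      unfolding iso_arrow_def
      by (rule conjI, simp add: hom x G[OF Fx] d[OF Fx], rule bexI[of _ "e (F x)"])
        (simp_all add: hom x G[OF Fx] eh[OF Fx] cmp idt de[OF Fx] ed[OF Fx])
    then show "iso_arrow C (omap id_functor x) (omap (comp_functor ?G ?F) x) (d (F x))"
      by (simp add: id_functor_def comp_functor_def)
  next
    fix x y f assume x: "x \<in> obs C" and y: "y \<in> obs C" and f: "f \<in> homs C x y"
    note Fx = F[OF x] and Fy = F[OF y]
    have f: "f \<in> homs D (F x) (F y)" using f x y by (simp add: hom)
    have "cmp D (F x) (F y) (F (G (F y))) (d (F y)) f =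
        cmp D (F x) (F (G (F x))) (F (G (F y))) (A (F x) (F y) f) (d (F x))"
    proof (rule cancel[OF Fx Fy])
      show "cmp D (F x) (F y) (F (G (F y))) (d (F y)) f \<in> homs D (F x) (F (G (F y)))"
        by (rule comp[OF Fx Fy FG[OF Fy] f d[OF Fy]])
      show "cmp D (F x) (F (G (F x))) (F (G (F y))) (A (F x) (F y) f) (d (F x)) \<in>
          homs D (F x) (F (G (F y)))"
        by (rule comp[OF Fx FG[OF Fx] FG[OF Fy] d[OF Fx] A_hom[OF Fx Fy f]])
      show "cmp D (F x) (F (G (F y))) (F y) (e (F y)) (cmp D (F x) (F y) (F (G (F y))) (d (F y)) f) =
          cmp D (F x) (F (G (F y))) (F y) (e (F y))
            (cmp D (F x) (F (G (F x))) (F (G (F y))) (A (F x) (F y) f) (d (F x)))"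
        by (simp add: assoc[OF Fx Fy FG[OF Fy] Fy f d[OF Fy] eh[OF Fy]] ed[OF Fy]
            category_idt_left[OF D Fx Fy f] category_idt_right[OF D Fx Fy f]
            assoc[OF Fx FG[OF Fx] FG[OF Fy] Fy d[OF Fx] A_hom[OF Fx Fy f] eh[OF Fy]]
            eA[OF Fx Fy f] assoc[OF Fx FG[OF Fx] Fx Fy d[OF Fx] eh[OF Fx] f, symmetric] ed[OF Fx])
    qed
    then show "cmp C (omap id_functor x) (omap id_functor y) (omap (comp_functor ?G ?F) y)
        (d (F y)) (amap id_functor x y f) =
      cmp C (omap id_functor x) (omap (comp_functor ?G ?F) x) (omap (comp_functor ?G ?F) y)
        (amap (comp_functor ?G ?F) x y f) (d (F x))"
      by (simp add: id_functor_def comp_functor_def cmp x y G[OF Fx] G[OF Fy])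
  qed
  have 4: "natural_iso D D (comp_functor ?F ?G) id_functor e"
    by (simp add: natural_iso_def id_functor_def comp_functor_def e eA)
  show ?thesis
    unfolding equivalent_categories_def
    by (intro conjI exI[of _ ?F] exI[of _ ?G] exI[of _ "\<lambda>x. d (F x)"] exI[of _ e]) (rule C D 1 2 3 4)+
qed

section \<open>Banach spaces\<close>

lemma field_ring_simps [simp]:
  "carrier field_ring = UNIV" "\<one>\<^bsub>field_ring\<^esub> = 1" "\<zero>\<^bsub>field_ring\<^esub> = 0"
  "a \<otimes>\<^bsub>field_ring\<^esub> b = a * b" "a \<oplus>\<^bsub>field_ring\<^esub> b = a + b"
  by (simp_all add: field_ring_def)

lemma cring_field_ring: "cring (field_ring :: 'k::field ring)"
proof (rule cringI)
  show "abelian_group (field_ring :: 'k ring)"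
    by (rule abelian_groupI) (auto simp: algebra_simps intro: exI[of _ "- x" for x])
  show "Group.comm_monoid (field_ring :: 'k ring)"
    by unfold_locales (auto simp: algebra_simps)
qed (simp add: algebra_simps)

text \<open>The value v 1 is a nonzero idempotent, hence 1, and v (- 1) is a nonnegative number with
  square 1.\<close>

lemma valued_minus_one:
  assumes "complete_valued_field v"
  shows "v (- 1) = 1"
proof -
  have nn: "v x \<ge> 0" and m: "v (x * y) = v x * v y" and z: "v x = 0 \<longleftrightarrow> x = 0" for x y
    using assms by (simp_all add: complete_valued_field_def)
  have "v 1 * v 1 = v 1 * 1" using m[of 1 1] by simp
  then have "v 1 = 1" using z[of 1] by simp
  then have "v (-1) * v (-1) = 1" using m[of "-1" "-1"] by simp
  then have "v (-1) = 1 \<or> v (-1) = -1" by (simp add: square_eq_1_iff)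
  then show ?thesis using nn[of "-1"] by linarith
qed

locale banach_module =
  fixes v :: "'k::field \<Rightarrow> real" and s :: bool and V :: "('k, 'u) nmod" (structure)
  assumes valued: "complete_valued_field v" and banach: "banach v s V"
begin

sublocale module field_ring V
  using banach by (simp add: banach_def)

text \<open>The module laws of the library mention the operations of \<open>field_ring\<close>,
  which \<open>field_ring_simps\<close> rewrites to those of the type of scalars. Here they are
  restated in that normal form.\<close>

lemma smult_1 [simp]: "x \<in> carrier V \<Longrightarrow> 1 \<odot> x = x"
  using smult_one[of x] by (simp del: smult_one)

lemma smult_0 [simp]: "x \<in> carrier V \<Longrightarrow> 0 \<odot> x = \<zero>"
  using smult_l_null[of x] by (simp del: smult_l_null)

lemma smult_add: "x \<in> carrier V \<Longrightarrow> (a + b) \<odot> x = a \<odot> x \<oplus> b \<odot> x"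
  using smult_l_distr[of a b x] by simp

lemma smult_mult: "x \<in> carrier V \<Longrightarrow> (a * b) \<odot> x = a \<odot> (b \<odot> x)"
  using smult_assoc1[of a b x] by simp

lemma nrm_ge0: "x \<in> carrier V \<Longrightarrow> 0 \<le> nrm V x"
  using banach by (simp add: banach_def)

lemma nrm_eq0: "x \<in> carrier V \<Longrightarrow> nrm V x = 0 \<longleftrightarrow> x = \<zero>"
  using banach by (simp add: banach_def)

lemma nrm_zero [simp]: "nrm V \<zero> = 0"
  by (simp add: nrm_eq0)

lemma nrm_smult: "x \<in> carrier V \<Longrightarrow> nrm V (c \<odot> x) = v c * nrm V x"
  using banach by (simp add: banach_def)

lemma nrm_add: "x \<in> carrier V \<Longrightarrow> y \<in> carrier V \<Longrightarrow> nrm V (x \<oplus> y) \<le> nrm V x + nrm V y"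
  using banach by (simp add: banach_def)

lemma nrm_add_strong:
  "s \<Longrightarrow> x \<in> carrier V \<Longrightarrow> y \<in> carrier V \<Longrightarrow> nrm V (x \<oplus> y) \<le> max (nrm V x) (nrm V y)"
  using banach by (simp add: banach_def)

lemma cauchy_limit:
  assumes "\<And>n. X n \<in> carrier V"
    and "\<And>e. e > 0 \<Longrightarrow> \<exists>N::nat. \<forall>m\<ge>N. \<forall>n\<ge>N. nrm V (X m \<ominus> X n) < e"
  shows "\<exists>l\<in>carrier V. (\<lambda>n. nrm V (X n \<ominus> l)) \<longlonglongrightarrow> 0"
  using banach assms unfolding banach_def by blast

lemma uminus_eq_smult: "x \<in> carrier V \<Longrightarrow> \<ominus> x = (- 1) \<odot> x"
  using smult_add[of x "-1" 1] by (intro minus_equality) auto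

lemma nrm_uminus [simp]: "x \<in> carrier V \<Longrightarrow> nrm V (\<ominus> x) = nrm V x"
  by (simp add: uminus_eq_smult nrm_smult valued_minus_one[OF valued])

lemma nrm_minus_commute:
  assumes "x \<in> carrier V" "y \<in> carrier V"
  shows "nrm V (x \<ominus> y) = nrm V (y \<ominus> x)"
proof -
  have "\<ominus> (y \<ominus> x) = x \<ominus> y"
    using assms by (simp add: a_minus_def minus_add a_comm)
  then show ?thesis using nrm_uminus[of "y \<ominus> x"] assms by simp
qed

lemma diff_add_diff:
  "x \<in> carrier V \<Longrightarrow> y \<in> carrier V \<Longrightarrow> z \<in> carrier V \<Longrightarrow> (x \<ominus> y) \<oplus> (y \<ominus> z) = x \<ominus> z"
  by (simp add: a_minus_def a_assoc r_neg1)

lemma add_diff_add: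
  assumes "x \<in> carrier V" "x' \<in> carrier V" "y \<in> carrier V" "y' \<in> carrier V"
  shows "(x \<oplus> y) \<ominus> (x' \<oplus> y') = (x \<ominus> x') \<oplus> (y \<ominus> y')"
  using assms by (simp add: a_minus_def minus_add a_ac)

lemma diff_eq_zero: "x \<in> carrier V \<Longrightarrow> y \<in> carrier V \<Longrightarrow> x \<ominus> y = \<zero> \<longleftrightarrow> x = y"
  by (metis a_minus_def a_inv_closed minus_equality minus_minus r_neg)

lemma nrm_diff_triangle:
  "x \<in> carrier V \<Longrightarrow> y \<in> carrier V \<Longrightarrow> z \<in> carrier V \<Longrightarrow>
    nrm V (x \<ominus> z) \<le> nrm V (x \<ominus> y) + nrm V (y \<ominus> z)"
  using nrm_add[of "x \<ominus> y" "y \<ominus> z"] by (simp add: diff_add_diff)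

lemma nrm_diff_le:
  "x \<in> carrier V \<Longrightarrow> y \<in> carrier V \<Longrightarrow> nrm V (x \<ominus> y) \<le> nrm V x + nrm V y"
  using nrm_add[of x "\<ominus> y"] by (simp add: a_minus_def)

lemma nrm_le_diff:
  "x \<in> carrier V \<Longrightarrow> y \<in> carrier V \<Longrightarrow> nrm V x \<le> nrm V (x \<ominus> y) + nrm V y"
  using nrm_add[of "x \<ominus> y" y] by (simp add: a_minus_def a_assoc l_neg)

lemma limit_unique:
  assumes X: "\<And>n. X n \<in> carrier V" and l: "l \<in> carrier V" and m: "m \<in> carrier V"
    and "(\<lambda>n. nrm V (X n \<ominus> l)) \<longlonglongrightarrow> 0" and "(\<lambda>n. nrm V (X n \<ominus> m)) \<longlonglongrightarrow> 0"
  shows "l = m"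
proof -
  have "(\<lambda>n. nrm V (X n \<ominus> l) + nrm V (X n \<ominus> m)) \<longlonglongrightarrow> 0 + 0"
    by (intro tendsto_add assms)
  moreover have "nrm V (l \<ominus> m) \<le> nrm V (X n \<ominus> l) + nrm V (X n \<ominus> m)" for n
    using nrm_diff_triangle[OF l X m, of n] nrm_minus_commute[OF l X, of n] by simp
  ultimately have "nrm V (l \<ominus> m) \<le> 0"
    using LIMSEQ_le_const by fastforce
  then have "nrm V (l \<ominus> m) = 0"
    using nrm_ge0[of "l \<ominus> m"] l m by simp
  then show ?thesis
    using l m by (simp add: nrm_eq0 diff_eq_zero)
qed

text \<open>Operations and norm are taken over unchanged, so the norm laws are inherited; a Cauchy
  sequence converges in V, and sequential closedness keeps its limit in S.\<close>

lemma banach_closed_subspace: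
  assumes S: "S \<subseteq> carrier V" and zero: "\<zero> \<in> S"
    and add: "\<And>x y. x \<in> S \<Longrightarrow> y \<in> S \<Longrightarrow> x \<oplus> y \<in> S"
    and smult: "\<And>c x. x \<in> S \<Longrightarrow> c \<odot> x \<in> S"
    and closed: "\<And>X l. (\<And>n::nat. X n \<in> S) \<Longrightarrow> l \<in> carrier V \<Longrightarrow> (\<lambda>n. nrm V (X n \<ominus> l)) \<longlonglongrightarrow> 0 \<Longrightarrow> l \<in> S"
  shows "banach v s (V\<lparr>carrier := S\<rparr>)"
proof -
  let ?S = "V\<lparr>carrier := S\<rparr>"
  have c: "x \<in> carrier V" if "x \<in> S" for x using that S by auto
  have ag: "abelian_group ?S"
  proof (rule abelian_groupI)
    show "\<exists>y\<in>carrier ?S. y \<oplus>\<^bsub>?S\<^esub> x = \<zero>\<^bsub>?S\<^esub>" if "x \<in> carrier ?S" for x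
      using that smult[of x "-1"] by (intro bexI[of _ "\<ominus> x"]) (auto simp: c uminus_eq_smult[symmetric] l_neg)
  qed (auto simp: zero add c a_ac)
  interpret S: abelian_group ?S by (rule ag)
  have mod: "module field_ring ?S"
    by (rule moduleI[OF cring_field_ring ag])
      (simp_all add: smult c smult_add smult_r_distr smult_mult)
  \<comment> \<open>The additive inverse in a record is a description over its carrier. It changes
    its meaning with the carrier and has to be identified with the inverse in V.\<close>
  have neg: "\<ominus>\<^bsub>?S\<^esub> x = \<ominus> x" if "x \<in> S" for x
    using that smult[of x "-1"] by (intro S.minus_equality) (auto simp: c uminus_eq_smult[symmetric] l_neg)
  have diff: "x \<ominus>\<^bsub>?S\<^esub> y = x \<ominus> y" if "y \<in> S" for x y
    by (simp add: a_minus_def neg[OF that])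
  have "\<exists>l\<in>S. (\<lambda>n. nrm V (X n \<ominus>\<^bsub>?S\<^esub> l)) \<longlonglongrightarrow> 0"
    if X: "\<And>n. X n \<in> S" and C: "\<And>e. e > 0 \<Longrightarrow> \<exists>N::nat. \<forall>m\<ge>N. \<forall>n\<ge>N. nrm V (X m \<ominus>\<^bsub>?S\<^esub> X n) < e" for X
  proof -
    obtain l where "l \<in> carrier V" "(\<lambda>n. nrm V (X n \<ominus> l)) \<longlonglongrightarrow> 0"
      using cauchy_limit[of X, OF c[OF X]] C by (auto simp: X diff)
    with closed[OF X this] show ?thesis by (auto simp: diff)
  qed
  then show ?thesis
    unfolding banach_def
    using mod by (simp add: c nrm_ge0 nrm_eq0 nrm_smult nrm_add nrm_add_strong)
qed

end

section \<open>Bounded linear maps\<close>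

lemma bhomI:
  assumes "f \<in> extensional (carrier V)" "\<And>x. x \<in> carrier V \<Longrightarrow> f x \<in> carrier W"
    and "\<And>x y. x \<in> carrier V \<Longrightarrow> y \<in> carrier V \<Longrightarrow> f (x \<oplus>\<^bsub>V\<^esub> y) = f x \<oplus>\<^bsub>W\<^esub> f y"
    and "\<And>c x. x \<in> carrier V \<Longrightarrow> f (c \<odot>\<^bsub>V\<^esub> x) = c \<odot>\<^bsub>W\<^esub> f x"
    and "\<And>x. x \<in> carrier V \<Longrightarrow> nrm W (f x) \<le> M * nrm V x"
  shows "f \<in> bhom V W"
  unfolding bhom_def by (auto simp: PiE_iff assms intro: exI[of _ M])

lemma bhom_closed: "f \<in> bhom V W \<Longrightarrow> x \<in> carrier V \<Longrightarrow> f x \<in> carrier W"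
  and bhom_extensional: "f \<in> bhom V W \<Longrightarrow> f \<in> extensional (carrier V)"
  and bhom_add: "f \<in> bhom V W \<Longrightarrow> x \<in> carrier V \<Longrightarrow> y \<in> carrier V \<Longrightarrow> f (x \<oplus>\<^bsub>V\<^esub> y) = f x \<oplus>\<^bsub>W\<^esub> f y"
  and bhom_smult: "f \<in> bhom V W \<Longrightarrow> x \<in> carrier V \<Longrightarrow> f (c \<odot>\<^bsub>V\<^esub> x) = c \<odot>\<^bsub>W\<^esub> f x"
  by (auto simp: bhom_def PiE_iff)

text \<open>The constant in \<open>bhom\<close> may be negative, for instance on the zero space.
  Later estimates multiply inequalities by it and therefore need it nonnegative.\<close>

lemma bhom_bound:
  assumes "banach_module v s V" "f \<in> bhom V W"
  obtains M where "M \<ge> 0" "\<And>x. x \<in> carrier V \<Longrightarrow> nrm W (f x) \<le> M * nrm V x"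
proof -
  obtain M where M: "\<And>x. x \<in> carrier V \<Longrightarrow> nrm W (f x) \<le> M * nrm V x"
    using assms(2) unfolding bhom_def by blast
  have "nrm W (f x) \<le> max M 0 * nrm V x" if "x \<in> carrier V" for x
    using M[OF that] mult_right_mono[of M "max M 0" "nrm V x"] banach_module.nrm_ge0[OF assms(1) that]
    by linarith
  then show ?thesis using that[of "max M 0"] by simp
qed

lemma bhom_diff:
  assumes V: "banach_module v s V" and W: "banach_module v s W" and f: "f \<in> bhom V W"
    and x: "x \<in> carrier V" and y: "y \<in> carrier V"
  shows "f (x \<ominus>\<^bsub>V\<^esub> y) = f x \<ominus>\<^bsub>W\<^esub> f y"
proof -
  interpret V: banach_module v s V by (rule V)
  interpret W: banach_module v s W by (rule W)
  show ?thesis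
    using x y bhom_closed[OF f]
    by (simp add: a_minus_def bhom_add[OF f] V.uminus_eq_smult W.uminus_eq_smult bhom_smult[OF f])
qed

lemma bhom_zero:
  assumes V: "banach_module v s V" and W: "banach_module v s W" and f: "f \<in> bhom V W"
  shows "f \<zero>\<^bsub>V\<^esub> = \<zero>\<^bsub>W\<^esub>"
proof -
  interpret V: banach_module v s V by (rule V)
  interpret W: banach_module v s W by (rule W)
  show ?thesis
    using bhom_smult[OF f V.zero_closed, of 0] bhom_closed[OF f V.zero_closed] by simp
qed

lemma bhom_tendsto:
  assumes V: "banach_module v s V" and W: "banach_module v s W" and f: "f \<in> bhom V W"
    and X: "\<And>n. X n \<in> carrier V" and l: "l \<in> carrier V"
    and lim: "(\<lambda>n. nrm V (X n \<ominus>\<^bsub>V\<^esub> l)) \<longlonglongrightarrow> 0"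
  shows "(\<lambda>n. nrm W (f (X n) \<ominus>\<^bsub>W\<^esub> f l)) \<longlonglongrightarrow> 0"
proof -
  interpret V: banach_module v s V by (rule V)
  interpret W: banach_module v s W by (rule W)
  obtain M where M: "\<And>x. x \<in> carrier V \<Longrightarrow> nrm W (f x) \<le> M * nrm V x"
    using bhom_bound[OF V f] by blast
  have "(\<lambda>n. M * nrm V (X n \<ominus>\<^bsub>V\<^esub> l)) \<longlonglongrightarrow> M * 0"
    by (intro tendsto_mult tendsto_const lim)
  then have lim: "(\<lambda>n. M * nrm V (X n \<ominus>\<^bsub>V\<^esub> l)) \<longlonglongrightarrow> 0" by simp
  have "nrm W (f (X n) \<ominus>\<^bsub>W\<^esub> f l) \<le> M * nrm V (X n \<ominus>\<^bsub>V\<^esub> l)" for n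
    using M[of "X n \<ominus>\<^bsub>V\<^esub> l"] X l bhom_diff[OF V W f X l] by simp
  then show ?thesis
    by (intro tendsto_sandwich[OF _ _ tendsto_const lim])
      (auto intro!: always_eventually W.nrm_ge0 bhom_closed[OF f] X l W.minus_closed)
qed

lemma bhom_compose:
  assumes "f \<in> bhom V W" "g \<in> bhom W Z" "banach_module v s W" "banach_module v s V"
  shows "compose (carrier V) g f \<in> bhom V Z"
proof -
  interpret V: banach_module v s V by fact
  obtain M where M: "\<And>x. x \<in> carrier V \<Longrightarrow> nrm W (f x) \<le> M * nrm V x"
    using assms(1) unfolding bhom_def by blast
  obtain N where N: "N \<ge> 0" "\<And>x. x \<in> carrier W \<Longrightarrow> nrm Z (g x) \<le> N * nrm W x"
    using bhom_bound[OF assms(3,2)] by blast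
  show ?thesis
  proof (rule bhomI)
    show "nrm Z (compose (carrier V) g f x) \<le> (N * M) * nrm V x" if "x \<in> carrier V" for x
      using N(2)[OF bhom_closed[OF assms(1) that]] mult_left_mono[OF M[OF that] N(1)] that
      by (simp add: compose_eq mult.assoc)
  qed (simp_all add: compose_def bhom_closed[OF assms(1)] bhom_closed[OF assms(2)]
      bhom_add[OF assms(1)] bhom_add[OF assms(2)] bhom_smult[OF assms(1)] bhom_smult[OF assms(2)])
qed

lemma bhom_idt: "banach_module v s V \<Longrightarrow> (\<lambda>x\<in>carrier V. x) \<in> bhom V V"
proof -
  assume "banach_module v s V"
  then interpret banach_module v s V .
  show ?thesis by (rule bhomI[where M = 1]) auto
qed

text \<open>Bounded maps are continuous and limits are unique. This is the reason why the equalizers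
  used below are closed subspaces.\<close>

lemma bhom_eq_locus_closed:
  assumes V: "banach_module v s V" and W: "banach_module v s W"
    and f: "f \<in> bhom V W" and g: "g \<in> bhom V W"
    and X: "\<And>n. X n \<in> carrier V" and l: "l \<in> carrier V"
    and lim: "(\<lambda>n. nrm V (X n \<ominus>\<^bsub>V\<^esub> l)) \<longlonglongrightarrow> 0" and eq: "\<And>n. f (X n) = g (X n)"
  shows "f l = g l"
proof (rule banach_module.limit_unique[OF W])
  show "(\<lambda>n. nrm W (f (X n) \<ominus>\<^bsub>W\<^esub> f l)) \<longlonglongrightarrow> 0"
    by (rule bhom_tendsto[OF V W f X l lim])
  show "(\<lambda>n. nrm W (f (X n) \<ominus>\<^bsub>W\<^esub> g l)) \<longlonglongrightarrow> 0"
    unfolding eq by (rule bhom_tendsto[OF V W g X l lim])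
qed (auto intro: bhom_closed[OF f] bhom_closed[OF g] X l)

section \<open>Ind-objects\<close>

lemma filtered_category: "filtered I \<Longrightarrow> category I"
  by (simp add: filtered_def)

lemma filtered_upper:
  assumes "filtered I" "i \<in> obs I" "j \<in> obs I"
  obtains l p q where "l \<in> obs I" "p \<in> homs I i l" "q \<in> homs I j l"
  using assms unfolding filtered_def by blast

lemma filtered_coeq:
  assumes "filtered I" "i \<in> obs I" "j \<in> obs I" "p \<in> homs I i j" "q \<in> homs I i j"
  obtains l r where "l \<in> obs I" "r \<in> homs I j l" "cmp I i j l r p = cmp I i j l r q"
  using assms unfolding filtered_def by blast

text \<open>An upper bound of j and k need not make the square over i commute; coequalizing the two
  composites out of i repairs this.\<close>

lemma filtered_span:
  assumes I: "filtered I" and o: "i \<in> obs I" "j \<in> obs I" "k \<in> obs I"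
    and u: "u \<in> homs I i j" and w: "w \<in> homs I i k"
  obtains l p q where "l \<in> obs I" "p \<in> homs I j l" "q \<in> homs I k l"
    "cmp I i j l p u = cmp I i k l q w"
proof -
  note C = filtered_category[OF I]
  obtain m a b where m: "m \<in> obs I" "a \<in> homs I j m" "b \<in> homs I k m"
    by (rule filtered_upper[OF I o(2,3)])
  obtain l r where l: "l \<in> obs I" "r \<in> homs I m l"
    "cmp I i m l r (cmp I i j m a u) = cmp I i m l r (cmp I i k m b w)"
    by (rule filtered_coeq[OF I o(1) m(1) category_cmp[OF C o(1,2) m(1) u m(2)]
          category_cmp[OF C o(1,3) m(1) w m(3)]])
  show thesis
  proof (rule that)
    show "cmp I i j l (cmp I j m l r a) u = cmp I i k l (cmp I k m l r b) w"
      using l(3) category_assoc[OF C o(1,2) m(1) l(1) u m(2) l(2)]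
        category_assoc[OF C o(1,3) m(1) l(1) w m(3) l(2)] by simp
  qed (use category_cmp[OF C o(2) m(1) l(1) m(2) l(2)] category_cmp[OF C o(3) m(1) l(1) m(3) l(2)]
      l(1) in auto)
qed

section \<open>Ind-objects, eventual equality and filtered colimits of sets of maps\<close>

locale ind_banach =
  fixes v :: "'k::field \<Rightarrow> real" and s :: bool and X :: "('k, 'u) ind"
  assumes valued: "complete_valued_field v" and ind: "ind_object v s X"
begin

abbreviation tr :: "'u \<Rightarrow> 'u \<Rightarrow> 'u \<Rightarrow> 'u \<Rightarrow> 'u" where
  "tr \<equiv> amap (dgm X)"

lemma filtered_idx: "filtered (idx X)"
  and functor_dgm: "is_functor (idx X) (Ban v s) (dgm X)"
  using ind by (simp_all add: ind_object_def)

lemmas category_idx = filtered_category[OF filtered_idx]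

lemma sp_banach: "i \<in> ix X \<Longrightarrow> banach_module v s (sp X i)"
  using functor_obs[OF functor_dgm] valued by (simp add: Ban_def banach_module_def)

lemma tr_bhom:
  "i \<in> ix X \<Longrightarrow> j \<in> ix X \<Longrightarrow> u \<in> homs (idx X) i j \<Longrightarrow> tr i j u \<in> bhom (sp X i) (sp X j)"
  using functor_homs[OF functor_dgm] by (simp add: Ban_def)

lemma tr_closed:
  "i \<in> ix X \<Longrightarrow> j \<in> ix X \<Longrightarrow> u \<in> homs (idx X) i j \<Longrightarrow> x \<in> carrier (sp X i) \<Longrightarrow>
    tr i j u x \<in> carrier (sp X j)"
  by (rule bhom_closed[OF tr_bhom])

lemma tr_idt: "i \<in> ix X \<Longrightarrow> x \<in> carrier (sp X i) \<Longrightarrow> tr i i (idt (idx X) i) x = x"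
  using functor_idt[OF functor_dgm] by (simp add: Ban_def)

lemma tr_cmp:
  "i \<in> ix X \<Longrightarrow> j \<in> ix X \<Longrightarrow> l \<in> ix X \<Longrightarrow> u \<in> homs (idx X) i j \<Longrightarrow> w \<in> homs (idx X) j l \<Longrightarrow>
    x \<in> carrier (sp X i) \<Longrightarrow> tr i l (cmp (idx X) i j l w u) x = tr j l w (tr i j u x)"
  using functor_cmp[OF functor_dgm] by (simp add: Ban_def compose_eq)

lemma tr_span:
  assumes o: "i \<in> ix X" "j \<in> ix X" "k \<in> ix X"
    and u: "u \<in> homs (idx X) i j" and w: "w \<in> homs (idx X) i k"
  obtains l p q where "l \<in> ix X" "p \<in> homs (idx X) j l" "q \<in> homs (idx X) k l"
    "\<And>x. x \<in> carrier (sp X i) \<Longrightarrow> tr j l p (tr i j u x) = tr k l q (tr i k w x)"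
proof -
  obtain l p q where l: "l \<in> ix X" "p \<in> homs (idx X) j l" "q \<in> homs (idx X) k l"
    and e: "cmp (idx X) i j l p u = cmp (idx X) i k l q w"
    by (rule filtered_span[OF filtered_idx o u w])
  show thesis
    by (rule that[OF l]) (use tr_cmp[OF o(1,2) l(1) u l(2)] tr_cmp[OF o(1,3) l(1) w l(3)] e in simp)
qed

lemma ev_eq_refl: "j \<in> ix X \<Longrightarrow> (\<And>x. x \<in> D \<Longrightarrow> f x = f' x) \<Longrightarrow> ev_eq X D j f j f'"
  using category_idt[OF category_idx, of j] by (auto simp: ev_eq_def)

lemma ev_eq_sym: "ev_eq X D j f j' f' \<Longrightarrow> ev_eq X D j' f' j f"
  unfolding ev_eq_def by metis

lemma ev_eqI:
  "l \<in> ix X \<Longrightarrow> p \<in> homs (idx X) j l \<Longrightarrow> q \<in> homs (idx X) j' l \<Longrightarrow>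
    (\<And>x. x \<in> D \<Longrightarrow> tr j l p (f x) = tr j' l q (f' x)) \<Longrightarrow> ev_eq X D j f j' f'"
  unfolding ev_eq_def by blast

lemma ev_eqE:
  assumes "ev_eq X D j f j' f'"
  obtains l p q where "l \<in> ix X" "p \<in> homs (idx X) j l" "q \<in> homs (idx X) j' l"
    "\<And>x. x \<in> D \<Longrightarrow> tr j l p (f x) = tr j' l q (f' x)"
  using assms unfolding ev_eq_def by blast

text \<open>The two comparison indices are joined over the middle index j'. Values have to lie in
  the carriers, since transition maps are known to compose correctly only there.\<close>

lemma ev_eq_trans:
  assumes o: "j \<in> ix X" "j' \<in> ix X" "j'' \<in> ix X"
    and f: "f \<in> D \<rightarrow> carrier (sp X j)" "f' \<in> D \<rightarrow> carrier (sp X j')" "f'' \<in> D \<rightarrow> carrier (sp X j'')"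
    and e: "ev_eq X D j f j' f'" "ev_eq X D j' f' j'' f''"
  shows "ev_eq X D j f j'' f''"
proof -
  obtain l p q where l: "l \<in> ix X" "p \<in> homs (idx X) j l" "q \<in> homs (idx X) j' l"
    and lx: "\<And>x. x \<in> D \<Longrightarrow> tr j l p (f x) = tr j' l q (f' x)"
    by (rule ev_eqE[OF e(1)]) blast
  obtain l' p' q' where l': "l' \<in> ix X" "p' \<in> homs (idx X) j' l'" "q' \<in> homs (idx X) j'' l'"
    and lx': "\<And>x. x \<in> D \<Longrightarrow> tr j' l' p' (f' x) = tr j'' l' q' (f'' x)"
    by (rule ev_eqE[OF e(2)]) blast
  obtain m a b where m: "m \<in> ix X" "a \<in> homs (idx X) l m" "b \<in> homs (idx X) l' m"
    and mx: "\<And>x. x \<in> carrier (sp X j') \<Longrightarrow> tr l m a (tr j' l q x) = tr l' m b (tr j' l' p' x)"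
    by (rule tr_span[OF o(2) l(1) l'(1) l(3) l'(2)]) blast
  show ?thesis
  proof (rule ev_eqI[OF m(1)])
    show "cmp (idx X) j l m a p \<in> homs (idx X) j m"
      by (rule category_cmp[OF category_idx o(1) l(1) m(1) l(2) m(2)])
    show "cmp (idx X) j'' l' m b q' \<in> homs (idx X) j'' m"
      by (rule category_cmp[OF category_idx o(3) l'(1) m(1) l'(3) m(3)])
    fix x assume x: "x \<in> D"
    with f have "f x \<in> carrier (sp X j)" "f' x \<in> carrier (sp X j')" "f'' x \<in> carrier (sp X j'')"
      by auto
    with x show "tr j m (cmp (idx X) j l m a p) (f x) = tr j'' m (cmp (idx X) j'' l' m b q') (f'' x)"
      by (simp add: tr_cmp[OF o(1) l(1) m(1) l(2) m(2)] tr_cmp[OF o(3) l'(1) m(1) l'(3) m(3)]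
          lx lx'[symmetric] mx)
  qed
qed

lemma ev_eq_push:
  assumes "j \<in> ix X" "l \<in> ix X" "u \<in> homs (idx X) j l" "f \<in> D \<rightarrow> carrier (sp X j)"
    "\<And>x. x \<in> D \<Longrightarrow> f' x = tr j l u (f x)"
  shows "ev_eq X D j f l f'"
proof (rule ev_eqI[OF assms(2,3) category_idt[OF category_idx assms(2)]])
  show "tr j l u (f x) = tr l l (idt (idx X) l) (f' x)" if "x \<in> D" for x
    using assms that tr_idt[OF assms(2) tr_closed[OF assms(1-3)], of "f x"] by (auto simp: Pi_iff)
qed

text \<open>Eventual equality is stable under any reparametrization k of the arguments. Only values
  on E count, so g and g' may be given by other expressions that agree there; most comparisons below
  are obtained from known ones in this way.\<close>

lemma ev_eq_comp:
  "ev_eq X D j f j' f' \<Longrightarrow> k \<in> E \<rightarrow> D \<Longrightarrow> (\<And>x. x \<in> E \<Longrightarrow> g x = f (k x)) \<Longrightarrow>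
    (\<And>x. x \<in> E \<Longrightarrow> g' x = f' (k x)) \<Longrightarrow> ev_eq X E j g j' g'"
  by (erule ev_eqE, rule ev_eqI) (auto simp: Pi_iff)

lemma ev_eq_cong:
  "ev_eq X D j f j' f' \<Longrightarrow> (\<And>x. x \<in> D \<Longrightarrow> g x = f x) \<Longrightarrow> (\<And>x. x \<in> D \<Longrightarrow> g' x = f' x) \<Longrightarrow>
    ev_eq X D j g j' g'"
  by (rule ev_eq_comp[where k = "\<lambda>x. x"]) auto

context
  fixes D :: "'x set" and H :: "'u \<Rightarrow> ('x \<Rightarrow> 'u) set"
  assumes H: "\<And>j. H j \<subseteq> (D \<rightarrow> carrier (sp X j))"
begin

text \<open>All that enters about the sets H j is that they consist of maps into the carriers. The
  same quotient thus serves for bounded maps and for families of bounded maps indexed by the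
  group.\<close>

lemma equiv_colim_rel: "equiv (SIGMA j : ix X. H j) (colim_rel X D H)"
proof (rule equivI)
  show "colim_rel X D H \<subseteq> (SIGMA j : ix X. H j) \<times> (SIGMA j : ix X. H j)"
    by (auto simp: colim_rel_def)
  show "refl_on (SIGMA j : ix X. H j) (colim_rel X D H)"
    by (auto simp: refl_on_def colim_rel_def intro: ev_eq_refl)
  show "sym (colim_rel X D H)"
    by (auto simp: sym_def colim_rel_def intro: ev_eq_sym)
  show "trans (colim_rel X D H)"
    by (rule transI) (auto simp: colim_rel_def intro: ev_eq_trans[OF _ _ _ subsetD[OF H] subsetD[OF H] subsetD[OF H]])
qed

lemma colim_set_nonempty: "c \<in> colim_set X D H \<Longrightarrow> c \<noteq> {}"
  unfolding colim_set_def using in_quotient_imp_non_empty[OF equiv_colim_rel] by auto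

lemma colim_setD: "c \<in> colim_set X D H \<Longrightarrow> (j, f) \<in> c \<Longrightarrow> j \<in> ix X \<and> f \<in> H j"
  unfolding colim_set_def using in_quotient_imp_subset[OF equiv_colim_rel] by blast

lemma colim_set_ev:
  "c \<in> colim_set X D H \<Longrightarrow> (j, f) \<in> c \<Longrightarrow> (j', f') \<in> c \<Longrightarrow> ev_eq X D j f j' f'"
  unfolding colim_set_def
  using quotient_eq_iff[OF equiv_colim_rel, of c c "(j, f)" "(j', f')"] by (auto simp: colim_rel_def)

lemma colim_set_mem:
  "c \<in> colim_set X D H \<Longrightarrow> (j, f) \<in> c \<Longrightarrow> j' \<in> ix X \<Longrightarrow> f' \<in> H j' \<Longrightarrow> ev_eq X D j f j' f' \<Longrightarrow>
    (j', f') \<in> c"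
  using in_quotient_imp_closed[OF equiv_colim_rel, of c "(j, f)" "(j', f')"] colim_setD[of c j f]
  by (auto simp: colim_set_def colim_rel_def)

lemma colim_set_eqI:
  "c \<in> colim_set X D H \<Longrightarrow> c' \<in> colim_set X D H \<Longrightarrow> r \<in> c \<Longrightarrow> r \<in> c' \<Longrightarrow> c = c'"
  unfolding colim_set_def using quotient_disj[OF equiv_colim_rel] by blast

end

end

section \<open>Morphisms of ind-objects\<close>

lemma homs_carrier: "f \<in> bhom V W \<Longrightarrow> f \<in> carrier V \<rightarrow> carrier W"
  by (rule Pi_I) (rule bhom_closed)

lemma homs_subset: "bhom V W \<subseteq> (carrier V \<rightarrow> carrier W)"
  by (rule subsetI) (rule homs_carrier)

lemma ind_hom_colim:
  "\<phi> \<in> ind_hom X Y \<Longrightarrow> i \<in> ix X \<Longrightarrow>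
    \<phi> i \<in> colim_set Y (carrier (sp X i)) (\<lambda>j. bhom (sp X i) (sp Y j))"
  by (auto simp: ind_hom_def PiE_iff)

lemma ind_hom_nat:
  "\<phi> \<in> ind_hom X Y \<Longrightarrow> i \<in> ix X \<Longrightarrow> i' \<in> ix X \<Longrightarrow> u \<in> homs (idx X) i i' \<Longrightarrow> (j, f) \<in> \<phi> i' \<Longrightarrow>
    (j, compose (carrier (sp X i)) f (amap (dgm X) i i' u)) \<in> \<phi> i"
  unfolding ind_hom_def by blast

lemma ind_hom_extensional: "\<phi> \<in> ind_hom X Y \<Longrightarrow> \<phi> \<in> extensional (ix X)"
  by (auto simp: ind_hom_def PiE_iff)

context ind_banach
begin

lemma ind_hom_rep:
  assumes "\<phi> \<in> ind_hom W X" "i \<in> ix W"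
  obtains j f where "(j, f) \<in> \<phi> i"
proof -
  have "\<phi> i \<noteq> {}" by (rule colim_set_nonempty[OF homs_subset ind_hom_colim[OF assms]])
  then show thesis using that by auto
qed

lemma ind_homD:
  "\<phi> \<in> ind_hom W X \<Longrightarrow> i \<in> ix W \<Longrightarrow> (j, f) \<in> \<phi> i \<Longrightarrow> j \<in> ix X \<and> f \<in> bhom (sp W i) (sp X j)"
  by (rule colim_setD[OF homs_subset ind_hom_colim])

lemma ind_hom_ev:
  "\<phi> \<in> ind_hom W X \<Longrightarrow> i \<in> ix W \<Longrightarrow> (j, f) \<in> \<phi> i \<Longrightarrow> (j', f') \<in> \<phi> i \<Longrightarrow>
    ev_eq X (carrier (sp W i)) j f j' f'"
  by (rule colim_set_ev[OF homs_subset ind_hom_colim])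

lemma ind_hom_mem:
  "\<phi> \<in> ind_hom W X \<Longrightarrow> i \<in> ix W \<Longrightarrow> (j, f) \<in> \<phi> i \<Longrightarrow> j' \<in> ix X \<Longrightarrow> f' \<in> bhom (sp W i) (sp X j') \<Longrightarrow>
    ev_eq X (carrier (sp W i)) j f j' f' \<Longrightarrow> (j', f') \<in> \<phi> i"
  by (rule colim_set_mem[OF homs_subset ind_hom_colim])

lemma ind_hom_eqI:
  assumes "\<phi> \<in> ind_hom W X" "\<psi> \<in> ind_hom W X"
    and "\<And>i. i \<in> ix W \<Longrightarrow> \<exists>r. r \<in> \<phi> i \<and> r \<in> \<psi> i"
  shows "\<phi> = \<psi>"
proof (rule extensionalityI[OF ind_hom_extensional ind_hom_extensional])
  fix i assume i: "i \<in> ix W"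
  obtain r where "r \<in> \<phi> i" "r \<in> \<psi> i" using assms(3)[OF i] by blast
  from this show "\<phi> i = \<psi> i"
    by (rule colim_set_eqI[OF homs_subset ind_hom_colim[OF assms(1) i] ind_hom_colim[OF assms(2) i]])
qed (use assms in auto)

text \<open>The value of a morphism at an index is a full equivalence class, so one pair of
  eventually equal representatives per index decides equality.\<close>

lemma ind_hom_eq_evI:
  assumes "\<phi> \<in> ind_hom W X" "\<psi> \<in> ind_hom W X"
    and "\<And>i. i \<in> ix W \<Longrightarrow> \<exists>j f l h. (j, f) \<in> \<phi> i \<and> (l, h) \<in> \<psi> i \<and> ev_eq X (carrier (sp W i)) j f l h"
  shows "\<phi> = \<psi>"
proof (rule ind_hom_eqI[OF assms(1,2)])
  fix i assume i: "i \<in> ix W"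
  then obtain j f l h where "(j, f) \<in> \<phi> i" "(l, h) \<in> \<psi> i" "ev_eq X (carrier (sp W i)) j f l h"
    using assms(3) by blast
  note e = this and d = ind_homD[OF assms(2) i this(2)]
  have "(l, h) \<in> \<phi> i"
    by (rule ind_hom_mem[OF assms(1) i e(1) conjunct1[OF d] conjunct2[OF d] e(3)])
  with e(2) show "\<exists>r. r \<in> \<phi> i \<and> r \<in> \<psi> i" by blast
qed

lemma ind_cls_self:
  assumes "j \<in> ix X" "f \<in> bhom (sp W i) (sp X j)"
  shows "(j, f) \<in> ind_cls W X i j f"
  using assms by (simp add: ind_cls_def colim_rel_def ev_eq_refl)

lemma ind_cls_colim:
  assumes "j \<in> ix X" "f \<in> bhom (sp W i) (sp X j)"
  shows "ind_cls W X i j f \<in> colim_set X (carrier (sp W i)) (\<lambda>j. bhom (sp W i) (sp X j))"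
  unfolding ind_cls_def colim_set_def by (rule quotientI) (use assms in simp)

text \<open>One compatible choice of representatives is enough: any other representative over i' is
  eventually equal to the chosen one, and this survives composition with a transition map.\<close>

lemma ind_homI:
  assumes W: "ind_banach v s W" and ext: "\<phi> \<in> extensional (ix W)"
    and mem: "\<And>i. i \<in> ix W \<Longrightarrow> J i \<in> ix X \<and> F i \<in> bhom (sp W i) (sp X (J i)) \<and>
      \<phi> i = ind_cls W X i (J i) (F i)"
    and nat: "\<And>i i' u. i \<in> ix W \<Longrightarrow> i' \<in> ix W \<Longrightarrow> u \<in> homs (idx W) i i' \<Longrightarrow>
      ev_eq X (carrier (sp W i)) (J i) (F i) (J i') (\<lambda>x. F i' (amap (dgm W) i i' u x))"
  shows "\<phi> \<in> ind_hom W X"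
proof -
  interpret W: ind_banach v s W by (rule W)
  have colim: "\<phi> i \<in> colim_set X (carrier (sp W i)) (\<lambda>j. bhom (sp W i) (sp X j))" if "i \<in> ix W" for i
    using mem[OF that] ind_cls_colim by simp
  have "(j, compose (carrier (sp W i)) f (amap (dgm W) i i' u)) \<in> \<phi> i"
    if i: "i \<in> ix W" and i': "i' \<in> ix W" and u: "u \<in> homs (idx W) i i'" and jf: "(j, f) \<in> \<phi> i'"
    for i i' u j f
  proof (rule colim_set_mem[OF homs_subset colim[OF i]])
    note ub = W.tr_bhom[OF i i' u]
    note m = mem[OF i] mem[OF i']
    show "(J i, F i) \<in> \<phi> i" using mem[OF i] by (simp add: ind_cls_self)
    have m': "(J i', F i') \<in> \<phi> i'" using mem[OF i'] by (simp add: ind_cls_self)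
    show j: "j \<in> ix X" using colim_setD[OF homs_subset colim[OF i'] jf] by blast
    have f: "f \<in> bhom (sp W i') (sp X j)"
      using colim_setD[OF homs_subset colim[OF i'] jf] by blast
    show "compose (carrier (sp W i)) f (amap (dgm W) i i' u) \<in> bhom (sp W i) (sp X j)"
      by (rule bhom_compose[OF ub f W.sp_banach[OF i'] W.sp_banach[OF i]])
    have e: "ev_eq X (carrier (sp W i)) (J i') (\<lambda>x. F i' (amap (dgm W) i i' u x)) j
        (compose (carrier (sp W i)) f (amap (dgm W) i i' u))"
      by (rule ev_eq_comp[OF colim_set_ev[OF homs_subset colim[OF i'] m' jf]
            homs_carrier[OF ub]]) (simp_all add: compose_eq)
    show "ev_eq X (carrier (sp W i)) (J i) (F i) j
        (compose (carrier (sp W i)) f (amap (dgm W) i i' u))"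
      by (rule ev_eq_trans[OF _ _ _ _ _ _ nat[OF i i' u] e])
        (use m j f ub in \<open>auto simp: compose_eq bhom_closed\<close>)
  qed
  then show ?thesis
    unfolding ind_hom_def mem_Collect_eq PiE_iff using ext colim by blast
qed

text \<open>The case of representatives that commute strictly with transition maps along an
  assignment of arrows \<open>A\<close>. It covers level maps, and also the map from the equalizer
  to X, where \<open>J\<close> forgets the comparison data.\<close>

lemma ind_homI_transform:
  assumes W: "ind_banach v s W" and ext: "\<phi> \<in> extensional (ix W)"
    and ix: "\<And>i. i \<in> ix W \<Longrightarrow> J i \<in> ix X"
    and bhom: "\<And>i. i \<in> ix W \<Longrightarrow> F i \<in> bhom (sp W i) (sp X (J i))"
    and cls: "\<And>i. i \<in> ix W \<Longrightarrow> \<phi> i = ind_cls W X i (J i) (F i)"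
    and arr: "\<And>i i' u. i \<in> ix W \<Longrightarrow> i' \<in> ix W \<Longrightarrow> u \<in> homs (idx W) i i' \<Longrightarrow>
      A i i' u \<in> homs (idx X) (J i) (J i')"
    and nat: "\<And>i i' u x. i \<in> ix W \<Longrightarrow> i' \<in> ix W \<Longrightarrow> u \<in> homs (idx W) i i' \<Longrightarrow> x \<in> carrier (sp W i) \<Longrightarrow>
      F i' (amap (dgm W) i i' u x) = tr (J i) (J i') (A i i' u) (F i x)"
  shows "\<phi> \<in> ind_hom W X"
  by (rule ind_homI[OF W ext, of J F])
    (auto simp: ix bhom cls intro!: ev_eq_push[OF ix ix arr] bhom_closed[OF bhom] nat)

text \<open>This is well-definedness of composition with an arbitrary parameter set D in place of a
  carrier, so that it applies as well to families with a group variable. Both maps are pushed to an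
  index k at which they agree and are compared through one representative w over k.\<close>

lemma ind_hom_subst:
  assumes Y: "ind_banach v s Y" and \<phi>: "\<phi> \<in> ind_hom X Y"
    and o: "j \<in> ix X" "j' \<in> ix X"
    and f: "f \<in> D \<rightarrow> carrier (sp X j)" "f' \<in> D \<rightarrow> carrier (sp X j')"
    and e: "ev_eq X D j f j' f'"
    and h: "(l, h) \<in> \<phi> j" "(l', h') \<in> \<phi> j'"
  shows "ev_eq Y D l (\<lambda>x. h (f x)) l' (\<lambda>x. h' (f' x))"
proof -
  interpret Y: ind_banach v s Y by (rule Y)
  obtain k p q where k: "k \<in> ix X" "p \<in> homs (idx X) j k" "q \<in> homs (idx X) j' k"
    and kx: "\<And>x. x \<in> D \<Longrightarrow> tr j k p (f x) = tr j' k q (f' x)"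
    by (rule ev_eqE[OF e]) blast
  obtain m w where mw: "(m, w) \<in> \<phi> k" by (rule Y.ind_hom_rep[OF \<phi> k(1)])
  \<comment> \<open>By naturality of \<phi>, both a and w after the transition map represent the
    class at i, so they are eventually equal; this is then evaluated at the points g x.\<close>
  have *: "ev_eq Y D n (\<lambda>x. a (g x)) m (\<lambda>x. w (tr i k u (g x)))"
    if "i \<in> ix X" "u \<in> homs (idx X) i k" "g \<in> D \<rightarrow> carrier (sp X i)" "(n, a) \<in> \<phi> i" for n a i u g
    by (rule Y.ev_eq_comp[OF Y.ind_hom_ev[OF \<phi> that(1,4) ind_hom_nat[OF \<phi> that(1) k(1) that(2) mw]]
          that(3)]) (use that(3) in \<open>auto simp: compose_eq Pi_iff\<close>)
  have 1: "ev_eq Y D l (\<lambda>x. h (f x)) m (\<lambda>x. w (tr j k p (f x)))"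
    by (rule *[OF o(1) k(2) f(1) h(1)])
  have 2: "ev_eq Y D m (\<lambda>x. w (tr j k p (f x))) l' (\<lambda>x. h' (f' x))"
    by (rule Y.ev_eq_cong[OF Y.ev_eq_sym[OF *[OF o(2) k(3) f(2) h(2)]]]) (simp_all add: kx)
  note d = Y.ind_homD[OF \<phi> o(1) h(1)] Y.ind_homD[OF \<phi> o(2) h(2)] Y.ind_homD[OF \<phi> k(1) mw]
  show ?thesis
    by (rule Y.ev_eq_trans[OF _ _ _ _ _ _ 1 2])
      (use d f tr_closed[OF o(1) k(1,2)] in \<open>auto simp: Pi_iff bhom_closed\<close>)
qed

end

section \<open>Composition and the category of ind-objects\<close>

locale ind_triple = X: ind_banach v s X + Y: ind_banach v s Y + Z: ind_banach v s Z
  for v :: "'k::field \<Rightarrow> real" and s :: bool and X Y Z :: "('k, 'u) ind" +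
  fixes \<phi> \<psi> :: "'u indmap"
  assumes \<phi>: "\<phi> \<in> ind_hom X Y" and \<psi>: "\<psi> \<in> ind_hom Y Z"
begin

lemma compose_bhom:
  assumes i: "i \<in> ix X" and f: "(j, f) \<in> \<phi> i" and h: "(l, h) \<in> \<psi> j"
  shows "l \<in> ix Z" "compose (carrier (sp X i)) h f \<in> bhom (sp X i) (sp Z l)"
proof -
  note d = Y.ind_homD[OF \<phi> i f]
  note e = Z.ind_homD[OF \<psi> conjunct1[OF d] h]
  show "l \<in> ix Z" by (rule conjunct1[OF e])
  show "compose (carrier (sp X i)) h f \<in> bhom (sp X i) (sp Z l)"
    by (rule bhom_compose[OF conjunct2[OF d] conjunct2[OF e] Y.sp_banach[OF conjunct1[OF d]]
          X.sp_banach[OF i]])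
qed

text \<open>\<open>ind_comp\<close> is a union over all representatives. By
  \<open>ind_hom_subst\<close> they all contribute the same class, so any one pair computes the
  composite.\<close>

lemma ind_comp_cls:
  assumes i: "i \<in> ix X" and f: "(j, f) \<in> \<phi> i" and h: "(l, h) \<in> \<psi> j"
  shows "ind_comp X Y Z \<psi> \<phi> i = ind_cls X Z i l (compose (carrier (sp X i)) h f)"
proof -
  let ?c = "ind_cls X Z i l (compose (carrier (sp X i)) h f)"
  have "ind_cls X Z i l' (compose (carrier (sp X i)) h' f') = ?c"
    if f': "(j', f') \<in> \<phi> i" and h': "(l', h') \<in> \<psi> j'" for j' f' l' h'
  proof (rule Z.colim_set_eqI[OF homs_subset Z.ind_cls_colim Z.ind_cls_colim Z.ind_cls_self])
    note d = Y.ind_homD[OF \<phi> i f] Y.ind_homD[OF \<phi> i f']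
    have "ev_eq Z (carrier (sp X i)) l (\<lambda>x. h (f x)) l' (\<lambda>x. h' (f' x))"
      by (rule Y.ind_hom_subst[OF Z.ind_banach_axioms \<psi> conjunct1[OF d(1)] conjunct1[OF d(2)]
            homs_carrier[OF conjunct2[OF d(1)]] homs_carrier[OF conjunct2[OF d(2)]]
            Y.ind_hom_ev[OF \<phi> i f f'] h h'])
    then have "ev_eq Z (carrier (sp X i)) l (compose (carrier (sp X i)) h f)
        l' (compose (carrier (sp X i)) h' f')"
      by (rule Z.ev_eq_cong) (simp_all add: compose_eq)
    then show "(l', compose (carrier (sp X i)) h' f') \<in> ?c"
      using compose_bhom[OF i f h] compose_bhom[OF i f' h']
      by (simp add: ind_cls_def colim_rel_def)
  qed (use compose_bhom[OF i f h] compose_bhom[OF i f' h'] in auto)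
  note cls = this
  have "(\<Union>(j, f)\<in>\<phi> i. \<Union>(l, h)\<in>\<psi> j. ind_cls X Z i l (compose (carrier (sp X i)) h f)) = ?c"
    (is "?U = _")
  proof
    show "?U \<subseteq> ?c"
    proof
      fix r assume "r \<in> ?U"
      then obtain j' f' l' h' where "(j', f') \<in> \<phi> i" "(l', h') \<in> \<psi> j'"
        "r \<in> ind_cls X Z i l' (compose (carrier (sp X i)) h' f')"
        by (auto simp only: UN_iff case_prod_beta fst_conv snd_conv)
      with cls show "r \<in> ?c" by simp
    qed
    show "?c \<subseteq> ?U"
      by (rule subsetI, rule UN_I[OF f], simp only: prod.case, rule UN_I[OF h], simp only: prod.case)
  qed
  then show ?thesis using i by (simp add: ind_comp_def)
qed

lemma ind_comp_mem:
  assumes i: "i \<in> ix X" and f: "(j, f) \<in> \<phi> i" and h: "(l, h) \<in> \<psi> j"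
  shows "(l, compose (carrier (sp X i)) h f) \<in> ind_comp X Y Z \<psi> \<phi> i"
  by (simp add: ind_comp_cls[OF assms] Z.ind_cls_self compose_bhom[OF assms])

lemma ind_comp_hom: "ind_comp X Y Z \<psi> \<phi> \<in> ind_hom X Z"
proof -
  have "\<exists>j f l h. (j, f) \<in> \<phi> i \<and> (l, h) \<in> \<psi> j" if "i \<in> ix X" for i
    using Y.ind_hom_rep[OF \<phi> that] Z.ind_hom_rep[OF \<psi>] Y.ind_homD[OF \<phi> that] by metis
  then obtain J F L H where r: "\<And>i. i \<in> ix X \<Longrightarrow> (J i, F i) \<in> \<phi> i \<and> (L i, H i) \<in> \<psi> (J i)"
    by metis
  show ?thesis
  proof (rule Z.ind_homI[OF X.ind_banach_axioms, where J = L and F = "\<lambda>i. compose (carrier (sp X i)) (H i) (F i)"])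
    show "ind_comp X Y Z \<psi> \<phi> \<in> extensional (ix X)"
      by (simp add: ind_comp_def)
    show "L i \<in> ix Z \<and> compose (carrier (sp X i)) (H i) (F i) \<in> bhom (sp X i) (sp Z (L i)) \<and>
        ind_comp X Y Z \<psi> \<phi> i = ind_cls X Z i (L i) (compose (carrier (sp X i)) (H i) (F i))"
      if "i \<in> ix X" for i
      using compose_bhom[OF that, of "J i" "F i" "L i" "H i"]
        ind_comp_cls[OF that, of "J i" "F i" "L i" "H i"] r[OF that] by simp
    fix i i' u assume i: "i \<in> ix X" and i': "i' \<in> ix X" and u: "u \<in> homs (idx X) i i'"
    \<comment> \<open>Naturality of \<phi> makes F i' after the transition map a second
      representative at i; substituting both into \<psi> compares the composites.\<close>
    note rr = conjunct1[OF r[OF i]] ind_hom_nat[OF \<phi> i i' u conjunct1[OF r[OF i']]]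
    note d = Y.ind_homD[OF \<phi> i rr(1)] Y.ind_homD[OF \<phi> i rr(2)]
    have "ev_eq Z (carrier (sp X i)) (L i) (\<lambda>x. H i (F i x)) (L i')
        (\<lambda>x. H i' (compose (carrier (sp X i)) (F i') (amap (dgm X) i i' u) x))"
      by (rule Y.ind_hom_subst[OF Z.ind_banach_axioms \<psi> conjunct1[OF d(1)] conjunct1[OF d(2)]
            homs_carrier[OF conjunct2[OF d(1)]] homs_carrier[OF conjunct2[OF d(2)]]
            Y.ind_hom_ev[OF \<phi> i rr] conjunct2[OF r[OF i]] conjunct2[OF r[OF i']]])
    then show "ev_eq Z (carrier (sp X i)) (L i) (compose (carrier (sp X i)) (H i) (F i)) (L i')
        (\<lambda>x. compose (carrier (sp X i')) (H i') (F i') (amap (dgm X) i i' u x))"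
      by (rule Z.ev_eq_cong) (simp_all add: compose_eq X.tr_closed[OF i i' u])
  qed
qed

end

text \<open>The second conclusion names a concrete representative at each index. Identities, counit
  and comultiplication are computed through it.\<close>

lemma level_map_hom:
  assumes X: "ind_banach v s X" and Y: "ind_banach v s Y" and idx: "idx Y = idx X"
    and F: "\<And>i. i \<in> ix X \<Longrightarrow> F i \<in> bhom (sp X i) (sp Y i)"
    and nat: "\<And>i i' u x. i \<in> ix X \<Longrightarrow> i' \<in> ix X \<Longrightarrow> u \<in> homs (idx X) i i' \<Longrightarrow> x \<in> carrier (sp X i) \<Longrightarrow>
      F i' (amap (dgm X) i i' u x) = amap (dgm Y) i i' u (F i x)"
  shows "level_map X Y F \<in> ind_hom X Y" "i \<in> ix X \<Longrightarrow> (i, F i) \<in> level_map X Y F i"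
proof -
  interpret Y: ind_banach v s Y by (rule Y)
  show "level_map X Y F \<in> ind_hom X Y"
    by (rule Y.ind_homI_transform[OF X, where J = "\<lambda>i. i" and F = F and A = "\<lambda>i i' u. u"])
      (auto simp: level_map_def idx F nat)
  show "i \<in> ix X \<Longrightarrow> (i, F i) \<in> level_map X Y F i"
    by (simp add: level_map_def Y.ind_cls_self idx F)
qed

lemma idt_IndBan:
  assumes "ind_banach v s X"
  shows "idt (IndBan v s) X \<in> ind_hom X X"
    and "i \<in> ix X \<Longrightarrow> (i, \<lambda>x\<in>carrier (sp X i). x) \<in> idt (IndBan v s) X i"
proof -
  interpret ind_banach v s X by fact
  have idt: "idt (IndBan v s) X = level_map X X (\<lambda>i. \<lambda>x\<in>carrier (sp X i). x)"
    by (simp add: IndBan_def)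
  have nat: "(\<lambda>x\<in>carrier (sp X i'). x) (tr i i' u x) = tr i i' u ((\<lambda>x\<in>carrier (sp X i). x) x)"
    if "i \<in> ix X" "i' \<in> ix X" "u \<in> homs (idx X) i i'" "x \<in> carrier (sp X i)" for i i' u x
    using that by (simp add: tr_closed)
  note lm = level_map_hom[OF assms assms refl bhom_idt[OF sp_banach] nat]
  show "idt (IndBan v s) X \<in> ind_hom X X"
    unfolding idt by (rule lm(1))
  show "i \<in> ix X \<Longrightarrow> (i, \<lambda>x\<in>carrier (sp X i). x) \<in> idt (IndBan v s) X i"
    unfolding idt by (rule lm(2))
qed

lemma ind_comp_idt_right:
  assumes X: "ind_banach v s X" and Y: "ind_banach v s Y" and \<phi>: "\<phi> \<in> ind_hom X Y"
  shows "ind_comp X X Y \<phi> (idt (IndBan v s) X) = \<phi>"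
proof -
  interpret X: ind_banach v s X by (rule X)
  interpret Y: ind_banach v s Y by (rule Y)
  note id = idt_IndBan[OF X]
  interpret T: ind_triple v s X X Y "idt (IndBan v s) X" \<phi>
    by unfold_locales (rule id \<phi>)+
  show ?thesis
  proof (rule Y.ind_hom_eqI[OF T.ind_comp_hom \<phi>])
    fix i assume i: "i \<in> ix X"
    obtain j f where f: "(j, f) \<in> \<phi> i" by (rule Y.ind_hom_rep[OF \<phi> i])
    have "compose (carrier (sp X i)) f (\<lambda>x\<in>carrier (sp X i). x) = f"
      using Y.ind_homD[OF \<phi> i f]
      by (intro extensionalityI[OF _ bhom_extensional]) (auto simp: compose_eq)
    then show "\<exists>r. r \<in> ind_comp X X Y \<phi> (idt (IndBan v s) X) i \<and> r \<in> \<phi> i"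
      using T.ind_comp_mem[OF i id(2)[OF i] f] f by auto
  qed
qed

lemma ind_comp_idt_left:
  assumes X: "ind_banach v s X" and Y: "ind_banach v s Y" and \<phi>: "\<phi> \<in> ind_hom X Y"
  shows "ind_comp X Y Y (idt (IndBan v s) Y) \<phi> = \<phi>"
proof -
  interpret X: ind_banach v s X by (rule X)
  interpret Y: ind_banach v s Y by (rule Y)
  note id = idt_IndBan[OF Y]
  interpret T: ind_triple v s X Y Y \<phi> "idt (IndBan v s) Y"
    by unfold_locales (rule id \<phi>)+
  show ?thesis
  proof (rule Y.ind_hom_eqI[OF T.ind_comp_hom \<phi>])
    fix i assume i: "i \<in> ix X"
    obtain j f where f: "(j, f) \<in> \<phi> i" by (rule Y.ind_hom_rep[OF \<phi> i])
    note d = Y.ind_homD[OF \<phi> i f]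
    have "compose (carrier (sp X i)) (\<lambda>x\<in>carrier (sp Y j). x) f = f"
      using d by (intro extensionalityI[OF _ bhom_extensional]) (auto simp: compose_eq bhom_closed)
    then show "\<exists>r. r \<in> ind_comp X Y Y (idt (IndBan v s) Y) \<phi> i \<and> r \<in> \<phi> i"
      using T.ind_comp_mem[OF i f id(2)] f d by auto
  qed
qed

lemma ind_comp_assoc:
  assumes W: "ind_banach v s W" and X: "ind_banach v s X"
    and Y: "ind_banach v s Y" and Z: "ind_banach v s Z"
    and hom: "\<phi> \<in> ind_hom W X" "\<psi> \<in> ind_hom X Y" "\<theta> \<in> ind_hom Y Z"
  shows "ind_comp W Y Z \<theta> (ind_comp W X Y \<psi> \<phi>) = ind_comp W X Z (ind_comp X Y Z \<theta> \<psi>) \<phi>"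
proof -
  interpret W: ind_banach v s W by (rule W)
  interpret X: ind_banach v s X by (rule X)
  interpret Y: ind_banach v s Y by (rule Y)
  interpret Z: ind_banach v s Z by (rule Z)
  interpret A: ind_triple v s W X Y \<phi> \<psi> by unfold_locales (rule hom)+
  interpret B: ind_triple v s X Y Z \<psi> \<theta> by unfold_locales (rule hom)+
  interpret C: ind_triple v s W Y Z "ind_comp W X Y \<psi> \<phi>" \<theta>
    by unfold_locales (rule A.ind_comp_hom hom)+
  interpret D: ind_triple v s W X Z \<phi> "ind_comp X Y Z \<theta> \<psi>"
    by unfold_locales (rule B.ind_comp_hom hom)+
  show ?thesis
  proof (rule Z.ind_hom_eqI[OF C.ind_comp_hom D.ind_comp_hom])
    fix i assume i: "i \<in> ix W"
    obtain j f where f: "(j, f) \<in> \<phi> i" by (rule X.ind_hom_rep[OF A.\<phi> i])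
    note df = X.ind_homD[OF A.\<phi> i f]
    obtain k g where g: "(k, g) \<in> \<psi> j" by (rule Y.ind_hom_rep[OF A.\<psi> conjunct1[OF df]])
    note dg = Y.ind_homD[OF A.\<psi> conjunct1[OF df] g]
    obtain l r where r: "(l, r) \<in> \<theta> k" by (rule Z.ind_hom_rep[OF B.\<psi> conjunct1[OF dg]])
    have "compose (carrier (sp W i)) r (compose (carrier (sp W i)) g f) =
        compose (carrier (sp W i)) (compose (carrier (sp X j)) r g) f"
      by (rule compose_assoc[OF homs_carrier[OF conjunct2[OF df]]])
    then show "\<exists>r. r \<in> ind_comp W Y Z \<theta> (ind_comp W X Y \<psi> \<phi>) i \<and>
        r \<in> ind_comp W X Z (ind_comp X Y Z \<theta> \<psi>) \<phi> i"
      using C.ind_comp_mem[OF i A.ind_comp_mem[OF i f g] r]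
        D.ind_comp_mem[OF i f B.ind_comp_mem[OF _ g r]] df by auto
  qed
qed

lemma category_IndBan:
  assumes v: "complete_valued_field v"
  shows "category (IndBan v s)"
proof -
  have o: "X \<in> obs (IndBan v s) \<longleftrightarrow> ind_banach v s X" for X
    by (simp add: IndBan_def ind_banach_def v)
  have h: "homs (IndBan v s) = ind_hom" "cmp (IndBan v s) = ind_comp"
    by (simp_all add: IndBan_def)
  show ?thesis
  proof (rule categoryI, unfold o h)
    show "ind_comp X Y Z \<psi> \<phi> \<in> ind_hom X Z"
      if "ind_banach v s X" "ind_banach v s Y" "ind_banach v s Z" "\<phi> \<in> ind_hom X Y" "\<psi> \<in> ind_hom Y Z"
      for X Y Z \<phi> \<psi>
      using that by (intro ind_triple.ind_comp_hom ind_triple.intro ind_triple_axioms.intro)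
  qed (fact idt_IndBan(1) ind_comp_idt_right ind_comp_idt_left ind_comp_assoc)+
qed

section \<open>Bounded left uniformly continuous functions\<close>

context banach_module
begin

text \<open>Boundedness makes the supremum in the definition finite, and its convergence to 0
  becomes a uniform estimate without suprema. From that estimate continuity at each point is
  recovered.\<close>

lemma cblu_funs_iff:
  fixes f :: "'g::topological_group_add \<Rightarrow> 'u"
  shows "f \<in> cblu_funs V \<longleftrightarrow> (\<forall>x. f x \<in> carrier V) \<and> (\<exists>M. \<forall>x. nrm V (f x) \<le> M) \<and>
    (\<forall>e>0. \<forall>\<^sub>F h in nhds 0. \<forall>x. nrm V (f (h + x) \<ominus> f x) \<le> e)"
    (is "_ \<longleftrightarrow> ?c \<and> ?b \<and> ?u")
proof (cases "?c \<and> ?b")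
  case True
  then obtain M where c: "\<And>x. f x \<in> carrier V" and M: "\<And>x. nrm V (f x) \<le> M" by auto
  have bdd: "bdd_above (range (\<lambda>x. nrm V (f (h + x) \<ominus> f x)))" for h
  proof (rule bdd_aboveI2)
    show "nrm V (f (h + x) \<ominus> f x) \<le> M + M" for x
      using nrm_diff_le[OF c c, of "h + x" x] M[of "h + x"] M[of x] by linarith
  qed
  let ?S = "\<lambda>h. SUP x. nrm V (f (h + x) \<ominus> f x)"
  have up: "nrm V (f (h + x) \<ominus> f x) \<le> ?S h" for h x
    by (rule cSUP_upper[OF UNIV_I bdd])
  have S0: "0 \<le> ?S h" for h
    by (rule order_trans[OF _ up[of h 0]]) (simp add: nrm_ge0 c)
  have S: "?S h \<le> e \<longleftrightarrow> (\<forall>x. nrm V (f (h + x) \<ominus> f x) \<le> e)" for h e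
  proof
    show "?S h \<le> e \<Longrightarrow> \<forall>x. nrm V (f (h + x) \<ominus> f x) \<le> e"
      using order_trans[OF up] by blast
    show "\<forall>x. nrm V (f (h + x) \<ominus> f x) \<le> e \<Longrightarrow> ?S h \<le> e"
      by (rule cSUP_least) simp_all
  qed
  have "?u \<longleftrightarrow> (?S \<longlongrightarrow> 0) (nhds 0)"
  proof
    assume u: ?u
    show "(?S \<longlongrightarrow> 0) (nhds 0)"
    proof (rule tendstoI)
      fix e :: real assume "e > 0"
      then have "\<forall>\<^sub>F h in nhds 0. ?S h \<le> e / 2" using u by (simp only: S half_gt_zero_iff)
      then show "\<forall>\<^sub>F h in nhds 0. dist (?S h) 0 < e"
        by eventually_elim (use S0 \<open>e > 0\<close> in \<open>simp add: abs_of_nonneg\<close>)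
    qed
  next
    assume *: "(?S \<longlongrightarrow> 0) (nhds 0)"
    show ?u
    proof (intro allI impI)
      fix e :: real assume "e > 0"
      from order_tendstoD(2)[OF * this] have "\<forall>\<^sub>F h in nhds 0. ?S h \<le> e"
        by eventually_elim simp
      then show "\<forall>\<^sub>F h in nhds 0. \<forall>x. nrm V (f (h + x) \<ominus> f x) \<le> e" by (simp only: S)
    qed
  qed
  \<comment> \<open>A point y near x is (y - x) + x, so the uniform estimate at h = y - x, taken at
    the point x, compares f y with f x.\<close>
  moreover have "((\<lambda>y. nrm V (f y \<ominus> f x)) \<longlongrightarrow> 0) (nhds x)" if ?u for x
  proof (rule tendstoI)
    fix e :: real assume "e > 0"
    then have "\<forall>\<^sub>F h in nhds 0. \<forall>x. nrm V (f (h + x) \<ominus> f x) \<le> e / 2"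
      using that by (meson half_gt_zero)
    moreover have "((\<lambda>y. y - x) \<longlongrightarrow> x - x) (nhds x)"
      by (intro tendsto_diff tendsto_const filterlim_ident)
    then have "filterlim (\<lambda>y. y - x) (nhds 0) (nhds x)" by simp
    ultimately have "\<forall>\<^sub>F y in nhds x. \<forall>z. nrm V (f ((y - x) + z) \<ominus> f z) \<le> e / 2"
      by (rule eventually_compose_filterlim)
    then show "\<forall>\<^sub>F y in nhds x. dist (nrm V (f y \<ominus> f x)) 0 < e"
    proof eventually_elim
      case (elim y)
      have "nrm V (f y \<ominus> f x) \<le> e / 2" using spec[OF elim, of x] by simp
      then show ?case using \<open>e > 0\<close> c by (simp add: abs_of_nonneg nrm_ge0)
    qed
  qed
  ultimately show ?thesis
    using True unfolding cblu_funs_def by blast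
qed (auto simp: cblu_funs_def)

lemma cblu_funsI:
  fixes f :: "'g::topological_group_add \<Rightarrow> 'u"
  assumes "\<And>x. f x \<in> carrier V" "\<And>x. nrm V (f x) \<le> M"
    and "\<And>e. e > 0 \<Longrightarrow> \<forall>\<^sub>F h in nhds 0. \<forall>x. nrm V (f (h + x) \<ominus> f x) \<le> e"
  shows "f \<in> cblu_funs V"
  unfolding cblu_funs_iff using assms by blast

lemma cblu_funs_bounded:
  assumes "f \<in> cblu_funs V" obtains M where "\<And>x. nrm V (f x) \<le> M"
  using assms unfolding cblu_funs_def by blast

lemma cblu_funs_uniform:
  "f \<in> cblu_funs V \<Longrightarrow> e > 0 \<Longrightarrow> \<forall>\<^sub>F h in nhds 0. \<forall>x. nrm V (f (h + x) \<ominus> f x) \<le> e"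
  unfolding cblu_funs_iff by blast

lemma cblu_funs_zero: "(\<lambda>x. \<zero>) \<in> cblu_funs V"
  by (rule cblu_funsI[where M = 0]) (simp_all add: a_minus_def)

lemma cblu_funs_add:
  fixes f g :: "'g::topological_group_add \<Rightarrow> 'u"
  assumes f: "f \<in> cblu_funs V" and g: "g \<in> cblu_funs V"
  shows "(\<lambda>x. f x \<oplus> g x) \<in> cblu_funs V"
proof -
  have c: "f x \<in> carrier V" "g x \<in> carrier V" for x
    using f g by (simp_all add: cblu_funs_def)
  obtain M N where M: "\<And>x. nrm V (f x) \<le> M" and N: "\<And>x. nrm V (g x) \<le> N"
    using f g by (metis cblu_funs_bounded)
  show ?thesis
  proof (rule cblu_funsI[where M = "M + N"])
    show "nrm V (f x \<oplus> g x) \<le> M + N" for x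
      using nrm_add[OF c(1) c(2), of x x] M[of x] N[of x] by linarith
    fix e :: real assume "e > 0"
    then have e: "e / 2 > 0" by simp
    from cblu_funs_uniform[OF f e] cblu_funs_uniform[OF g e]
    show "\<forall>\<^sub>F h in nhds 0. \<forall>x. nrm V (f (h + x) \<oplus> g (h + x) \<ominus> (f x \<oplus> g x)) \<le> e"
    proof (eventually_elim, intro allI)
      fix h x assume a: "\<forall>x. nrm V (f (h + x) \<ominus> f x) \<le> e / 2" "\<forall>x. nrm V (g (h + x) \<ominus> g x) \<le> e / 2"
      have "nrm V (f (h + x) \<oplus> g (h + x) \<ominus> (f x \<oplus> g x)) \<le>
          nrm V (f (h + x) \<ominus> f x) + nrm V (g (h + x) \<ominus> g x)"
        by (simp add: add_diff_add c nrm_add)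
      also have "\<dots> \<le> e" using spec[OF a(1), of x] spec[OF a(2), of x] by simp
      finally show "nrm V (f (h + x) \<oplus> g (h + x) \<ominus> (f x \<oplus> g x)) \<le> e" .
    qed
  qed (simp add: c)
qed

lemma cblu_funs_bhom:
  fixes f :: "'g::topological_group_add \<Rightarrow> 'u"
  assumes W: "banach_module v s W" and T: "T \<in> bhom V W" and f: "f \<in> cblu_funs V"
  shows "(\<lambda>x. T (f x)) \<in> cblu_funs W"
proof -
  interpret W: banach_module v s W by (rule W)
  have c: "f x \<in> carrier V" for x using f by (simp add: cblu_funs_def)
  obtain M where M: "\<And>x. nrm V (f x) \<le> M" using cblu_funs_bounded[OF f] by blast
  obtain N where N: "N \<ge> 0" "\<And>x. x \<in> carrier V \<Longrightarrow> nrm W (T x) \<le> N * nrm V x"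
    using bhom_bound[OF banach_module_axioms T] by blast
  show ?thesis
  proof (rule W.cblu_funsI[where M = "N * M"])
    show "nrm W (T (f x)) \<le> N * M" for x
      using N(2)[OF c, of x] mult_left_mono[OF M N(1), of x] by linarith
    fix e :: real assume "e > 0"
    \<comment> \<open>Dividing by N + 1 rather than by N also covers N = 0.\<close>
    then have e: "e / (N + 1) > 0" using N(1) by simp
    from cblu_funs_uniform[OF f e]
    show "\<forall>\<^sub>F h in nhds 0. \<forall>x. nrm W (T (f (h + x)) \<ominus>\<^bsub>W\<^esub> T (f x)) \<le> e"
    proof (eventually_elim, intro allI)
      fix h x assume a: "\<forall>x. nrm V (f (h + x) \<ominus> f x) \<le> e / (N + 1)"
      have "nrm W (T (f (h + x)) \<ominus>\<^bsub>W\<^esub> T (f x)) \<le> N * nrm V (f (h + x) \<ominus> f x)"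
        using N(2)[of "f (h + x) \<ominus> f x"] bhom_diff[OF banach_module_axioms W T c c]
        by (simp add: c)
      also have "\<dots> \<le> N * (e / (N + 1))"
        by (rule mult_left_mono) (use a N(1) in auto)
      also have "\<dots> \<le> e" using N(1) \<open>e > 0\<close> by (simp add: field_simps)
      finally show "nrm W (T (f (h + x)) \<ominus>\<^bsub>W\<^esub> T (f x)) \<le> e" .
    qed
  qed (simp add: bhom_closed[OF T] c)
qed

lemma bhom_smult_map: "(\<lambda>x\<in>carrier V. c \<odot> x) \<in> bhom V V"
  by (rule bhomI[where M = "v c"])
    (auto simp: smult_r_distr nrm_smult smult_mult[symmetric] mult.commute)

lemma cblu_funs_smult:
  fixes f :: "'g::topological_group_add \<Rightarrow> 'u"
  assumes f: "f \<in> cblu_funs V"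
  shows "(\<lambda>x. c \<odot> f x) \<in> cblu_funs V"
proof -
  have "f x \<in> carrier V" for x using f by (simp add: cblu_funs_def)
  then show ?thesis
    using cblu_funs_bhom[OF banach_module_axioms bhom_smult_map f, of c] by simp
qed

text \<open>The perturbation h and the translation g act on the same side and need not commute.
  Since g + (h + x) = (g + h - g) + (g + x), the perturbation is conjugated by g, and conjugation is
  continuous at 0.\<close>

lemma cblu_funs_translate:
  fixes f :: "'g::topological_group_add \<Rightarrow> 'u"
  assumes f: "f \<in> cblu_funs V"
  shows "(\<lambda>x. f (g + x)) \<in> cblu_funs V"
proof -
  obtain M where M: "\<And>x. nrm V (f x) \<le> M" using cblu_funs_bounded[OF f] by blast
  show ?thesis
  proof (rule cblu_funsI[where M = M])
    fix e :: real assume e: "e > 0"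
    have "((\<lambda>h. g + h - g) \<longlongrightarrow> g + 0 - g) (nhds 0)"
      by (intro tendsto_diff tendsto_add tendsto_const filterlim_ident)
    then have "filterlim (\<lambda>h. g + h - g) (nhds 0) (nhds 0)" by simp
    from eventually_compose_filterlim[OF cblu_funs_uniform[OF f e] this]
    show "\<forall>\<^sub>F h in nhds 0. \<forall>x. nrm V (f (g + (h + x)) \<ominus> f (g + x)) \<le> e"
    proof (eventually_elim, intro allI)
      fix h x assume a: "\<forall>x. nrm V (f (g + h - g + x) \<ominus> f x) \<le> e"
      have "g + h - g + (g + x) = g + (h + x)"
        by (metis add.assoc diff_add_cancel)
      with spec[OF a, of "g + x"] show "nrm V (f (g + (h + x)) \<ominus> f (g + x)) \<le> e" by simp
    qed
  qed (use f M in \<open>simp_all add: cblu_funs_def\<close>)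
qed

text \<open>Uniformity passes to f by cutting e into three parts: from f to an approximating g,
  along g, and back to f. An approximation at distance 1 shows that f is bounded.\<close>

lemma cblu_funs_uniform_limit:
  fixes f :: "'g::topological_group_add \<Rightarrow> 'u"
  assumes c: "\<And>x. f x \<in> carrier V"
    and lim: "\<And>e. e > 0 \<Longrightarrow> \<exists>g\<in>cblu_funs V. \<forall>x. nrm V (g x \<ominus> f x) \<le> e"
  shows "f \<in> cblu_funs V"
proof -
  obtain g where g: "g \<in> cblu_funs V" "\<And>x. nrm V (g x \<ominus> f x) \<le> 1"
    using lim[of 1] by auto
  obtain M where M: "\<And>x. nrm V (g x) \<le> M" using cblu_funs_bounded[OF g(1)] by blast
  show ?thesis
  proof (rule cblu_funsI[where M = "1 + M"])
    show "nrm V (f x) \<le> 1 + M" for x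
      using nrm_le_diff[of "f x" "g x"] g c M[of x] nrm_minus_commute[of "f x" "g x"]
      by (simp add: cblu_funs_def) (smt (verit))
    fix e :: real assume "e > 0"
    then have e3: "e / 3 > 0" by simp
    then obtain g where g: "g \<in> cblu_funs V" and d: "\<And>x. nrm V (g x \<ominus> f x) \<le> e / 3"
      using lim by blast
    have gc: "g x \<in> carrier V" for x using g by (simp add: cblu_funs_def)
    from cblu_funs_uniform[OF g e3]
    show "\<forall>\<^sub>F h in nhds 0. \<forall>x. nrm V (f (h + x) \<ominus> f x) \<le> e"
    proof (eventually_elim, intro allI)
      fix h x assume a: "\<forall>x. nrm V (g (h + x) \<ominus> g x) \<le> e / 3"
      show "nrm V (f (h + x) \<ominus> f x) \<le> e"
        using spec[OF a, of x] d[of x] d[of "h + x"]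
          nrm_diff_triangle[OF c gc c, of "h + x" x "h + x"]
          nrm_diff_triangle[OF gc gc c, of "h + x" x x]
          nrm_minus_commute[OF c gc, of "h + x" "h + x"]
        by linarith
    qed
  qed (rule c)
qed

end

section \<open>The Banach space of encoded functions\<close>

locale cblu_universe =
  fixes v :: "'k::field \<Rightarrow> real" and s :: bool
    and U :: "('k, 'g::topological_group_add, 'u) univ"
  assumes valued: "complete_valued_field v" and universe: "universe U"
begin

lemma fdec_fenc [simp]: "fdec U (fenc U f) = f"
  using universe by (simp add: universe_def)

lemma fenc_eq [simp]: "fenc U f = fenc U f' \<longleftrightarrow> f = f'"
  using universe by (simp add: universe_def inj_eq)

abbreviation CS :: "('k, 'u) nmod \<Rightarrow> ('k, 'u) nmod" where
  "CS V \<equiv> cblu_space U V"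

lemma cblu_space_simps [simp]:
  "\<zero>\<^bsub>CS V\<^esub> = fenc U (\<lambda>x. \<zero>\<^bsub>V\<^esub>)"
  "fenc U f \<oplus>\<^bsub>CS V\<^esub> fenc U f' = fenc U (\<lambda>x. f x \<oplus>\<^bsub>V\<^esub> f' x)"
  "c \<odot>\<^bsub>CS V\<^esub> fenc U f = fenc U (\<lambda>x. c \<odot>\<^bsub>V\<^esub> f x)"
  "nrm (CS V) (fenc U f) = (SUP x. nrm V (f x))"
  by (simp_all add: cblu_space_def)

lemma fenc_mem [simp]: "fenc U f \<in> carrier (CS V) \<longleftrightarrow> f \<in> cblu_funs V"
  by (auto simp: cblu_space_def)

lemma cblu_spaceE:
  assumes "a \<in> carrier (CS V)" obtains f where "a = fenc U f" "f \<in> cblu_funs V"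
  using assms by (auto simp: cblu_space_def)

lemma fdec_mem: "a \<in> carrier (CS V) \<Longrightarrow> fdec U a \<in> cblu_funs V"
  and fenc_fdec: "a \<in> carrier (CS V) \<Longrightarrow> fenc U (fdec U a) = a"
  by (auto elim: cblu_spaceE)

lemma fdec_closed: "a \<in> carrier (CS V) \<Longrightarrow> fdec U a x \<in> carrier V"
  using fdec_mem[of a V] by (simp add: cblu_funs_def)

lemma cblu_nrm_le: "(\<And>x. nrm V (f x) \<le> M) \<Longrightarrow> nrm (CS V) (fenc U f) \<le> M"
  by (simp add: cSUP_least)

lemma nrm_le_cblu_nrm: "f \<in> cblu_funs V \<Longrightarrow> nrm V (f x) \<le> nrm (CS V) (fenc U f)"
  by (simp, rule cSUP_upper) (auto simp: cblu_funs_def bdd_above_def)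

lemma cblu_nrm_smult_le:
  assumes "banach_module v s V" "f \<in> cblu_funs V"
  shows "nrm (CS V) (fenc U (\<lambda>x. c \<odot>\<^bsub>V\<^esub> f x)) \<le> v c * nrm (CS V) (fenc U f)"
proof (rule cblu_nrm_le)
  interpret banach_module v s V by fact
  have "v c \<ge> 0" using valued by (simp add: complete_valued_field_def)
  then show "nrm V (c \<odot>\<^bsub>V\<^esub> f x) \<le> v c * nrm (CS V) (fenc U f)" for x
    using assms(2) nrm_le_cblu_nrm[OF assms(2)]
    by (simp add: nrm_smult cblu_funs_def mult_left_mono del: cblu_space_simps(4))
qed

lemma cblu_uminus_mem:
  assumes V: "banach_module v s V" and f: "f \<in> cblu_funs V"
  shows "(\<lambda>x. \<ominus>\<^bsub>V\<^esub> f x) \<in> cblu_funs V"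
proof -
  interpret banach_module v s V by (rule V)
  have "(\<lambda>x. \<ominus>\<^bsub>V\<^esub> f x) = (\<lambda>x. (- 1) \<odot>\<^bsub>V\<^esub> f x)"
    using f by (auto simp: uminus_eq_smult cblu_funs_def)
  then show ?thesis using cblu_funs_smult[OF f] by simp
qed

lemma abelian_group_cblu:
  assumes V: "banach_module v s V"
  shows "abelian_group (CS V)"
proof -
  interpret banach_module v s V by (rule V)
  note [simp] = cblu_funs_zero cblu_funs_add
  have c [simp]: "f \<in> cblu_funs V \<Longrightarrow> f x \<in> carrier V" for f :: "'g \<Rightarrow> 'u" and x
    by (simp add: cblu_funs_def)
  show ?thesis
  proof (rule abelian_groupI)
    show "\<exists>y\<in>carrier (CS V). y \<oplus>\<^bsub>CS V\<^esub> x = \<zero>\<^bsub>CS V\<^esub>" if x: "x \<in> carrier (CS V)" for x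
    proof -
      obtain f where f: "x = fenc U f" "f \<in> cblu_funs V" by (rule cblu_spaceE[OF x])
      then show ?thesis
        by (intro bexI[of _ "fenc U (\<lambda>x. \<ominus>\<^bsub>V\<^esub> f x)"]) (auto simp: l_neg cblu_uminus_mem[OF V])
    qed
  qed (auto elim!: cblu_spaceE simp: a_ac)
qed

text \<open>The inverse of an encoded function is once more a description over the carrier. Only
  after it is identified can norms of differences be estimated pointwise.\<close>

lemma cblu_diff:
  assumes V: "banach_module v s V" and f: "f \<in> cblu_funs V" and h: "h \<in> cblu_funs V"
  shows "fenc U f \<ominus>\<^bsub>CS V\<^esub> fenc U h = fenc U (\<lambda>x. f x \<ominus>\<^bsub>V\<^esub> h x)"
proof -
  interpret banach_module v s V by (rule V)
  interpret C: abelian_group "CS V" by (rule abelian_group_cblu[OF V])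
  have c: "h x \<in> carrier V" for x using h by (simp add: cblu_funs_def)
  have "\<ominus>\<^bsub>CS V\<^esub> fenc U h = fenc U (\<lambda>x. \<ominus>\<^bsub>V\<^esub> h x)"
    by (rule C.minus_equality) (simp_all add: l_neg c h cblu_uminus_mem[OF V h])
  then show ?thesis by (simp add: a_minus_def)
qed

lemma cblu_diff_mem:
  assumes V: "banach_module v s V" and f: "f \<in> cblu_funs V" and h: "h \<in> cblu_funs V"
  shows "(\<lambda>x. f x \<ominus>\<^bsub>V\<^esub> h x) \<in> cblu_funs V"
  using banach_module.cblu_funs_add[OF V f cblu_uminus_mem[OF V h]] by (simp add: a_minus_def)

text \<open>Pointwise limits exist because V is complete. Letting m tend to infinity in the uniform
  Cauchy estimate makes the convergence uniform, and \<open>cblu_funs_uniform_limit\<close> then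
  puts the limit into the space.\<close>

lemma cblu_complete:
  assumes V: "banach_module v s V" and X: "\<And>n. X n \<in> cblu_funs V"
    and cauchy: "\<And>e. e > 0 \<Longrightarrow> \<exists>N::nat. \<forall>m\<ge>N. \<forall>n\<ge>N. nrm (CS V) (fenc U (X m) \<ominus>\<^bsub>CS V\<^esub> fenc U (X n)) < e"
  obtains f where "f \<in> cblu_funs V" "(\<lambda>n. nrm (CS V) (fenc U (X n) \<ominus>\<^bsub>CS V\<^esub> fenc U f)) \<longlonglongrightarrow> 0"
proof -
  interpret banach_module v s V by (rule V)
  have c: "X n x \<in> carrier V" for n x using X[of n] by (simp add: cblu_funs_def)
  have pw: "\<exists>N. \<forall>m\<ge>N. \<forall>n\<ge>N. \<forall>x. nrm V (X m x \<ominus>\<^bsub>V\<^esub> X n x) < e" if e: "e > 0" for e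
  proof -
    obtain N where N: "\<forall>m\<ge>N. \<forall>n\<ge>N. nrm (CS V) (fenc U (X m) \<ominus>\<^bsub>CS V\<^esub> fenc U (X n)) < e"
      using cauchy[OF e] by blast
    have "nrm V (X m x \<ominus>\<^bsub>V\<^esub> X n x) \<le> nrm (CS V) (fenc U (X m) \<ominus>\<^bsub>CS V\<^esub> fenc U (X n))" for m n x
      unfolding cblu_diff[OF V X X] by (rule nrm_le_cblu_nrm[OF cblu_diff_mem[OF V X X]])
    with N show ?thesis by (meson order_le_less_trans)
  qed
  have "\<exists>l\<in>carrier V. (\<lambda>n. nrm V (X n x \<ominus>\<^bsub>V\<^esub> l)) \<longlonglongrightarrow> 0" for x
    by (rule cauchy_limit[OF c]) (use pw in blast)
  then obtain f where fc: "\<And>x. f x \<in> carrier V" and f: "\<And>x. (\<lambda>n. nrm V (X n x \<ominus>\<^bsub>V\<^esub> f x)) \<longlonglongrightarrow> 0"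
    by metis
  have unif: "\<exists>N. \<forall>n\<ge>N. \<forall>x. nrm V (X n x \<ominus>\<^bsub>V\<^esub> f x) \<le> e" if e: "e > 0" for e
  proof -
    obtain N where N: "\<forall>m\<ge>N. \<forall>n\<ge>N. \<forall>x. nrm V (X m x \<ominus>\<^bsub>V\<^esub> X n x) < e"
      using pw[OF e] by blast
    have "nrm V (X n x \<ominus>\<^bsub>V\<^esub> f x) \<le> e" if n: "n \<ge> N" for n x
    proof (rule LIMSEQ_le_const)
      have "(\<lambda>m. e + nrm V (X m x \<ominus>\<^bsub>V\<^esub> f x)) \<longlonglongrightarrow> e + 0"
        by (intro tendsto_add tendsto_const f)
      then show "(\<lambda>m. e + nrm V (X m x \<ominus>\<^bsub>V\<^esub> f x)) \<longlonglongrightarrow> e" by simp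
      have "nrm V (X n x \<ominus>\<^bsub>V\<^esub> f x) \<le> e + nrm V (X m x \<ominus>\<^bsub>V\<^esub> f x)" if "m \<ge> N" for m
        using nrm_diff_triangle[OF c[of n x] c[of m x] fc[of x]] N n that by (smt (verit))
      then show "\<exists>M. \<forall>m\<ge>M. nrm V (X n x \<ominus>\<^bsub>V\<^esub> f x) \<le> e + nrm V (X m x \<ominus>\<^bsub>V\<^esub> f x)" by blast
    qed
    then show ?thesis by blast
  qed
  have fm: "f \<in> cblu_funs V"
    by (rule cblu_funs_uniform_limit[OF fc]) (use unif X in blast)
  have ge: "0 \<le> nrm (CS V) (fenc U (X n) \<ominus>\<^bsub>CS V\<^esub> fenc U f)" for n
    unfolding cblu_diff[OF V X fm]
    by (rule order_trans[OF nrm_ge0[OF minus_closed[OF c fc]] nrm_le_cblu_nrm[OF cblu_diff_mem[OF V X fm]]])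
  have "(\<lambda>n. nrm (CS V) (fenc U (X n) \<ominus>\<^bsub>CS V\<^esub> fenc U f)) \<longlonglongrightarrow> 0"
  proof (rule LIMSEQ_I)
    fix e :: real assume e: "e > 0"
    then obtain N where N: "\<forall>n\<ge>N. \<forall>x. nrm V (X n x \<ominus>\<^bsub>V\<^esub> f x) \<le> e / 2"
      using unif[of "e / 2"] by auto
    have "nrm (CS V) (fenc U (X n) \<ominus>\<^bsub>CS V\<^esub> fenc U f) \<le> e / 2" if "n \<ge> N" for n
      unfolding cblu_diff[OF V X fm] by (rule cblu_nrm_le) (use N that in blast)
    then have "norm (nrm (CS V) (fenc U (X n) \<ominus>\<^bsub>CS V\<^esub> fenc U f) - 0) < e" if "n \<ge> N" for n
      using e ge[of n] that by (fastforce simp del: cblu_space_simps)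
    then show "\<exists>N. \<forall>n\<ge>N. norm (nrm (CS V) (fenc U (X n) \<ominus>\<^bsub>CS V\<^esub> fenc U f) - 0) < e" by blast
  qed
  with fm show thesis by (rule that)
qed

lemma banach_cblu_space:
  assumes V: "banach_module v s V"
  shows "banach_module v s (CS V)"
proof -
  interpret banach_module v s V by (rule V)
  note [simp] = cblu_funs_zero cblu_funs_add cblu_funs_smult
  have c [simp]: "f \<in> cblu_funs V \<Longrightarrow> f x \<in> carrier V" for f :: "'g \<Rightarrow> 'u" and x
    by (simp add: cblu_funs_def)
  have v: "v (a * b) = v a * v b" "0 \<le> v a" "v a = 0 \<longleftrightarrow> a = 0" for a b
    using valued by (simp_all add: complete_valued_field_def)
  have mod: "module field_ring (CS V)"
    by (rule moduleI[OF cring_field_ring abelian_group_cblu[OF V]])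
      (auto elim!: cblu_spaceE simp: smult_add smult_r_distr smult_mult)
  have ge0: "0 \<le> nrm (CS V) (fenc U f)" if f: "f \<in> cblu_funs V" for f
    by (rule order_trans[OF nrm_ge0[OF c[OF f, of 0]] nrm_le_cblu_nrm[OF f]])
  have eq0: "nrm (CS V) (fenc U f) = 0 \<longleftrightarrow> fenc U f = \<zero>\<^bsub>CS V\<^esub>" if f: "f \<in> cblu_funs V" for f
  proof
    assume "nrm (CS V) (fenc U f) = 0"
    then have "nrm V (f x) = 0" for x
      using nrm_le_cblu_nrm[OF f, of x] nrm_ge0[OF c[OF f, of x]] by linarith
    then show "fenc U f = \<zero>\<^bsub>CS V\<^esub>" using f by (auto simp: nrm_eq0)
  qed simp
  have smult: "nrm (CS V) (a \<odot>\<^bsub>CS V\<^esub> fenc U f) = v a * nrm (CS V) (fenc U f)"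
    if f: "f \<in> cblu_funs V" for f a
  proof (rule antisym)
    show "nrm (CS V) (a \<odot>\<^bsub>CS V\<^esub> fenc U f) \<le> v a * nrm (CS V) (fenc U f)"
      unfolding cblu_space_simps(3) by (rule cblu_nrm_smult_le[OF V f])
    \<comment> \<open>For nonzero a this is the inequality just shown, applied to
      \<open>inverse a\<close> and the function a f.\<close>
    show "v a * nrm (CS V) (fenc U f) \<le> nrm (CS V) (a \<odot>\<^bsub>CS V\<^esub> fenc U f)"
    proof (cases "a = 0")
      case True
      then show ?thesis
        using ge0[OF cblu_funs_smult[OF f, of a]] v(3)[of a] by (simp del: cblu_space_simps(4))
    next
      case False
      have "inverse a \<odot>\<^bsub>V\<^esub> (a \<odot>\<^bsub>V\<^esub> f x) = f x" for x
        using False f by (simp add: smult_mult[symmetric])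
      then have "nrm (CS V) (fenc U f) \<le> v (inverse a) * nrm (CS V) (a \<odot>\<^bsub>CS V\<^esub> fenc U f)"
        using cblu_nrm_smult_le[OF V cblu_funs_smult[OF f, of a], of "inverse a"]
        by (simp del: cblu_space_simps(4))
      from mult_left_mono[OF this v(2), of a] show ?thesis
        using v(1)[of a "inverse a"] v(1)[of 1 1] v(3)[of 1] False
        by (simp add: mult.assoc[symmetric] del: cblu_space_simps)
    qed
  qed
  have add: "nrm (CS V) (fenc U f \<oplus>\<^bsub>CS V\<^esub> fenc U h) \<le> nrm (CS V) (fenc U f) + nrm (CS V) (fenc U h)"
    if f: "f \<in> cblu_funs V" and h: "h \<in> cblu_funs V" for f h
    unfolding cblu_space_simps(2)
    by (rule cblu_nrm_le)
      (rule order_trans[OF nrm_add[OF c[OF f] c[OF h]] add_mono[OF nrm_le_cblu_nrm[OF f] nrm_le_cblu_nrm[OF h]]])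
  have strong: "nrm (CS V) (fenc U f \<oplus>\<^bsub>CS V\<^esub> fenc U h) \<le> max (nrm (CS V) (fenc U f)) (nrm (CS V) (fenc U h))"
    if s: "s" and f: "f \<in> cblu_funs V" and h: "h \<in> cblu_funs V" for f h
    unfolding cblu_space_simps(2)
    by (rule cblu_nrm_le)
      (rule order_trans[OF nrm_add_strong[OF s c[OF f] c[OF h]]
          max.mono[OF nrm_le_cblu_nrm[OF f] nrm_le_cblu_nrm[OF h]]])
  have complete: "\<exists>l\<in>carrier (CS V). (\<lambda>n. nrm (CS V) (X n \<ominus>\<^bsub>CS V\<^esub> l)) \<longlonglongrightarrow> 0"
    if X: "\<And>n. X n \<in> carrier (CS V)"
      and cauchy: "\<And>e. e > 0 \<Longrightarrow> \<exists>N::nat. \<forall>m\<ge>N. \<forall>n\<ge>N. nrm (CS V) (X m \<ominus>\<^bsub>CS V\<^esub> X n) < e" for X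
  proof -
    have X': "fenc U (fdec U (X n)) = X n" for n by (rule fenc_fdec[OF X])
    obtain f where "f \<in> cblu_funs V" "(\<lambda>n. nrm (CS V) (X n \<ominus>\<^bsub>CS V\<^esub> fenc U f)) \<longlonglongrightarrow> 0"
      by (rule cblu_complete[OF V, of "\<lambda>n. fdec U (X n)", unfolded X']) (use fdec_mem[OF X] cauchy in auto)
    then show ?thesis by (intro bexI[of _ "fenc U f"]) simp_all
  qed
  have "banach v s (CS V)"
    unfolding banach_def
  proof (intro conjI ballI allI impI mod)
    fix x y a assume x: "x \<in> carrier (CS V)" and y: "y \<in> carrier (CS V)"
    show "nrm (CS V) (x \<oplus>\<^bsub>CS V\<^esub> y) \<le> nrm (CS V) x + nrm (CS V) y"
      using add[OF fdec_mem[OF x] fdec_mem[OF y]] by (simp only: fenc_fdec[OF x] fenc_fdec[OF y])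
    show "nrm (CS V) (x \<oplus>\<^bsub>CS V\<^esub> y) \<le> max (nrm (CS V) x) (nrm (CS V) y)" if "s"
      using strong[OF that fdec_mem[OF x] fdec_mem[OF y]]
      by (simp only: fenc_fdec[OF x] fenc_fdec[OF y])
  next
    fix x a assume x: "x \<in> carrier (CS V)"
    show "0 \<le> nrm (CS V) x"
      using ge0[OF fdec_mem[OF x]] by (simp only: fenc_fdec[OF x])
    show "(nrm (CS V) x = 0) = (x = \<zero>\<^bsub>CS V\<^esub>)"
      using eq0[OF fdec_mem[OF x]] by (simp only: fenc_fdec[OF x])
    show "nrm (CS V) (a \<odot>\<^bsub>CS V\<^esub> x) = v a * nrm (CS V) x"
      using smult[OF fdec_mem[OF x]] by (simp only: fenc_fdec[OF x])
  next
    fix X :: "nat \<Rightarrow> 'u"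
    assume "(\<forall>n. X n \<in> carrier (CS V)) \<and>
      (\<forall>e>0. \<exists>N. \<forall>m\<ge>N. \<forall>n\<ge>N. nrm (CS V) (X m \<ominus>\<^bsub>CS V\<^esub> X n) < e)"
    then show "\<exists>l\<in>carrier (CS V). (\<lambda>n. nrm (CS V) (X n \<ominus>\<^bsub>CS V\<^esub> l)) \<longlonglongrightarrow> 0"
      using complete by blast
  qed
  then show ?thesis using valued by (simp add: banach_module_def)
qed

end

section \<open>The comonad on ind-objects\<close>

context cblu_universe
begin

section \<open>Functoriality in the Banach space, evaluation and translates\<close>

lemma cblu_funs_closed: "f \<in> cblu_funs V \<Longrightarrow> f x \<in> carrier V" for f :: "'g \<Rightarrow> 'u"
  by (simp add: cblu_funs_def)

lemma cblu_map_fenc [simp]: "f \<in> cblu_funs V \<Longrightarrow> cblu_map U V T (fenc U f) = fenc U (\<lambda>x. T (f x))"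
  by (simp add: cblu_map_def)

lemma cblu_map_apply:
  "a \<in> carrier (CS V) \<Longrightarrow> cblu_map U V T a = fenc U (\<lambda>x. T (fdec U a x))"
  by (simp add: cblu_map_def)

lemma cblu_map_bhom:
  assumes V: "banach_module v s V" and W: "banach_module v s W" and T: "T \<in> bhom V W"
  shows "cblu_map U V T \<in> bhom (CS V) (CS W)"
proof -
  interpret V: banach_module v s V by (rule V)
  note mem = V.cblu_funs_bhom[OF W T]
  obtain N where N: "N \<ge> 0" "\<And>x. x \<in> carrier V \<Longrightarrow> nrm W (T x) \<le> N * nrm V x"
    using bhom_bound[OF V T] by blast
  show ?thesis
  proof (rule bhomI[where M = N])
    show "nrm (CS W) (cblu_map U V T a) \<le> N * nrm (CS V) a" if a: "a \<in> carrier (CS V)" for a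
    proof -
      obtain f where f: "a = fenc U f" "f \<in> cblu_funs V" by (rule cblu_spaceE[OF a])
      have "nrm W (T (f x)) \<le> N * nrm (CS V) (fenc U f)" for x
        by (rule order_trans[OF N(2)[OF cblu_funs_closed[OF f(2)]]
              mult_left_mono[OF nrm_le_cblu_nrm[OF f(2)] N(1)]])
      then show ?thesis unfolding f(1) cblu_map_fenc[OF f(2)] by (rule cblu_nrm_le)
    qed
    show "cblu_map U V T \<in> extensional (carrier (CS V))"
      by (simp add: cblu_map_def)
  qed (auto elim!: cblu_spaceE simp: mem V.cblu_funs_add V.cblu_funs_smult bhom_add[OF T] bhom_smult[OF T]
      cblu_funs_closed)
qed

lemma cblu_map_compose:
  assumes "banach_module v s V" and W: "banach_module v s W" and T: "T \<in> bhom V W"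
  shows "compose (carrier (CS V)) (cblu_map U W S) (cblu_map U V T) =
    cblu_map U V (compose (carrier V) S T)"
proof (rule extensionalityI)
  fix a assume a: "a \<in> carrier (CS V)"
  obtain f where f: "a = fenc U f" "f \<in> cblu_funs V" by (rule cblu_spaceE[OF a])
  then show "compose (carrier (CS V)) (cblu_map U W S) (cblu_map U V T) a =
      cblu_map U V (compose (carrier V) S T) a"
    by (simp add: compose_eq banach_module.cblu_funs_bhom[OF assms] cblu_funs_closed)
qed (simp_all add: cblu_map_def)

lemma cblu_map_idt: "cblu_map U V (\<lambda>x\<in>carrier V. x) = (\<lambda>a\<in>carrier (CS V). a)"
  by (rule extensionalityI[of _ "carrier (CS V)"])
    (auto simp: cblu_map_def cblu_funs_closed elim!: cblu_spaceE)

text \<open>Evaluation at a point has norm at most 1. At 0 it is the counit, and at - g it recovers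
  the action of g from a coaction.\<close>

lemma fdec_bhom:
  assumes V: "banach_module v s V"
  shows "(\<lambda>a\<in>carrier (CS V). fdec U a x) \<in> bhom (CS V) V"
proof -
  interpret V: banach_module v s V by (rule V)
  show ?thesis
  proof (rule bhomI[where M = 1])
    show "nrm V ((\<lambda>a\<in>carrier (CS V). fdec U a x) a) \<le> 1 * nrm (CS V) a"
      if a: "a \<in> carrier (CS V)" for a
      using nrm_le_cblu_nrm[OF fdec_mem[OF a], of x] a by (simp add: fenc_fdec del: cblu_space_simps)
  qed (auto elim!: cblu_spaceE simp: V.cblu_funs_add V.cblu_funs_smult cblu_funs_closed)
qed

text \<open>The comultiplication over a single Banach space, which \<open>comult\<close> applies
  index by index.\<close>

definition translates :: "('k, 'u) nmod \<Rightarrow> 'u \<Rightarrow> 'u" where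
  "translates V = (\<lambda>a\<in>carrier (CS V). fenc U (\<lambda>x. fenc U (\<lambda>y. fdec U a (x + y))))"

lemma translates_fenc:
  "f \<in> cblu_funs V \<Longrightarrow> translates V (fenc U f) = fenc U (\<lambda>x. fenc U (\<lambda>y. f (x + y)))"
  by (simp add: translates_def)

text \<open>In h + x + y the element h still perturbs on the left, whatever y is. The left uniform
  estimate for f therefore bounds the inner supremum over y, which continuity of f alone would not
  do.\<close>

lemma translates_mem:
  assumes V: "banach_module v s V" and f: "f \<in> cblu_funs V"
  shows "(\<lambda>x. fenc U (\<lambda>y. f (x + y))) \<in> cblu_funs (CS V)"
proof -
  interpret V: banach_module v s V by (rule V)
  interpret C: banach_module v s "CS V" by (rule banach_cblu_space[OF V])
  note t = V.cblu_funs_translate[OF f]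
  show ?thesis
  proof (rule C.cblu_funsI[where M = "nrm (CS V) (fenc U f)"])
    show "nrm (CS V) (fenc U (\<lambda>y. f (x + y))) \<le> nrm (CS V) (fenc U f)" for x
      by (rule cblu_nrm_le) (rule nrm_le_cblu_nrm[OF f])
    fix e :: real assume "e > 0"
    from V.cblu_funs_uniform[OF f this]
    show "\<forall>\<^sub>F h in nhds 0. \<forall>x. nrm (CS V) (fenc U (\<lambda>y. f (h + x + y)) \<ominus>\<^bsub>CS V\<^esub> fenc U (\<lambda>y. f (x + y))) \<le> e"
    proof (eventually_elim, intro allI)
      fix h x assume "\<forall>x. nrm V (f (h + x) \<ominus>\<^bsub>V\<^esub> f x) \<le> e"
      then show "nrm (CS V) (fenc U (\<lambda>y. f (h + x + y)) \<ominus>\<^bsub>CS V\<^esub> fenc U (\<lambda>y. f (x + y))) \<le> e"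
        unfolding cblu_diff[OF V t t] by (intro cblu_nrm_le) (simp add: add.assoc)
    qed
  qed (simp add: t)
qed

lemma translates_bhom:
  assumes V: "banach_module v s V"
  shows "translates V \<in> bhom (CS V) (CS (CS V))"
proof -
  interpret V: banach_module v s V by (rule V)
  show ?thesis
  proof (rule bhomI[where M = 1])
    show "nrm (CS (CS V)) (translates V a) \<le> 1 * nrm (CS V) a" if a: "a \<in> carrier (CS V)" for a
    proof -
      obtain f where f: "a = fenc U f" "f \<in> cblu_funs V" by (rule cblu_spaceE[OF a])
      show ?thesis
        unfolding f(1) translates_fenc[OF f(2)] mult_1
        by (rule cblu_nrm_le, rule cblu_nrm_le) (rule nrm_le_cblu_nrm[OF f(2)])
    qed
  qed (auto elim!: cblu_spaceE simp: translates_mem[OF V] V.cblu_funs_add V.cblu_funs_smult translates_fenc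
      , auto simp: translates_def)
qed

lemma cblu_obj_simps [simp]:
  "idx (cblu_obj U X) = idx X" "sp (cblu_obj U X) i = CS (sp X i)"
  "amap (dgm (cblu_obj U X)) i j u = cblu_map U (sp X i) (amap (dgm X) i j u)"
  by (simp_all add: cblu_obj_def)

lemma ind_banach_cblu_obj:
  assumes X: "ind_banach v s X"
  shows "ind_banach v s (cblu_obj U X)"
proof -
  interpret ind_banach v s X by (rule X)
  have B: "banach_module v s V \<Longrightarrow> V \<in> obs (Ban v s)" for V :: "('k, 'u) nmod"
    by (simp add: Ban_def banach_module_def)
  have "is_functor (idx X) (Ban v s) (dgm (cblu_obj U X))"
    unfolding is_functor_def cblu_obj_simps
  proof (intro conjI ballI)
    show "CS (sp X i) \<in> obs (Ban v s)" if "i \<in> ix X" for i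
      by (rule B[OF banach_cblu_space[OF sp_banach[OF that]]])
    show "cblu_map U (sp X i) (tr i j u) \<in> homs (Ban v s) (CS (sp X i)) (CS (sp X j))"
      if "i \<in> ix X" "j \<in> ix X" "u \<in> homs (idx X) i j" for i j u
      using cblu_map_bhom[OF sp_banach sp_banach tr_bhom] that by (simp add: Ban_def)
    show "cblu_map U (sp X i) (tr i i (idt (idx X) i)) = idt (Ban v s) (CS (sp X i))"
      if "i \<in> ix X" for i
      using functor_idt[OF functor_dgm that] by (simp add: Ban_def cblu_map_idt)
    show "cblu_map U (sp X i) (tr i l (cmp (idx X) i j l w u)) =
        cmp (Ban v s) (CS (sp X i)) (CS (sp X j)) (CS (sp X l))
          (cblu_map U (sp X j) (tr j l w)) (cblu_map U (sp X i) (tr i j u))"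
      if "i \<in> ix X" "j \<in> ix X" "l \<in> ix X" "u \<in> homs (idx X) i j" "w \<in> homs (idx X) j l" for i j l u w
      using functor_cmp[OF functor_dgm that] cblu_map_compose[OF sp_banach sp_banach tr_bhom, of i j u] that
      by (simp add: Ban_def)
  qed
  then show ?thesis
    using valued filtered_idx by (simp add: ind_banach_def ind_object_def)
qed

text \<open>Transition maps of \<open>cblu_obj U X\<close> act pointwise and \<open>fenc\<close> is
  injective. Equality of encoded functions at an index is thus equality for every group element at
  that same index, and a map into functions can be uncurried without changing the index of
  comparison.\<close>

lemma ev_eq_cblu:
  assumes X: "ind_banach v s X" and o: "j \<in> ix X" "j' \<in> ix X"
    and a: "a \<in> D \<rightarrow> carrier (CS (sp X j))" "a' \<in> D \<rightarrow> carrier (CS (sp X j'))"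
  shows "ev_eq (cblu_obj U X) D j a j' a' \<longleftrightarrow>
    ev_eq X (UNIV \<times> D) j (\<lambda>(g, d). fdec U (a d) g) j' (\<lambda>(g, d). fdec U (a' d) g)"
proof -
  have "(\<forall>x\<in>D. cblu_map U (sp X j) f (a x) = cblu_map U (sp X j') f' (a' x)) \<longleftrightarrow>
      (\<forall>y\<in>UNIV \<times> D. f ((\<lambda>(g, d). fdec U (a d) g) y) = f' ((\<lambda>(g, d). fdec U (a' d) g) y))" for f f'
    using a by (auto simp: cblu_map_apply Pi_iff fun_eq_iff)
  then show ?thesis
    by (simp only: ev_eq_def cblu_obj_simps)
qed

text \<open>Read pointwise by \<open>ev_eq_cblu\<close>, this is the hypothesis at the points
  \<open>fdec U a g\<close>, so the index at which f and f' agree serves again.\<close>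

lemma ev_eq_cblu_map:
  assumes Y: "ind_banach v s Y" and o: "j \<in> ix Y" "j' \<in> ix Y" and V: "banach_module v s V"
    and f: "f \<in> bhom V (sp Y j)" "f' \<in> bhom V (sp Y j')"
    and e: "ev_eq Y (carrier V) j f j' f'"
  shows "ev_eq (cblu_obj U Y) (carrier (CS V)) j (cblu_map U V f) j' (cblu_map U V f')"
proof -
  interpret Y: ind_banach v s Y by (rule Y)
  note b = cblu_map_bhom[OF V Y.sp_banach[OF o(1)] f(1)] cblu_map_bhom[OF V Y.sp_banach[OF o(2)] f(2)]
  show ?thesis
    unfolding ev_eq_cblu[OF Y o homs_carrier[OF b(1)] homs_carrier[OF b(2)]]
    by (rule Y.ev_eq_comp[OF e, where k = "\<lambda>(g, a). fdec U a g"])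
      (auto simp: cblu_map_apply fdec_closed)
qed

abbreviation CM :: "('k, 'u) ind \<Rightarrow> ('k, 'u) ind \<Rightarrow> 'u indmap \<Rightarrow> 'u indmap" where
  "CM \<equiv> amap (endo (Cblu v s U))"

lemma endo_Cblu [simp]: "omap (endo (Cblu v s U)) = cblu_obj U"
  by (simp add: Cblu_def)

context
  fixes X Y :: "('k, 'u) ind" and \<phi> :: "'u indmap"
  assumes X: "ind_banach v s X" and Y: "ind_banach v s Y" and \<phi>: "\<phi> \<in> ind_hom X Y"
begin

interpretation X: ind_banach v s X by (rule X)
interpretation Y: ind_banach v s Y by (rule Y)
interpretation CX: ind_banach v s "cblu_obj U X" by (rule ind_banach_cblu_obj[OF X])
interpretation CY: ind_banach v s "cblu_obj U Y" by (rule ind_banach_cblu_obj[OF Y])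

lemma cblu_map_rep:
  assumes i: "i \<in> ix X" and f: "(j, f) \<in> \<phi> i"
  shows "j \<in> ix (cblu_obj U Y)"
    "cblu_map U (sp X i) f \<in> bhom (sp (cblu_obj U X) i) (sp (cblu_obj U Y) j)"
  using Y.ind_homD[OF \<phi> i f] cblu_map_bhom[OF X.sp_banach[OF i] Y.sp_banach] by simp_all

text \<open>As for composition, the union over representatives reduces to one class, because
  pointwise application preserves eventual equality.\<close>

lemma CM_cls:
  assumes i: "i \<in> ix X" and f: "(j, f) \<in> \<phi> i"
  shows "CM X Y \<phi> i = ind_cls (cblu_obj U X) (cblu_obj U Y) i j (cblu_map U (sp X i) f)"
proof -
  let ?c = "ind_cls (cblu_obj U X) (cblu_obj U Y) i j (cblu_map U (sp X i) f)"
  have cls: "ind_cls (cblu_obj U X) (cblu_obj U Y) i j' (cblu_map U (sp X i) f') = ?c"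
    if f': "(j', f') \<in> \<phi> i" for j' f'
  proof (rule CY.colim_set_eqI[OF homs_subset CY.ind_cls_colim[OF cblu_map_rep[OF i f']]
        CY.ind_cls_colim[OF cblu_map_rep[OF i f]] CY.ind_cls_self[OF cblu_map_rep[OF i f']]])
    note d = Y.ind_homD[OF \<phi> i f] Y.ind_homD[OF \<phi> i f']
    have "ev_eq (cblu_obj U Y) (carrier (CS (sp X i))) j (cblu_map U (sp X i) f) j' (cblu_map U (sp X i) f')"
      using d by (intro ev_eq_cblu_map[OF Y _ _ X.sp_banach[OF i]] Y.ind_hom_ev[OF \<phi> i f f']) simp_all
    then show "(j', cblu_map U (sp X i) f') \<in> ?c"
      using cblu_map_rep[OF i f] cblu_map_rep[OF i f'] by (simp add: ind_cls_def colim_rel_def)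
  qed
  have "(\<Union>(j, f)\<in>\<phi> i. ind_cls (cblu_obj U X) (cblu_obj U Y) i j (cblu_map U (sp X i) f)) = ?c"
    (is "?U = _")
  proof
    show "?U \<subseteq> ?c"
    proof
      fix r assume "r \<in> ?U"
      then obtain j' f' where "(j', f') \<in> \<phi> i"
        "r \<in> ind_cls (cblu_obj U X) (cblu_obj U Y) i j' (cblu_map U (sp X i) f')"
        by (auto simp only: UN_iff case_prod_beta fst_conv snd_conv)
      with cls show "r \<in> ?c" by simp
    qed
    show "?c \<subseteq> ?U"
      by (rule subsetI, rule UN_I[OF f], simp only: prod.case)
  qed
  then show ?thesis using i by (simp add: Cblu_def)
qed

lemma CM_mem: "i \<in> ix X \<Longrightarrow> (j, f) \<in> \<phi> i \<Longrightarrow> (j, cblu_map U (sp X i) f) \<in> CM X Y \<phi> i"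
  using CY.ind_cls_self[OF cblu_map_rep] by (simp only: CM_cls)

lemma CM_hom: "CM X Y \<phi> \<in> ind_hom (cblu_obj U X) (cblu_obj U Y)"
proof -
  have "\<exists>j f. (j, f) \<in> \<phi> i" if "i \<in> ix X" for i
    using Y.ind_hom_rep[OF \<phi> that] by blast
  then obtain J F where r: "\<And>i. i \<in> ix X \<Longrightarrow> (J i, F i) \<in> \<phi> i"
    by metis
  show ?thesis
  proof (rule CY.ind_homI[OF CX.ind_banach_axioms, where J = J and F = "\<lambda>i. cblu_map U (sp X i) (F i)"])
    show "CM X Y \<phi> \<in> extensional (ix (cblu_obj U X))"
      by (simp add: Cblu_def)
    show "J i \<in> ix (cblu_obj U Y) \<and>
        cblu_map U (sp X i) (F i) \<in> bhom (sp (cblu_obj U X) i) (sp (cblu_obj U Y) (J i)) \<and>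
        CM X Y \<phi> i = ind_cls (cblu_obj U X) (cblu_obj U Y) i (J i) (cblu_map U (sp X i) (F i))"
      if "i \<in> ix (cblu_obj U X)" for i
      using that cblu_map_rep[OF _ r] CM_cls[OF _ r] by simp
    fix i i' u assume "i \<in> ix (cblu_obj U X)" "i' \<in> ix (cblu_obj U X)"
      "u \<in> homs (idx (cblu_obj U X)) i i'"
    then have i: "i \<in> ix X" and i': "i' \<in> ix X" and u: "u \<in> homs (idx X) i i'" by simp_all
    note rr = r[OF i] ind_hom_nat[OF \<phi> i i' u r[OF i']]
    note d = Y.ind_homD[OF \<phi> i rr(1)] Y.ind_homD[OF \<phi> i rr(2)]
    have "ev_eq (cblu_obj U Y) (carrier (CS (sp X i))) (J i) (cblu_map U (sp X i) (F i))
        (J i') (cblu_map U (sp X i) (compose (carrier (sp X i)) (F i') (amap (dgm X) i i' u)))"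
      using d by (intro ev_eq_cblu_map[OF Y _ _ X.sp_banach[OF i]] Y.ind_hom_ev[OF \<phi> i rr]) simp_all
    then have "ev_eq (cblu_obj U Y) (carrier (CS (sp X i))) (J i) (cblu_map U (sp X i) (F i))
        (J i') (\<lambda>x. cblu_map U (sp X i') (F i') (cblu_map U (sp X i) (amap (dgm X) i i' u) x))"
      by (rule CY.ev_eq_cong)
        (simp_all add: cblu_map_compose[OF X.sp_banach[OF i] X.sp_banach[OF i'] X.tr_bhom[OF i i' u], symmetric]
          compose_eq)
    then show "ev_eq (cblu_obj U Y) (carrier (sp (cblu_obj U X) i)) (J i) (cblu_map U (sp X i) (F i))
        (J i') (\<lambda>x. cblu_map U (sp X i') (F i') (amap (dgm (cblu_obj U X)) i i' u x))"
      by simp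
  qed
qed

end

lemma IndBan_simps [simp]:
  "homs (IndBan v s) = ind_hom" "cmp (IndBan v s) = ind_comp"
  "X \<in> obs (IndBan v s) \<longleftrightarrow> ind_banach v s X"
  by (simp_all add: IndBan_def ind_banach_def valued)

lemma functor_Cblu: "is_functor (IndBan v s) (IndBan v s) (endo (Cblu v s U))"
  unfolding is_functor_def endo_Cblu IndBan_simps
proof (intro conjI ballI; unfold IndBan_simps)
  fix X :: "('k, 'u) ind" assume X: "ind_banach v s X"
  note CX = ind_banach_cblu_obj[OF X]
  show "ind_banach v s (cblu_obj U X)" by (rule CX)
  note id = idt_IndBan[OF X] and idC = idt_IndBan[OF CX]
  show "CM X X (idt (IndBan v s) X) = idt (IndBan v s) (cblu_obj U X)"
  proof (rule ind_banach.ind_hom_eqI[OF CX CM_hom[OF X X id(1)] idC(1)])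
    fix i assume "i \<in> ix (cblu_obj U X)"
    then have i: "i \<in> ix X" by simp
    show "\<exists>r. r \<in> CM X X (idt (IndBan v s) X) i \<and> r \<in> idt (IndBan v s) (cblu_obj U X) i"
      using CM_mem[OF X X id(1) i id(2)[OF i]] idC(2)[of i] i
      unfolding cblu_map_idt cblu_obj_simps by blast
  qed
next
  fix X Y :: "('k, 'u) ind" and \<phi>
  assume "ind_banach v s X" "ind_banach v s Y" "\<phi> \<in> ind_hom X Y"
  then show "CM X Y \<phi> \<in> ind_hom (cblu_obj U X) (cblu_obj U Y)" by (rule CM_hom)
next
  fix X Y Z :: "('k, 'u) ind" and \<phi> \<psi>
  assume X: "ind_banach v s X" and Y: "ind_banach v s Y" and Z: "ind_banach v s Z"
    and \<phi>: "\<phi> \<in> ind_hom X Y" and \<psi>: "\<psi> \<in> ind_hom Y Z"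
  interpret A: ind_triple v s X Y Z \<phi> \<psi>
    by (intro ind_triple.intro ind_triple_axioms.intro X Y Z \<phi> \<psi>)
  interpret B: ind_triple v s "cblu_obj U X" "cblu_obj U Y" "cblu_obj U Z" "CM X Y \<phi>" "CM Y Z \<psi>"
    by (intro ind_triple.intro ind_triple_axioms.intro ind_banach_cblu_obj CM_hom X Y Z \<phi> \<psi>)
  show "CM X Z (ind_comp X Y Z \<psi> \<phi>) =
      ind_comp (cblu_obj U X) (cblu_obj U Y) (cblu_obj U Z) (CM Y Z \<psi>) (CM X Y \<phi>)"
  proof (rule B.Z.ind_hom_eqI[OF CM_hom[OF X Z A.ind_comp_hom] B.ind_comp_hom])
    fix i assume "i \<in> ix (cblu_obj U X)"
    then have i: "i \<in> ix X" by simp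
    obtain j f where f: "(j, f) \<in> \<phi> i" by (rule A.Y.ind_hom_rep[OF \<phi> i])
    note df = A.Y.ind_homD[OF \<phi> i f]
    obtain l h where h: "(l, h) \<in> \<psi> j" by (rule A.Z.ind_hom_rep[OF \<psi> conjunct1[OF df]])
    show "\<exists>r. r \<in> CM X Z (ind_comp X Y Z \<psi> \<phi>) i \<and>
        r \<in> ind_comp (cblu_obj U X) (cblu_obj U Y) (cblu_obj U Z) (CM Y Z \<psi>) (CM X Y \<phi>) i"
      using CM_mem[OF X Z A.ind_comp_hom i A.ind_comp_mem[OF i f h]]
        B.ind_comp_mem[OF _ CM_mem[OF X Y \<phi> i f] CM_mem[OF Y Z \<psi> conjunct1[OF df] h]] i
        cblu_map_compose[OF A.X.sp_banach[OF i] A.Y.sp_banach[OF conjunct1[OF df]] conjunct2[OF df]]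
      by auto
  qed
qed

section \<open>Counit and comultiplication as morphisms of ind-objects\<close>

lemma counit_Cblu:
  assumes X: "ind_banach v s X"
  shows "counit (Cblu v s U) X \<in> ind_hom (cblu_obj U X) X"
    and "i \<in> ix X \<Longrightarrow> (i, \<lambda>a\<in>carrier (CS (sp X i)). fdec U a 0) \<in> counit (Cblu v s U) X i"
proof -
  interpret ind_banach v s X by (rule X)
  have eq: "counit (Cblu v s U) X = level_map (cblu_obj U X) X (\<lambda>i. \<lambda>a\<in>carrier (CS (sp X i)). fdec U a 0)"
    by (simp add: Cblu_def)
  have nat: "(\<lambda>a\<in>carrier (CS (sp X i')). fdec U a 0) (amap (dgm (cblu_obj U X)) i i' u x) =
      tr i i' u ((\<lambda>a\<in>carrier (CS (sp X i)). fdec U a 0) x)"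
    if "i \<in> ix X" "i' \<in> ix X" "u \<in> homs (idx X) i i'" "x \<in> carrier (CS (sp X i))" for i i' u x
    using that bhom_closed[OF cblu_map_bhom[OF sp_banach sp_banach tr_bhom]]
    by (simp add: cblu_map_apply)
  note lm = level_map_hom[OF ind_banach_cblu_obj[OF X] X, of "\<lambda>i. \<lambda>a\<in>carrier (CS (sp X i)). fdec U a 0"]
  show "counit (Cblu v s U) X \<in> ind_hom (cblu_obj U X) X"
    unfolding eq by (rule lm(1)) (use nat fdec_bhom[OF sp_banach] in simp_all)
  show "i \<in> ix X \<Longrightarrow> (i, \<lambda>a\<in>carrier (CS (sp X i)). fdec U a 0) \<in> counit (Cblu v s U) X i"
    unfolding eq by (rule lm(2)) (use nat fdec_bhom[OF sp_banach] in simp_all)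
qed

lemma comult_Cblu:
  assumes X: "ind_banach v s X"
  shows "comult (Cblu v s U) X \<in> ind_hom (cblu_obj U X) (cblu_obj U (cblu_obj U X))"
    and "i \<in> ix X \<Longrightarrow> (i, translates (sp X i)) \<in> comult (Cblu v s U) X i"
proof -
  interpret ind_banach v s X by (rule X)
  have eq: "comult (Cblu v s U) X =
      level_map (cblu_obj U X) (cblu_obj U (cblu_obj U X)) (\<lambda>i. translates (sp X i))"
    by (simp add: Cblu_def translates_def)
  have nat: "translates (sp X i') (cblu_map U (sp X i) (tr i i' u) x) =
      cblu_map U (CS (sp X i)) (cblu_map U (sp X i) (tr i i' u)) (translates (sp X i) x)"
    if i: "i \<in> ix X" "i' \<in> ix X" "u \<in> homs (idx X) i i'" and x: "x \<in> carrier (CS (sp X i))" for i i' u x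
  proof -
    obtain f where f: "x = fenc U f" "f \<in> cblu_funs (sp X i)" by (rule cblu_spaceE[OF x])
    then show ?thesis
      using banach_module.cblu_funs_bhom[OF sp_banach[OF i(1)] sp_banach[OF i(2)] tr_bhom[OF i] f(2)]
        translates_mem[OF sp_banach[OF i(1)] f(2)]
        banach_module.cblu_funs_translate[OF sp_banach[OF i(1)] f(2)]
      by (simp add: translates_fenc)
  qed
  note lm = level_map_hom[OF ind_banach_cblu_obj[OF X] ind_banach_cblu_obj[OF ind_banach_cblu_obj[OF X]],
      of "\<lambda>i. translates (sp X i)"]
  show "comult (Cblu v s U) X \<in> ind_hom (cblu_obj U X) (cblu_obj U (cblu_obj U X))"
    unfolding eq by (rule lm(1)) (use nat translates_bhom[OF sp_banach] in simp_all)
  show "i \<in> ix X \<Longrightarrow> (i, translates (sp X i)) \<in> comult (Cblu v s U) X i"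
    unfolding eq by (rule lm(2)) (use nat translates_bhom[OF sp_banach] in simp_all)
qed

end

section \<open>From isometric modules to coalgebras\<close>

text \<open>Supplies for families the hypothesis of the colimit lemmas, as
  \<open>homs_subset\<close> does for bounded maps.\<close>

lemma families_subset: "families V W \<subseteq> (UNIV \<times> carrier V \<rightarrow> carrier W)"
proof
  fix a assume a: "a \<in> families V W"
  have "(\<lambda>x. a (g, x)) \<in> bhom V W" for g
    using a by (simp add: families_def)
  then show "a \<in> UNIV \<times> carrier V \<rightarrow> carrier W"
    using bhom_closed by (fastforce simp: Pi_iff)
qed

context cblu_universe
begin

text \<open>A coaction sends v to the function with value x^{-1} v at x, so g acts by evaluation at
  \<open>- g\<close>. The value \<open>undefined\<close> off the carrier is the convention of
  extensional functions that membership in \<open>bhom\<close> requires.\<close>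

definition family_of :: "('k, 'u) nmod \<Rightarrow> ('u \<Rightarrow> 'u) \<Rightarrow> 'g \<times> 'u \<Rightarrow> 'u" where
  "family_of V r = (\<lambda>(g, x). if x \<in> carrier V then fdec U (r x) (- g) else undefined)"

lemma family_of_families:
  assumes V: "banach_module v s V" and W: "banach_module v s W" and r: "r \<in> bhom V (CS W)"
  shows "family_of V r \<in> families V W"
proof -
  have "(\<lambda>x. family_of V r (g, x)) = compose (carrier V) (\<lambda>a\<in>carrier (CS W). fdec U a (- g)) r" for g
    by (rule ext) (simp add: family_of_def compose_def bhom_closed[OF r])
  then show ?thesis
    using bhom_compose[OF r fdec_bhom[OF W] banach_cblu_space[OF W] V] by (simp add: families_def)
qed

text \<open>After uncurrying by \<open>ev_eq_cblu\<close> the two sides differ by g -> - g, which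
  permutes the group variable.\<close>

lemma ev_eq_family_of:
  assumes X: "ind_banach v s X" and o: "j \<in> ix X" "j' \<in> ix X"
    and r: "r \<in> bhom V (CS (sp X j))" "r' \<in> bhom V (CS (sp X j'))"
  shows "ev_eq (cblu_obj U X) (carrier V) j r j' r' \<longleftrightarrow>
    ev_eq X (UNIV \<times> carrier V) j (family_of V r) j' (family_of V r')"
proof -
  interpret ind_banach v s X by (rule X)
  have k: "(\<lambda>(g, x). (- g, x)) \<in> UNIV \<times> carrier V \<rightarrow> UNIV \<times> carrier V" by auto
  show ?thesis
    unfolding ev_eq_cblu[OF X o homs_carrier[OF r(1)] homs_carrier[OF r(2)]]
    by (rule iffI; erule ev_eq_comp[OF _ k]) (auto simp: family_of_def)
qed

text \<open>Two uncurryings, one for each application of the function space. The variable uncurried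
  last stands in front: g is the argument of the outer function, h that of the inner one.\<close>

lemma ev_eq_coassoc:
  assumes X: "ind_banach v s X" and V: "banach_module v s V" and o: "j \<in> ix X" "l \<in> ix X"
    and r: "r \<in> bhom V (CS (sp X j))" and t: "t \<in> bhom (sp X j) (CS (sp X l))"
  shows "ev_eq (cblu_obj U (cblu_obj U X)) (carrier V)
      j (compose (carrier V) (translates (sp X j)) r)
      l (compose (carrier V) (cblu_map U (sp X j) t) r) \<longleftrightarrow>
    ev_eq X (UNIV \<times> UNIV \<times> carrier V) j (\<lambda>(h, g, x). fdec U (r x) (g + h))
      l (\<lambda>(h, g, x). fdec U (t (fdec U (r x) g)) h)"
proof -
  interpret ind_banach v s X by (rule X)
  interpret C: ind_banach v s "cblu_obj U X" by (rule ind_banach_cblu_obj[OF X])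
  note B = sp_banach[OF o(1)] sp_banach[OF o(2)]
  have R: "fdec U (r x) \<in> cblu_funs (sp X j)" if "x \<in> carrier V" for x
    by (rule fdec_mem[OF bhom_closed[OF r that]])
  have T: "compose (carrier V) (translates (sp X j)) r \<in> carrier V \<rightarrow> carrier (CS (CS (sp X j)))"
    "compose (carrier V) (cblu_map U (sp X j) t) r \<in> carrier V \<rightarrow> carrier (CS (CS (sp X l)))"
    by (auto simp: compose_eq bhom_closed[OF r] bhom_closed[OF translates_bhom[OF B(1)]]
        bhom_closed[OF cblu_map_bhom[OF B(1) banach_cblu_space[OF B(2)] t]])
  have Te: "compose (carrier V) (translates (sp X j)) r x = fenc U (\<lambda>g. fenc U (\<lambda>h. fdec U (r x) (g + h)))"
    "compose (carrier V) (cblu_map U (sp X j) t) r x = fenc U (\<lambda>g. t (fdec U (r x) g))"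
    if "x \<in> carrier V" for x
    using that by (simp_all add: compose_eq translates_def cblu_map_apply bhom_closed[OF r])
  have 1: "ev_eq (cblu_obj U (cblu_obj U X)) (carrier V)
      j (compose (carrier V) (translates (sp X j)) r)
      l (compose (carrier V) (cblu_map U (sp X j) t) r) \<longleftrightarrow>
    ev_eq (cblu_obj U X) (UNIV \<times> carrier V)
      j (\<lambda>(g, x). fdec U (compose (carrier V) (translates (sp X j)) r x) g)
      l (\<lambda>(g, x). fdec U (compose (carrier V) (cblu_map U (sp X j) t) r x) g)"
    using T by (intro ev_eq_cblu[OF C.ind_banach_axioms]) (simp_all add: o)
  have 2: "\<dots> \<longleftrightarrow> ev_eq X (UNIV \<times> UNIV \<times> carrier V)
      j (\<lambda>(h, d). fdec U ((\<lambda>(g, x). fdec U (compose (carrier V) (translates (sp X j)) r x) g) d) h)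
      l (\<lambda>(h, d). fdec U ((\<lambda>(g, x). fdec U (compose (carrier V) (cblu_map U (sp X j) t) r x) g) d) h)"
  proof (rule ev_eq_cblu[OF X o])
    show "(\<lambda>(g, x). fdec U (compose (carrier V) (translates (sp X j)) r x) g)
        \<in> UNIV \<times> carrier V \<rightarrow> carrier (CS (sp X j))"
      using T(1) by (auto simp: Pi_iff intro!: fdec_closed)
    show "(\<lambda>(g, x). fdec U (compose (carrier V) (cblu_map U (sp X j) t) r x) g)
        \<in> UNIV \<times> carrier V \<rightarrow> carrier (CS (sp X l))"
      using T(2) by (auto simp: Pi_iff intro!: fdec_closed)
  qed
  have 3: "\<dots> \<longleftrightarrow> ev_eq X (UNIV \<times> UNIV \<times> carrier V) j (\<lambda>(h, g, x). fdec U (r x) (g + h))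
      l (\<lambda>(h, g, x). fdec U (t (fdec U (r x) g)) h)"
    by (rule iffI; erule ev_eq_cong) (auto simp: Te)
  show ?thesis unfolding 1 2 3 ..
qed

text \<open>Collecting every representative of the action that factors through left uniformly
  continuous functions avoids a choice. That such representatives exist is the content of
  \<open>coaction_rep\<close>.\<close>

definition coaction ::
  "('k, 'u) ind \<Rightarrow> ('g, 'u) ind_action \<Rightarrow> 'u indmap" where
  "coaction X \<alpha> = (\<lambda>i\<in>ix X. {(j, r). j \<in> ix X \<and> r \<in> bhom (sp X i) (CS (sp X j)) \<and>
     (j, family_of (sp X i) r) \<in> \<alpha> i})"

end

section \<open>The coalgebra of an isometric module\<close>

locale isometric_action = cblu_universe v s U + X: ind_banach v s X
  for v :: "'k::field \<Rightarrow> real" and s :: bool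
    and U :: "('k, 'g::topological_group_add, 'u) univ" and X :: "('k, 'u) ind" +
  fixes \<alpha> :: "('g, 'u) ind_action"
  assumes action: "iso_action X \<alpha>"
begin

sublocale CX: ind_banach v s "cblu_obj U X"
  by (rule ind_banach_cblu_obj[OF X.ind_banach_axioms])

lemma act_colim:
  "i \<in> ix X \<Longrightarrow> \<alpha> i \<in> colim_set X (UNIV \<times> carrier (sp X i)) (\<lambda>j. families (sp X i) (sp X j))"
  using action unfolding iso_action_def by (meson PiE_mem)

lemma act_nat:
  "i \<in> ix X \<Longrightarrow> i' \<in> ix X \<Longrightarrow> u \<in> homs (idx X) i i' \<Longrightarrow> (j, a) \<in> \<alpha> i' \<Longrightarrow>
    (j, \<lambda>(g, x). compose (carrier (sp X i)) (\<lambda>y. a (g, y)) (X.tr i i' u) x) \<in> \<alpha> i"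
  using action unfolding iso_action_def by blast

lemma act_unit:
  "i \<in> ix X \<Longrightarrow> (j, a) \<in> \<alpha> i \<Longrightarrow> ev_eq X (carrier (sp X i)) j (\<lambda>x. a (0, x)) i (\<lambda>x. x)"
  using action unfolding iso_action_def by blast

lemma act_mult:
  "i \<in> ix X \<Longrightarrow> (j, a) \<in> \<alpha> i \<Longrightarrow> (l, b) \<in> \<alpha> j \<Longrightarrow>
    ev_eq X (UNIV \<times> UNIV \<times> carrier (sp X i)) l (\<lambda>(g, h, x). b (g, a (h, x))) j (\<lambda>(g, h, x). a (g + h, x))"
  using action unfolding iso_action_def by blast

lemma act_isometric:
  assumes "i \<in> ix X"
  obtains j a where "(j, a) \<in> \<alpha> i" "isometric_family (sp X i) (sp X j) a"
    "strongly_continuous_family (sp X i) (sp X j) a"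
  using action assms unfolding iso_action_def by blast

lemma actD: "i \<in> ix X \<Longrightarrow> (j, a) \<in> \<alpha> i \<Longrightarrow> j \<in> ix X \<and> a \<in> families (sp X i) (sp X j)"
  by (rule X.colim_setD[OF families_subset act_colim])

lemma act_ev:
  "i \<in> ix X \<Longrightarrow> (j, a) \<in> \<alpha> i \<Longrightarrow> (j', a') \<in> \<alpha> i \<Longrightarrow> ev_eq X (UNIV \<times> carrier (sp X i)) j a j' a'"
  by (rule X.colim_set_ev[OF families_subset act_colim])

lemma act_mem:
  "i \<in> ix X \<Longrightarrow> (j, a) \<in> \<alpha> i \<Longrightarrow> j' \<in> ix X \<Longrightarrow> a' \<in> families (sp X i) (sp X j') \<Longrightarrow>
    ev_eq X (UNIV \<times> carrier (sp X i)) j a j' a' \<Longrightarrow> (j', a') \<in> \<alpha> i"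
  by (rule X.colim_set_mem[OF families_subset act_colim])

text \<open>Orbit maps are left uniformly continuous only after passing to an index at which the
  multiplication law holds.\<close>

lemma coaction_rep:
  assumes i: "i \<in> ix X"
  obtains j r where "(j, r) \<in> coaction X \<alpha> i"
proof -
  obtain j a where ja: "(j, a) \<in> \<alpha> i" and iso_a: "isometric_family (sp X i) (sp X j) a"
    and cont_a: "strongly_continuous_family (sp X i) (sp X j) a"
    by (rule act_isometric[OF i])
  note jd = conjunct1[OF actD[OF i ja]] conjunct2[OF actD[OF i ja]]
  \<comment> \<open>The values of \<open>a\<close> are acted on by a representative of its own,
    starting at j. Its isometry is what makes the later estimate uniform over the group.\<close>
  obtain l b where lb: "(l, b) \<in> \<alpha> j" and iso_b: "isometric_family (sp X j) (sp X l) b"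
    by (rule act_isometric[OF jd(1)])
  note ld = conjunct1[OF actD[OF jd(1) lb]] conjunct2[OF actD[OF jd(1) lb]]
  \<comment> \<open>At m the multiplication law for \<open>b\<close> after \<open>a\<close> becomes
    an equality. The orbit maps are formed there, from \<open>a\<close> pushed along
    \<open>q\<close>.\<close>
  obtain m p q where m: "m \<in> ix X" and p: "p \<in> homs (idx X) l m" and q: "q \<in> homs (idx X) j m"
    and pq: "\<And>y. y \<in> UNIV \<times> UNIV \<times> carrier (sp X i) \<Longrightarrow>
      X.tr l m p ((\<lambda>(g, h, x). b (g, a (h, x))) y) = X.tr j m q ((\<lambda>(g, h, x). a (g + h, x)) y)"
    by (rule X.ev_eqE[OF act_mult[OF i ja lb]]) blast
  have pq: "X.tr j m q (a (g + h, x)) = X.tr l m p (b (g, a (h, x)))" if "x \<in> carrier (sp X i)" for g h x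
    using pq[of "(g, h, x)"] that by simp
  interpret Vi: banach_module v s "sp X i" by (rule X.sp_banach[OF i])
  interpret Vj: banach_module v s "sp X j" by (rule X.sp_banach[OF jd(1)])
  interpret Vl: banach_module v s "sp X l" by (rule X.sp_banach[OF ld(1)])
  interpret Vm: banach_module v s "sp X m" by (rule X.sp_banach[OF m])
  have ab: "(\<lambda>x. a (g, x)) \<in> bhom (sp X i) (sp X j)" for g using jd(2) by (simp add: families_def)
  have bb: "(\<lambda>x. b (g, x)) \<in> bhom (sp X j) (sp X l)" for g using ld(2) by (simp add: families_def)
  note ac = bhom_closed[OF ab] and bc = bhom_closed[OF bb]
  note pb = X.tr_bhom[OF ld(1) m p] and qb = X.tr_bhom[OF jd(1) m q]
  obtain P where P: "P \<ge> 0" "\<And>x. x \<in> carrier (sp X l) \<Longrightarrow> nrm (sp X m) (X.tr l m p x) \<le> P * nrm (sp X l) x"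
    using bhom_bound[OF Vl.banach_module_axioms pb] by blast
  obtain Q where Q: "Q \<ge> 0" "\<And>x. x \<in> carrier (sp X j) \<Longrightarrow> nrm (sp X m) (X.tr j m q x) \<le> Q * nrm (sp X j) x"
    using bhom_bound[OF Vj.banach_module_axioms qb] by blast
  have bound: "nrm (sp X m) (X.tr j m q (a (- g, x))) \<le> Q * nrm (sp X i) x" if x: "x \<in> carrier (sp X i)" for g x
    using Q(2)[OF ac[OF x], of "- g"] iso_a x by (simp add: isometric_family_def)
  have mem: "(\<lambda>g. X.tr j m q (a (- g, x))) \<in> cblu_funs (sp X m)" if x: "x \<in> carrier (sp X i)" for x
  proof (rule Vm.cblu_funsI[where M = "Q * nrm (sp X i) x"])
    fix e :: real assume "e > 0"
    then have e: "e / (P + 1) > 0" using P(1) by simp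
    have "((\<lambda>h. nrm (sp X j) (a (h, x) \<ominus>\<^bsub>sp X j\<^esub> a (0, x))) \<longlongrightarrow> 0) (nhds 0)"
      using cont_a x by (simp add: strongly_continuous_family_def)
    from order_tendstoD(2)[OF this e]
    have "\<forall>\<^sub>F h in nhds 0. nrm (sp X j) (a (h, x) \<ominus>\<^bsub>sp X j\<^esub> a (0, x)) < e / (P + 1)" .
    moreover have "((\<lambda>h. - h) \<longlongrightarrow> - 0) (nhds (0::'g))"
      by (intro tendsto_minus filterlim_ident)
    then have "filterlim (\<lambda>h. - h) (nhds 0) (nhds (0::'g))" by simp
    ultimately have "\<forall>\<^sub>F h in nhds (0::'g). nrm (sp X j) (a (- h, x) \<ominus>\<^bsub>sp X j\<^esub> a (0, x)) < e / (P + 1)"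
      by (rule eventually_compose_filterlim)
    then show "\<forall>\<^sub>F h in nhds 0. \<forall>y. nrm (sp X m)
        (X.tr j m q (a (- (h + y), x)) \<ominus>\<^bsub>sp X m\<^esub> X.tr j m q (a (- y, x))) \<le> e"
    proof (eventually_elim, intro allI)
      fix h y :: 'g assume h: "nrm (sp X j) (a (- h, x) \<ominus>\<^bsub>sp X j\<^esub> a (0, x)) < e / (P + 1)"
      let ?d = "a (- h, x) \<ominus>\<^bsub>sp X j\<^esub> a (0, x)"
      have d: "?d \<in> carrier (sp X j)" by (intro Vj.minus_closed ac x)
      \<comment> \<open>Since - (h + y) = - y + - h, the variable y moves into the isometry b (- y,
        _) and drops out of the estimate.\<close>
      have 1: "X.tr j m q (a (- (h + y), x)) = X.tr l m p (b (- y, a (- h, x)))"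
        using pq[OF x, of "- y" "- h"] by (simp add: minus_add)
      \<comment> \<open>The base point is treated by the same law at h = 0. It involves a (0, x) and
        not x, since the two are identified only at an index which the unit law provides.\<close>
      have 2: "X.tr j m q (a (- y, x)) = X.tr l m p (b (- y, a (0, x)))"
        using pq[OF x, of "- y" 0] by simp
      have "X.tr j m q (a (- (h + y), x)) \<ominus>\<^bsub>sp X m\<^esub> X.tr j m q (a (- y, x)) = X.tr l m p (b (- y, ?d))"
        unfolding 1 2
        by (simp add: bhom_diff[OF Vj.banach_module_axioms Vl.banach_module_axioms bb ac[OF x] ac[OF x]]
            bhom_diff[OF Vl.banach_module_axioms Vm.banach_module_axioms pb bc[OF ac[OF x]] bc[OF ac[OF x]]])
      then have "nrm (sp X m) (X.tr j m q (a (- (h + y), x)) \<ominus>\<^bsub>sp X m\<^esub> X.tr j m q (a (- y, x)))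
          \<le> P * nrm (sp X j) ?d"
        using P(2)[OF bc[OF d], of "- y"] iso_b d by (simp add: isometric_family_def)
      also have "\<dots> \<le> P * (e / (P + 1))"
        by (rule mult_left_mono) (use h P(1) in auto)
      also have "\<dots> \<le> e" using P(1) \<open>e > 0\<close> by (simp add: field_simps)
      finally show "nrm (sp X m) (X.tr j m q (a (- (h + y), x)) \<ominus>\<^bsub>sp X m\<^esub> X.tr j m q (a (- y, x))) \<le> e" .
    qed
  qed (use bound x in \<open>simp_all add: X.tr_closed[OF jd(1) m q] ac\<close>)
  define r where "r = (\<lambda>x\<in>carrier (sp X i). fenc U (\<lambda>g. X.tr j m q (a (- g, x))))"
  have r: "r \<in> bhom (sp X i) (CS (sp X m))"
  proof (rule bhomI[where M = Q])
    show "nrm (CS (sp X m)) (r x) \<le> Q * nrm (sp X i) x" if x: "x \<in> carrier (sp X i)" for x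
      unfolding r_def restrict_apply'[OF x] by (rule cblu_nrm_le) (rule bound[OF x])
  qed (auto simp: r_def mem bhom_add[OF ab] bhom_add[OF qb] bhom_smult[OF ab] bhom_smult[OF qb] ac)
  have fam: "family_of (sp X i) r (g, x) = X.tr j m q (a (g, x))" if "x \<in> carrier (sp X i)" for g x
    using that by (simp add: family_of_def r_def)
  \<comment> \<open>The two inversions cancel: this family is \<open>a\<close> pushed along
    \<open>q\<close>, hence in the same class.\<close>
  have "(m, family_of (sp X i) r) \<in> \<alpha> i"
  proof (rule act_mem[OF i ja m family_of_families[OF Vi.banach_module_axioms Vm.banach_module_axioms r]])
    show "ev_eq X (UNIV \<times> carrier (sp X i)) j a m (family_of (sp X i) r)"
      using families_subset jd(2) by (intro X.ev_eq_push[OF jd(1) m q]) (auto simp: fam)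
  qed
  then have "(m, r) \<in> coaction X \<alpha> i"
    using i m r by (simp add: coaction_def)
  then show thesis by (rule that)
qed

lemma coactionD:
  "i \<in> ix X \<Longrightarrow> (j, r) \<in> coaction X \<alpha> i \<Longrightarrow>
    j \<in> ix X \<and> r \<in> bhom (sp X i) (CS (sp X j)) \<and> (j, family_of (sp X i) r) \<in> \<alpha> i"
  by (simp add: coaction_def)

text \<open>Membership in \<open>coaction X \<alpha> i\<close> and in the class of one
  representative both mean eventual equality with it, in terms of families or of maps into
  functions; \<open>ev_eq_family_of\<close> matches the two. Naturality of \<alpha> is transferred
  by the same dictionary.\<close>

lemma coaction_hom: "coaction X \<alpha> \<in> ind_hom X (cblu_obj U X)"
proof -
  have "\<exists>j r. (j, r) \<in> coaction X \<alpha> i" if "i \<in> ix X" for i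
    using coaction_rep[OF that] by blast
  then obtain J R where r: "\<And>i. i \<in> ix X \<Longrightarrow> (J i, R i) \<in> coaction X \<alpha> i"
    by metis
  note J = conjunct1[OF coactionD[OF _ r]]
    and R = conjunct1[OF conjunct2[OF coactionD[OF _ r]]]
    and A = conjunct2[OF conjunct2[OF coactionD[OF _ r]]]
  note fam = family_of_families[OF X.sp_banach X.sp_banach]
  show ?thesis
  proof (rule CX.ind_homI[OF X.ind_banach_axioms, where J = J and F = R])
    show "coaction X \<alpha> \<in> extensional (ix X)" by (simp add: coaction_def)
    show "J i \<in> ix (cblu_obj U X) \<and> R i \<in> bhom (sp X i) (sp (cblu_obj U X) (J i)) \<and>
        coaction X \<alpha> i = ind_cls X (cblu_obj U X) i (J i) (R i)" if i: "i \<in> ix X" for i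
    proof -
      have "(j, t) \<in> coaction X \<alpha> i \<longleftrightarrow> (j, t) \<in> ind_cls X (cblu_obj U X) i (J i) (R i)" for j t
      proof (cases "j \<in> ix X \<and> t \<in> bhom (sp X i) (CS (sp X j))")
        case True
        then have "(j, family_of (sp X i) t) \<in> \<alpha> i \<longleftrightarrow>
            ev_eq X (UNIV \<times> carrier (sp X i)) (J i) (family_of (sp X i) (R i)) j (family_of (sp X i) t)"
          using act_ev[OF i A[OF i i]] act_mem[OF i A[OF i i] _ fam[OF i]] by blast
        with True ev_eq_family_of[OF X.ind_banach_axioms J[OF i i] _ R[OF i i]] show ?thesis
          using i J[OF i i] R[OF i i] by (simp add: coaction_def ind_cls_def colim_rel_def)
      qed (auto simp: coaction_def ind_cls_def colim_rel_def i)
      then show ?thesis using J[OF i i] R[OF i i] by auto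
    qed
    fix i i' u assume i: "i \<in> ix X" and i': "i' \<in> ix X" and u: "u \<in> homs (idx X) i i'"
    let ?R = "compose (carrier (sp X i)) (R i') (X.tr i i' u)"
    have Rb: "?R \<in> bhom (sp X i) (CS (sp X (J i')))"
      by (rule bhom_compose[OF X.tr_bhom[OF i i' u] R[OF i' i'] X.sp_banach[OF i'] X.sp_banach[OF i]])
    have "family_of (sp X i) ?R =
        (\<lambda>(g, x). compose (carrier (sp X i)) (\<lambda>y. family_of (sp X i') (R i') (g, y)) (X.tr i i' u) x)"
      by (auto simp: fun_eq_iff family_of_def compose_def X.tr_closed[OF i i' u])
    then have "(J i', family_of (sp X i) ?R) \<in> \<alpha> i"
      using act_nat[OF i i' u A[OF i' i']] by simp
    from act_ev[OF i A[OF i i] this]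
    have "ev_eq (cblu_obj U X) (carrier (sp X i)) (J i) (R i) (J i') ?R"
      by (simp only: ev_eq_family_of[OF X.ind_banach_axioms J[OF i i] J[OF i' i'] R[OF i i] Rb])
    then show "ev_eq (cblu_obj U X) (carrier (sp X i)) (J i) (R i) (J i') (\<lambda>x. R i' (X.tr i i' u x))"
      by (rule CX.ev_eq_cong) (simp_all add: compose_eq)
  qed
qed

text \<open>Under the dictionary the counit law is the unit law of the action, and coassociativity
  is its multiplication law.\<close>

lemma coalgebra_coaction: "coalgebra (IndBan v s) (Cblu v s U) X (coaction X \<alpha>)"
proof -
  let ?C = "cblu_obj U X" and ?CC = "cblu_obj U (cblu_obj U X)" and ?\<rho> = "coaction X \<alpha>"
  note cou = counit_Cblu[OF X.ind_banach_axioms] and com = comult_Cblu[OF X.ind_banach_axioms]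
    and idt = idt_IndBan[OF X.ind_banach_axioms]
    and C\<rho> = CM_hom[OF X.ind_banach_axioms CX.ind_banach_axioms coaction_hom]
    and Cmem = CM_mem[OF X.ind_banach_axioms CX.ind_banach_axioms coaction_hom]
  interpret CCX: ind_banach v s ?CC
    by (rule ind_banach_cblu_obj[OF CX.ind_banach_axioms])
  interpret A: ind_triple v s X ?C X ?\<rho> "counit (Cblu v s U) X"
    by unfold_locales (rule coaction_hom cou)+
  interpret B: ind_triple v s X ?C ?CC ?\<rho> "comult (Cblu v s U) X"
    by unfold_locales (rule coaction_hom com)+
  interpret D: ind_triple v s X ?C ?CC ?\<rho> "CM X ?C ?\<rho>"
    by unfold_locales (rule coaction_hom C\<rho>)+
  have 1: "ind_comp X ?C X (counit (Cblu v s U) X) ?\<rho> = idt (IndBan v s) X"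
  proof (rule X.ind_hom_eq_evI[OF A.ind_comp_hom idt(1)])
    fix i assume i: "i \<in> ix X"
    obtain j r where r: "(j, r) \<in> ?\<rho> i" by (rule coaction_rep[OF i])
    note d = coactionD[OF i r]
    let ?e = "\<lambda>a\<in>carrier (CS (sp X j)). fdec U a 0"
    have "ev_eq X (carrier (sp X i)) j (\<lambda>x. family_of (sp X i) r (0, x)) i (\<lambda>x. x)"
      using act_unit[OF i] d by blast
    then have "ev_eq X (carrier (sp X i)) j (compose (carrier (sp X i)) ?e r) i (\<lambda>x\<in>carrier (sp X i). x)"
      by (rule X.ev_eq_cong) (use d in \<open>auto simp: compose_eq family_of_def bhom_closed\<close>)
    moreover have "(j, compose (carrier (sp X i)) ?e r) \<in> ind_comp X ?C X (counit (Cblu v s U) X) ?\<rho> i"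
      using A.ind_comp_mem[OF i r cou(2)] d by simp
    ultimately show "\<exists>j f l h. (j, f) \<in> ind_comp X ?C X (counit (Cblu v s U) X) ?\<rho> i \<and>
        (l, h) \<in> idt (IndBan v s) X i \<and> ev_eq X (carrier (sp X i)) j f l h"
      using idt(2)[OF i] by blast
  qed
  have 2: "ind_comp X ?C ?CC (comult (Cblu v s U) X) ?\<rho> = ind_comp X ?C ?CC (CM X ?C ?\<rho>) ?\<rho>"
  proof (rule CCX.ind_hom_eq_evI[OF B.ind_comp_hom D.ind_comp_hom])
    fix i assume i: "i \<in> ix X"
    obtain j r where r: "(j, r) \<in> ?\<rho> i" by (rule coaction_rep[OF i])
    have j: "j \<in> ix X" and rb: "r \<in> bhom (sp X i) (CS (sp X j))" and ra: "(j, family_of (sp X i) r) \<in> \<alpha> i"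
      using coactionD[OF i r] by auto
    obtain l t where t: "(l, t) \<in> ?\<rho> j" by (rule coaction_rep[OF j])
    have l: "l \<in> ix X" and tb: "t \<in> bhom (sp X j) (CS (sp X l))" and ta: "(l, family_of (sp X j) t) \<in> \<alpha> j"
      using coactionD[OF j t] by auto
    \<comment> \<open>Both group variables are inverted: acting by - g and then by - h is acting by
      - (g + h), which corresponds to the value of the orbit map at g + h.\<close>
    have "ev_eq X (UNIV \<times> UNIV \<times> carrier (sp X i)) j (\<lambda>(h, g, x). fdec U (r x) (g + h))
        l (\<lambda>(h, g, x). fdec U (t (fdec U (r x) g)) h)"
      by (rule X.ev_eq_comp[OF X.ev_eq_sym[OF act_mult[OF i ra ta]], where k = "\<lambda>(h, g, x). (- h, - g, x)"])
        (auto simp: family_of_def minus_add fdec_closed[OF bhom_closed[OF rb]])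
    then have "ev_eq ?CC (carrier (sp X i)) j (compose (carrier (sp X i)) (translates (sp X j)) r)
        l (compose (carrier (sp X i)) (cblu_map U (sp X j) t) r)"
      by (simp only: ev_eq_coassoc[OF X.ind_banach_axioms X.sp_banach[OF i] j l rb tb])
    with B.ind_comp_mem[OF i r com(2)[OF j]] D.ind_comp_mem[OF i r Cmem[OF j t]]
    show "\<exists>j f l h. (j, f) \<in> ind_comp X ?C ?CC (comult (Cblu v s U) X) ?\<rho> i \<and>
        (l, h) \<in> ind_comp X ?C ?CC (CM X ?C ?\<rho>) ?\<rho> i \<and> ev_eq ?CC (carrier (sp X i)) j f l h"
      by blast
  qed
  show ?thesis
    unfolding coalgebra_def Let_def endo_Cblu IndBan_simps
    by (intro conjI X.ind_banach_axioms coaction_hom 1 2)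
qed

end

text \<open>Both composites send elements of \<open>sp X i\<close> to functions on the group.
  Uncurried and with g replaced by - g, their values become the two sides of the equivariance
  condition.\<close>

lemma equivariant_iff_coalgebra_hom:
  assumes "isometric_action v s U X \<alpha>" and "isometric_action v s U Y \<beta>" and \<phi>: "\<phi> \<in> ind_hom X Y"
  shows "equivariant X \<alpha> Y \<beta> \<phi> \<longleftrightarrow>
    ind_comp X Y (cblu_obj U Y) (cblu_universe.coaction U Y \<beta>) \<phi> =
    ind_comp X (cblu_obj U X) (cblu_obj U Y) (amap (endo (Cblu v s U)) X Y \<phi>)
      (cblu_universe.coaction U X \<alpha>)"
proof -
  interpret X: isometric_action v s U X \<alpha> by fact
  interpret Y: isometric_action v s U Y \<beta> by fact
  let ?\<rho> = "X.coaction X \<alpha>" and ?\<sigma> = "X.coaction Y \<beta>"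
  note Xb = X.X.ind_banach_axioms and Yb = Y.X.ind_banach_axioms
  note C\<phi> = X.CM_hom[OF Xb Yb \<phi>] and Cmem = X.CM_mem[OF Xb Yb \<phi>]
  interpret A: ind_triple v s X Y "cblu_obj U Y" \<phi> ?\<sigma>
    by unfold_locales (rule \<phi> Y.coaction_hom)+
  interpret B: ind_triple v s X "cblu_obj U X" "cblu_obj U Y" ?\<rho> "X.CM X Y \<phi>"
    by unfold_locales (rule X.coaction_hom C\<phi>)+
  have rep: "ev_eq (cblu_obj U Y) (carrier (sp X i))
      n (compose (carrier (sp X i)) t h) l (compose (carrier (sp X i)) (cblu_map U (sp X j) f) r) \<longleftrightarrow>
    ev_eq Y (UNIV \<times> carrier (sp X i)) l (\<lambda>(g, x). f (X.family_of (sp X i) r (g, x)))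
      n (\<lambda>(g, x). X.family_of (sp Y m) t (g, h x))"
    if i: "i \<in> ix X" and r: "(j, r) \<in> ?\<rho> i" and f: "(l, f) \<in> \<phi> j" and h: "(m, h) \<in> \<phi> i" and t: "(n, t) \<in> ?\<sigma> m"
    for i j r l f m h n t
  proof -
    have j: "j \<in> ix X" and rb: "r \<in> bhom (sp X i) (X.CS (sp X j))"
      using X.coactionD[OF i r] by auto
    have l: "l \<in> ix Y" and fb: "f \<in> bhom (sp X j) (sp Y l)"
      using Y.X.ind_homD[OF \<phi> j f] by auto
    have m: "m \<in> ix Y" and hb: "h \<in> bhom (sp X i) (sp Y m)"
      using Y.X.ind_homD[OF \<phi> i h] by auto
    have n: "n \<in> ix Y" and tb: "t \<in> bhom (sp Y m) (X.CS (sp Y n))"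
      using Y.coactionD[OF m t] by auto
    note th = bhom_compose[OF hb tb Y.X.sp_banach[OF m] X.X.sp_banach[OF i]]
    note fr = bhom_compose[OF rb X.cblu_map_bhom[OF X.X.sp_banach[OF j] Y.X.sp_banach[OF l] fb]
        X.banach_cblu_space[OF X.X.sp_banach[OF j]] X.X.sp_banach[OF i]]
    show ?thesis
      unfolding X.ev_eq_family_of[OF Yb n l th fr]
      by (rule iffI; drule Y.X.ev_eq_sym; erule Y.X.ev_eq_cong)
        (auto simp: X.family_of_def compose_eq bhom_closed[OF hb] X.cblu_map_apply bhom_closed[OF rb])
  qed
  show ?thesis
  proof
    assume eq: "equivariant X \<alpha> Y \<beta> \<phi>"
    show "ind_comp X Y (cblu_obj U Y) ?\<sigma> \<phi> =
        ind_comp X (cblu_obj U X) (cblu_obj U Y) (X.CM X Y \<phi>) ?\<rho>"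
    proof (rule Y.CX.ind_hom_eq_evI[OF A.ind_comp_hom B.ind_comp_hom])
      fix i assume i: "i \<in> ix X"
      obtain j r where r: "(j, r) \<in> ?\<rho> i" by (rule X.coaction_rep[OF i])
      have j: "j \<in> ix X" and ra: "(j, X.family_of (sp X i) r) \<in> \<alpha> i" using X.coactionD[OF i r] by auto
      obtain l f where f: "(l, f) \<in> \<phi> j" by (rule Y.X.ind_hom_rep[OF \<phi> j])
      obtain m h where h: "(m, h) \<in> \<phi> i" by (rule Y.X.ind_hom_rep[OF \<phi> i])
      have m: "m \<in> ix Y" using Y.X.ind_homD[OF \<phi> i h] by blast
      obtain n t where t: "(n, t) \<in> ?\<sigma> m" by (rule Y.coaction_rep[OF m])
      have ta: "(n, X.family_of (sp Y m) t) \<in> \<beta> m" using Y.coactionD[OF m t] by blast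
      have "ev_eq Y (UNIV \<times> carrier (sp X i)) l (\<lambda>(g, x). f (X.family_of (sp X i) r (g, x)))
          n (\<lambda>(g, x). X.family_of (sp Y m) t (g, h x))"
        using eq i ra f h ta unfolding equivariant_def by blast
      then have "ev_eq (cblu_obj U Y) (carrier (sp X i))
          n (compose (carrier (sp X i)) t h) l (compose (carrier (sp X i)) (cblu_map U (sp X j) f) r)"
        by (simp only: rep[OF i r f h t])
      with A.ind_comp_mem[OF i h t] B.ind_comp_mem[OF i r Cmem[OF j f]]
      show "\<exists>j f l h. (j, f) \<in> ind_comp X Y (cblu_obj U Y) ?\<sigma> \<phi> i \<and>
          (l, h) \<in> ind_comp X (cblu_obj U X) (cblu_obj U Y) (X.CM X Y \<phi>) ?\<rho> i \<and>
          ev_eq (cblu_obj U Y) (carrier (sp X i)) j f l h"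
        by blast
    qed
  next
    assume eq: "ind_comp X Y (cblu_obj U Y) ?\<sigma> \<phi> =
        ind_comp X (cblu_obj U X) (cblu_obj U Y) (X.CM X Y \<phi>) ?\<rho>"
    \<comment> \<open>Equivariance ranges over all representatives of both actions, including those
      that come from no coaction. Fact 1 trades \<open>a\<close> for the family of a coaction, fact
      2 is the coalgebra condition, and fact 3 trades the family on the other side for
      \<open>b\<close>.\<close>
    have "ev_eq Y (UNIV \<times> carrier (sp X i)) l (\<lambda>(g, x). f (a (g, x))) n (\<lambda>(g, x). b (g, h x))"
      if i: "i \<in> ix X" and a: "(j, a) \<in> \<alpha> i" and f: "(l, f) \<in> \<phi> j" and h: "(m, h) \<in> \<phi> i" and b: "(n, b) \<in> \<beta> m"
      for i j a l f m h n b
    proof -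
      obtain j' r where r: "(j', r) \<in> ?\<rho> i" by (rule X.coaction_rep[OF i])
      have j': "j' \<in> ix X" and ra: "(j', X.family_of (sp X i) r) \<in> \<alpha> i" using X.coactionD[OF i r] by auto
      obtain l' f' where f': "(l', f') \<in> \<phi> j'" by (rule Y.X.ind_hom_rep[OF \<phi> j'])
      have m: "m \<in> ix Y" and hb: "h \<in> bhom (sp X i) (sp Y m)" using Y.X.ind_homD[OF \<phi> i h] by auto
      obtain n' t where t: "(n', t) \<in> ?\<sigma> m" by (rule Y.coaction_rep[OF m])
      have ta: "(n', X.family_of (sp Y m) t) \<in> \<beta> m" using Y.coactionD[OF m t] by blast
      have j: "j \<in> ix X" and af: "a \<in> UNIV \<times> carrier (sp X i) \<rightarrow> carrier (sp X j)"
        using X.actD[OF i a] families_subset by auto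
      have rf: "X.family_of (sp X i) r \<in> UNIV \<times> carrier (sp X i) \<rightarrow> carrier (sp X j')"
        using X.actD[OF i ra] families_subset by blast
      have n: "n \<in> ix Y" and bf: "b \<in> UNIV \<times> carrier (sp Y m) \<rightarrow> carrier (sp Y n)"
        using Y.actD[OF m b] families_subset by auto
      have n': "n' \<in> ix Y" and tf: "X.family_of (sp Y m) t \<in> UNIV \<times> carrier (sp Y m) \<rightarrow> carrier (sp Y n')"
        using Y.actD[OF m ta] families_subset by auto
      have l: "l \<in> ix Y" and fb: "f \<in> bhom (sp X j) (sp Y l)" using Y.X.ind_homD[OF \<phi> j f] by auto
      have l': "l' \<in> ix Y" and fb': "f' \<in> bhom (sp X j') (sp Y l')" using Y.X.ind_homD[OF \<phi> j' f'] by auto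
      have 1: "ev_eq Y (UNIV \<times> carrier (sp X i)) l (\<lambda>y. f (a y)) l' (\<lambda>y. f' (X.family_of (sp X i) r y))"
        by (rule X.X.ind_hom_subst[OF Yb \<phi> j j' af rf X.act_ev[OF i a ra] f f'])
      have "ev_eq (cblu_obj U Y) (carrier (sp X i)) n' (compose (carrier (sp X i)) t h)
          l' (compose (carrier (sp X i)) (cblu_map U (sp X j') f') r)"
        by (rule Y.CX.ind_hom_ev[OF A.ind_comp_hom i A.ind_comp_mem[OF i h t]])
          (simp only: eq B.ind_comp_mem[OF i r Cmem[OF j' f']])
      then have 2: "ev_eq Y (UNIV \<times> carrier (sp X i)) l' (\<lambda>y. f' (X.family_of (sp X i) r y))
          n' (\<lambda>(g, x). X.family_of (sp Y m) t (g, h x))"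
        unfolding rep[OF i r f' h t] by (simp add: case_prod_beta')
      have k: "(\<lambda>(g, x). (g, h x)) \<in> UNIV \<times> carrier (sp X i) \<rightarrow> UNIV \<times> carrier (sp Y m)"
        using bhom_closed[OF hb] by auto
      have 3: "ev_eq Y (UNIV \<times> carrier (sp X i)) n' (\<lambda>(g, x). X.family_of (sp Y m) t (g, h x))
          n (\<lambda>(g, x). b (g, h x))"
        by (rule Y.X.ev_eq_comp[OF Y.act_ev[OF m ta b] k]) auto
      have c1: "(\<lambda>y. f (a y)) \<in> UNIV \<times> carrier (sp X i) \<rightarrow> carrier (sp Y l)"
        using af bhom_closed[OF fb] by (fastforce simp: Pi_iff)
      have c2: "(\<lambda>y. f' (X.family_of (sp X i) r y)) \<in> UNIV \<times> carrier (sp X i) \<rightarrow> carrier (sp Y l')"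
        using rf bhom_closed[OF fb'] by (fastforce simp: Pi_iff)
      have c3: "(\<lambda>(g, x). X.family_of (sp Y m) t (g, h x)) \<in> UNIV \<times> carrier (sp X i) \<rightarrow> carrier (sp Y n')"
        using tf bhom_closed[OF hb] by (fastforce simp: Pi_iff)
      have c4: "(\<lambda>(g, x). b (g, h x)) \<in> UNIV \<times> carrier (sp X i) \<rightarrow> carrier (sp Y n)"
        using bf bhom_closed[OF hb] by (fastforce simp: Pi_iff)
      have "ev_eq Y (UNIV \<times> carrier (sp X i)) l (\<lambda>y. f (a y)) n (\<lambda>(g, x). b (g, h x))"
        by (rule Y.X.ev_eq_trans[OF l l' n c1 c2 c4 1 Y.X.ev_eq_trans[OF l' n' n c2 c3 c4 2 3]])
      then show ?thesis by (simp add: case_prod_beta')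
    qed
    then show "equivariant X \<alpha> Y \<beta> \<phi>"
      unfolding equivariant_def by (intro ballI, clarify, blast)
  qed
qed

section \<open>Coalgebras come from isometric modules\<close>

text \<open>Any number of equations between bounded maps cuts out a closed subspace. The parameter t
  will be a pair of group elements.\<close>

lemma (in banach_module) banach_equalizer:
  assumes W: "banach_module v s W"
    and A: "\<And>t. A t \<in> bhom V W" and B: "\<And>t. B t \<in> bhom V W"
  shows "banach v s (V\<lparr>carrier := {x \<in> carrier V. \<forall>t. A t x = B t x}\<rparr>)"
proof (rule banach_closed_subspace)
  show "l \<in> {x \<in> carrier V. \<forall>t. A t x = B t x}"
    if X: "\<And>n::nat. X n \<in> {x \<in> carrier V. \<forall>t. A t x = B t x}" and l: "l \<in> carrier V"
      and lim: "(\<lambda>n. nrm V (X n \<ominus> l)) \<longlonglongrightarrow> 0" for X l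
  proof -
    have "A t l = B t l" for t
      by (rule bhom_eq_locus_closed[OF banach_module_axioms W A B _ l lim]) (use X in auto)
    with l show ?thesis by simp
  qed
qed (auto simp: bhom_add[OF A] bhom_add[OF B] bhom_smult[OF A] bhom_smult[OF B]
    bhom_zero[OF banach_module_axioms W A] bhom_zero[OF banach_module_axioms W B])

lemma bhom_corestrict:
  "T \<in> bhom V W \<Longrightarrow> (\<And>x. x \<in> carrier V \<Longrightarrow> T x \<in> S) \<Longrightarrow> T \<in> bhom V (W\<lparr>carrier := S\<rparr>)"
  by (auto simp: bhom_def PiE_iff)

text \<open>The assumption that the subspace is Banach is used for its closure under the operations,
  so that additivity and homogeneity restrict.\<close>

lemma bhom_restrict:
  assumes V: "banach_module v s (V\<lparr>carrier := S\<rparr>)" and S: "S \<subseteq> carrier V" and T: "T \<in> bhom V W"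
  shows "restrict T S \<in> bhom (V\<lparr>carrier := S\<rparr>) W"
proof -
  interpret banach_module v s "V\<lparr>carrier := S\<rparr>" by (rule V)
  obtain M where M: "\<And>x. x \<in> carrier V \<Longrightarrow> nrm W (T x) \<le> M * nrm V x"
    using T unfolding bhom_def by blast
  have c: "x \<in> carrier V" if "x \<in> S" for x using that S by auto
  show ?thesis
    using a_closed smult_closed
    by (intro bhomI[where M = M]) (auto simp: c M bhom_closed[OF T] bhom_add[OF T] bhom_smult[OF T])
qed

context cblu_universe
begin

section \<open>The translation action on function spaces\<close>

definition translate :: "'g \<Rightarrow> 'u \<Rightarrow> 'u" where
  "translate g a = fenc U (\<lambda>x. fdec U a (- g + x))"

lemma translate_mem:
  "banach_module v s V \<Longrightarrow> a \<in> carrier (CS V) \<Longrightarrow> translate g a \<in> carrier (CS V)"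
  by (simp add: translate_def banach_module.cblu_funs_translate fdec_mem)

lemma fdec_translate [simp]: "fdec U (translate g a) x = fdec U a (- g + x)"
  by (simp add: translate_def)

lemma translate_zero: "a \<in> carrier (CS V) \<Longrightarrow> translate 0 a = a"
  by (simp add: translate_def fenc_fdec)

lemma translate_translate: "translate g (translate h a) = translate (g + h) a"
proof -
  have "- h + (- g + x) = - (g + h) + x" for x by (simp only: minus_add add.assoc)
  then show ?thesis by (simp add: translate_def del: minus_add_distrib)
qed

lemma translate_add:
  "a \<in> carrier (CS V) \<Longrightarrow> b \<in> carrier (CS V) \<Longrightarrow>
    translate g (a \<oplus>\<^bsub>CS V\<^esub> b) = translate g a \<oplus>\<^bsub>CS V\<^esub> translate g b"
  by (auto elim!: cblu_spaceE simp: translate_def)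

lemma translate_smult:
  "a \<in> carrier (CS V) \<Longrightarrow> translate g (c \<odot>\<^bsub>CS V\<^esub> a) = c \<odot>\<^bsub>CS V\<^esub> translate g a"
  by (auto elim!: cblu_spaceE simp: translate_def)

lemma translate_cblu_map:
  "banach_module v s V \<Longrightarrow> a \<in> carrier (CS V) \<Longrightarrow>
    cblu_map U V T (translate g a) = translate g (cblu_map U V T a)"
  by (simp add: cblu_map_apply translate_mem) (simp add: translate_def)

text \<open>Translation does not increase the norm, and the same bound for - g gives the reverse
  inequality.\<close>

lemma translate_nrm:
  assumes V: "banach_module v s V" and a: "a \<in> carrier (CS V)"
  shows "nrm (CS V) (translate g a) = nrm (CS V) a"
proof -
  have le: "nrm (CS V) (translate g a) \<le> nrm (CS V) a" if a: "a \<in> carrier (CS V)" for g a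
    unfolding translate_def
    by (rule cblu_nrm_le)
      (rule order_trans[OF nrm_le_cblu_nrm[OF fdec_mem[OF a]]], simp only: fenc_fdec[OF a] order_refl)
  show ?thesis
    using le[OF a, of g] le[OF translate_mem[OF V a, of g], of "- g"]
    by (simp add: translate_translate translate_zero[OF a])
qed

text \<open>Writing - h + x = (- h + g) + (- g + x) reduces continuity at g to the left uniform
  estimate of f at - h + g, which tends to 0 as h tends to g.\<close>

lemma translate_continuous:
  assumes V: "banach_module v s V" and a: "a \<in> carrier (CS V)"
  shows "((\<lambda>h. nrm (CS V) (translate h a \<ominus>\<^bsub>CS V\<^esub> translate g a)) \<longlongrightarrow> 0) (nhds g)"
proof (rule tendstoI)
  interpret V: banach_module v s V by (rule V)
  interpret C: banach_module v s "CS V" by (rule banach_cblu_space[OF V])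
  obtain f where f: "a = fenc U f" "f \<in> cblu_funs V" by (rule cblu_spaceE[OF a])
  fix e :: real assume "e > 0"
  then have "e / 2 > 0" by simp
  note u = V.cblu_funs_uniform[OF f(2) this]
  have "((\<lambda>h. - h + g) \<longlongrightarrow> - g + g) (nhds g)"
    by (intro tendsto_add tendsto_minus tendsto_const filterlim_ident)
  then have "filterlim (\<lambda>h. - h + g) (nhds 0) (nhds g)" by simp
  from eventually_compose_filterlim[OF u this]
  show "\<forall>\<^sub>F h in nhds g. dist (nrm (CS V) (translate h a \<ominus>\<^bsub>CS V\<^esub> translate g a)) 0 < e"
  proof eventually_elim
    case (elim h)
    have "nrm V (f (- h + x) \<ominus>\<^bsub>V\<^esub> f (- g + x)) \<le> e / 2" for x
      using spec[OF elim, of "- g + x"] by (simp add: add.assoc)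
    then have "nrm (CS V) (translate h a \<ominus>\<^bsub>CS V\<^esub> translate g a) \<le> e / 2"
      unfolding translate_def f(1) fdec_fenc
        cblu_diff[OF V V.cblu_funs_translate[OF f(2)] V.cblu_funs_translate[OF f(2)]]
      by (rule cblu_nrm_le)
    moreover have "0 \<le> nrm (CS V) (translate h a \<ominus>\<^bsub>CS V\<^esub> translate g a)"
      by (intro C.nrm_ge0 C.minus_closed translate_mem[OF V a])
    ultimately show ?case using \<open>e > 0\<close> by simp
  qed
qed

end

section \<open>A coalgebra in terms of representatives of its coaction\<close>

locale comonad_coalgebra = cblu_universe v s U + X: ind_banach v s X
  for v :: "'k::field \<Rightarrow> real" and s :: bool
    and U :: "('k, 'g::topological_group_add, 'u) univ" and X :: "('k, 'u) ind" +
  fixes \<rho> :: "'u indmap"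
  assumes coalgebra: "coalgebra (IndBan v s) (Cblu v s U) X \<rho>"
begin

sublocale CX: ind_banach v s "cblu_obj U X"
  by (rule ind_banach_cblu_obj[OF X.ind_banach_axioms])

sublocale CCX: ind_banach v s "cblu_obj U (cblu_obj U X)"
  by (rule ind_banach_cblu_obj[OF CX.ind_banach_axioms])

abbreviation ctr :: "'u \<Rightarrow> 'u \<Rightarrow> 'u \<Rightarrow> 'u \<Rightarrow> 'u" where
  "ctr i j u \<equiv> cblu_map U (sp X i) (X.tr i j u)"

lemma \<rho>_hom: "\<rho> \<in> ind_hom X (cblu_obj U X)"
  and \<rho>_counit: "ind_comp X (cblu_obj U X) X (counit (Cblu v s U) X) \<rho> = idt (IndBan v s) X"
  and \<rho>_comult: "ind_comp X (cblu_obj U X) (cblu_obj U (cblu_obj U X)) (comult (Cblu v s U) X) \<rho> =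
    ind_comp X (cblu_obj U X) (cblu_obj U (cblu_obj U X)) (CM X (cblu_obj U X) \<rho>) \<rho>"
  using coalgebra by (simp_all add: coalgebra_def Let_def)

text \<open>\<open>rr i\<close> is a fixed representative of \<rho> over i, with values in functions
  into X at the index \<open>jn i\<close>. For these representatives naturality and the coalgebra
  laws hold only eventually.\<close>

definition jn :: "'u \<Rightarrow> 'u" where "jn i = fst (SOME p. p \<in> \<rho> i)"
definition rr :: "'u \<Rightarrow> 'u \<Rightarrow> 'u" where "rr i = snd (SOME p. p \<in> \<rho> i)"

lemma rep: "i \<in> ix X \<Longrightarrow> (jn i, rr i) \<in> \<rho> i"
  unfolding jn_def rr_def prod.collapse using CX.ind_hom_rep[OF \<rho>_hom] someI_ex[of "\<lambda>p. p \<in> \<rho> i"] by blast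

lemma jn: "i \<in> ix X \<Longrightarrow> jn i \<in> ix X"
  and rr: "i \<in> ix X \<Longrightarrow> rr i \<in> bhom (sp X i) (CS (sp X (jn i)))"
  using CX.ind_homD[OF \<rho>_hom _ rep] by auto

lemma rr_closed: "i \<in> ix X \<Longrightarrow> x \<in> carrier (sp X i) \<Longrightarrow> rr i x \<in> carrier (CS (sp X (jn i)))"
  by (rule bhom_closed[OF rr])

lemma rr_fdec_closed: "i \<in> ix X \<Longrightarrow> x \<in> carrier (sp X i) \<Longrightarrow> fdec U (rr i x) g \<in> carrier (sp X (jn i))"
  by (rule fdec_closed[OF rr_closed])

lemma rr_nat:
  assumes "i \<in> ix X" "i' \<in> ix X" "u \<in> homs (idx X) i i'"
  shows "ev_eq (cblu_obj U X) (carrier (sp X i)) (jn i) (rr i) (jn i') (\<lambda>x. rr i' (X.tr i i' u x))"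
  by (rule CX.ev_eq_cong[OF CX.ind_hom_ev[OF \<rho>_hom assms(1) rep[OF assms(1)]
          ind_hom_nat[OF \<rho>_hom assms rep[OF assms(2)]]]]) (simp_all add: compose_eq)

lemma rr_counit:
  assumes i: "i \<in> ix X"
  shows "ev_eq X (carrier (sp X i)) (jn i) (\<lambda>x. fdec U (rr i x) 0) i (\<lambda>x. x)"
proof -
  note cou = counit_Cblu[OF X.ind_banach_axioms]
  interpret A: ind_triple v s X "cblu_obj U X" X \<rho> "counit (Cblu v s U) X"
    by unfold_locales (rule \<rho>_hom cou)+
  note idt = idt_IndBan[OF X.ind_banach_axioms]
  have "(jn i, compose (carrier (sp X i)) (\<lambda>a\<in>carrier (CS (sp X (jn i))). fdec U a 0) (rr i)) \<in>
      idt (IndBan v s) X i"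
    using A.ind_comp_mem[OF i rep[OF i] cou(2)[OF jn[OF i]]] by (simp only: \<rho>_counit)
  from X.ind_hom_ev[OF idt(1) i this idt(2)[OF i]] show ?thesis
    by (rule X.ev_eq_cong) (simp_all add: compose_eq rr_closed[OF i])
qed

text \<open>Coassociativity with a comparison index that depends on none of g, h and x. This
  uniformity is what lets a single code capture all orbit functions in \<open>KC_rr\<close>.\<close>

lemma rr_coassoc:
  assumes i: "i \<in> ix X"
  shows "ev_eq X (UNIV \<times> UNIV \<times> carrier (sp X i)) (jn i) (\<lambda>(h, g, x). fdec U (rr i x) (g + h))
    (jn (jn i)) (\<lambda>(h, g, x). fdec U (rr (jn i) (fdec U (rr i x) g)) h)"
proof -
  let ?C = "cblu_obj U X" and ?CC = "cblu_obj U (cblu_obj U X)"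
  note com = comult_Cblu[OF X.ind_banach_axioms]
    and C\<rho> = CM_hom[OF X.ind_banach_axioms CX.ind_banach_axioms \<rho>_hom]
    and Cmem = CM_mem[OF X.ind_banach_axioms CX.ind_banach_axioms \<rho>_hom]
  interpret B: ind_triple v s X ?C ?CC \<rho> "comult (Cblu v s U) X"
    by unfold_locales (rule \<rho>_hom com)+
  interpret D: ind_triple v s X ?C ?CC \<rho> "CM X ?C \<rho>"
    by unfold_locales (rule \<rho>_hom C\<rho>)+
  note j = jn[OF i] and r = rr[OF i]
  have "ev_eq ?CC (carrier (sp X i)) (jn i) (compose (carrier (sp X i)) (translates (sp X (jn i))) (rr i))
      (jn (jn i)) (compose (carrier (sp X i)) (cblu_map U (sp X (jn i)) (rr (jn i))) (rr i))"
    by (rule CCX.ind_hom_ev[OF B.ind_comp_hom i B.ind_comp_mem[OF i rep[OF i] com(2)[OF j]]])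
      (simp only: \<rho>_comult D.ind_comp_mem[OF i rep[OF i] Cmem[OF j rep[OF j]]])
  then show ?thesis
    by (simp only: ev_eq_coassoc[OF X.ind_banach_axioms X.sp_banach[OF i] j jn[OF j] r rr[OF j]])
qed

text \<open>The coalgebra is the equalizer of the comultiplication and of the map induced by \<open>\<rho>\<close>.
  It is presented by the closed translation-invariant subspaces \<open>KC a\<close>, where \<open>a\<close> encodes an index
  \<open>oi a\<close>, a later index \<open>ol a\<close> at which the two maps are compared, and the arrows \<open>op a\<close>, \<open>oq a\<close> used
  for this.\<close>

abbreviation sdec :: "'u \<Rightarrow> nat \<Rightarrow> 'u" where
  "sdec \<equiv> inv_into UNIV (senc U)"

definition oi :: "'u \<Rightarrow> 'u" where "oi a = sdec a 0"
definition ol :: "'u \<Rightarrow> 'u" where "ol a = sdec a 1"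
definition op :: "'u \<Rightarrow> 'u" where "op a = sdec a 2"
definition oq :: "'u \<Rightarrow> 'u" where "oq a = sdec a 3"

text \<open>Objects of an index category are elements of the type \<open>'u\<close>, so the data are
  packed into a sequence of which the first four entries are read. Several codes of the same data
  are isomorphic objects and do no harm.\<close>

definition Ob :: "'u set" where
  "Ob = {a. oi a \<in> ix X \<and> ol a \<in> ix X \<and>
     op a \<in> homs (idx X) (jn (oi a)) (ol a) \<and> oq a \<in> homs (idx X) (oi a) (ol a)}"

text \<open>The left side comes from the comultiplication of x, the right side from applying \<rho>
  to the values of x, with g as outer and h as inner variable. They live over \<open>oi a\<close>
  and \<open>jn (oi a)\<close> and can be compared only after pushing both to
  \<open>ol a\<close>.\<close>

definition KC :: "'u \<Rightarrow> 'u set" where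
  "KC a = {x \<in> carrier (CS (sp X (oi a))). \<forall>g h.
     X.tr (oi a) (ol a) (oq a) (fdec U x (g + h)) =
     X.tr (jn (oi a)) (ol a) (op a) (fdec U (rr (oi a) (fdec U x g)) h)}"

definition KS :: "'u \<Rightarrow> ('k, 'u) nmod" where
  "KS a = (CS (sp X (oi a)))\<lparr>carrier := KC a\<rparr>"

text \<open>Arrows are the arrows of \<open>idx X\<close> that map one subspace into the other,
  composed as in \<open>idx X\<close>. Equations between arrows are therefore inherited, whatever
  comparison arrows the objects carry.\<close>

definition KO :: "('k, 'u) ind" where
  "KO = \<lparr>idx = \<lparr>obs = Ob,
       homs = (\<lambda>a b. {u \<in> homs (idx X) (oi a) (oi b).
         ctr (oi a) (oi b) u ` KC a \<subseteq> KC b}),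
       idt = (\<lambda>a. idt (idx X) (oi a)), cmp = (\<lambda>a b c. cmp (idx X) (oi a) (oi b) (oi c))\<rparr>,
     dgm = \<lparr>omap = KS,
       amap = (\<lambda>a b u. \<lambda>x\<in>KC a. ctr (oi a) (oi b) u x)\<rparr>\<rparr>"

lemma KO_simps [simp]:
  "ix KO = Ob" "sp KO = KS"
  "u \<in> homs (idx KO) a b \<longleftrightarrow> u \<in> homs (idx X) (oi a) (oi b) \<and>
     ctr (oi a) (oi b) u ` KC a \<subseteq> KC b"
  "idt (idx KO) a = idt (idx X) (oi a)"
  "cmp (idx KO) a b c = cmp (idx X) (oi a) (oi b) (oi c)"
  "amap (dgm KO) a b u = (\<lambda>x\<in>KC a. ctr (oi a) (oi b) u x)"
  by (simp_all add: KO_def)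

lemma KS_simps [simp]:
  "carrier (KS a) = KC a" "nrm (KS a) = nrm (CS (sp X (oi a)))"
  "x \<oplus>\<^bsub>KS a\<^esub> y = x \<oplus>\<^bsub>CS (sp X (oi a))\<^esub> y" "c \<odot>\<^bsub>KS a\<^esub> x = c \<odot>\<^bsub>CS (sp X (oi a))\<^esub> x"
  by (simp_all add: KS_def)

lemma ObD:
  assumes "a \<in> Ob"
  shows "oi a \<in> ix X" "ol a \<in> ix X" "op a \<in> homs (idx X) (jn (oi a)) (ol a)"
    "oq a \<in> homs (idx X) (oi a) (ol a)" "jn (oi a) \<in> ix X"
  using assms jn by (auto simp: Ob_def)

lemma KC_subset: "KC a \<subseteq> carrier (CS (sp X (oi a)))"
  by (auto simp: KC_def)

lemma KC_eq:
  "x \<in> KC a \<Longrightarrow> X.tr (oi a) (ol a) (oq a) (fdec U x (g + h)) =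
     X.tr (jn (oi a)) (ol a) (op a) (fdec U (rr (oi a) (fdec U x g)) h)"
  by (simp add: KC_def)

lemma KC_fdec: "x \<in> KC a \<Longrightarrow> fdec U x g \<in> carrier (sp X (oi a))"
  using KC_subset fdec_closed by blast

lemma Ob_code:
  assumes "i \<in> ix X" "l \<in> ix X" "p \<in> homs (idx X) (jn i) l" "q \<in> homs (idx X) i l"
  obtains a where "a \<in> Ob" "oi a = i" "ol a = l" "op a = p" "oq a = q"
proof -
  have "sdec (senc U f) = f" for f
    using universe by (simp add: universe_def)
  then show thesis
    \<comment> \<open>Positions from 4 on hold unspecified values of \<open>nth\<close> and are
      never read.\<close>
    using that[of "senc U (\<lambda>n. [i, l, p, q] ! n)"] assms
    by (simp add: Ob_def oi_def ol_def op_def oq_def)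
qed

lemma Ob_over:
  assumes i: "i \<in> ix X" obtains a where "a \<in> Ob" "oi a = i"
proof -
  obtain l p q where "l \<in> ix X" "p \<in> homs (idx X) (jn i) l" "q \<in> homs (idx X) i l"
    by (rule filtered_upper[OF X.filtered_idx jn[OF i] i])
  then show thesis using Ob_code[OF i] that by metis
qed

lemma KO_idt:
  assumes "a \<in> Ob" "x \<in> KC a"
  shows "cblu_map U (sp X (oi a)) (X.tr (oi a) (oi a) (idt (idx X) (oi a))) x = x"
  using subsetD[OF KC_subset assms(2)] KC_fdec[OF assms(2)]
  by (simp add: cblu_map_apply X.tr_idt ObD[OF assms(1)] fenc_fdec)

lemma cblu_map_tr_cmp:
  assumes o: "i \<in> ix X" "j \<in> ix X" "l \<in> ix X" and u: "u \<in> homs (idx X) i j" and w: "w \<in> homs (idx X) j l"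
    and x: "x \<in> carrier (CS (sp X i))"
  shows "cblu_map U (sp X i) (X.tr i l (cmp (idx X) i j l w u)) x =
    ctr j l w (ctr i j u x)"
  using CX.tr_cmp[of i j l u w x] assms by simp

lemma cblu_map_tr_closed:
  assumes "i \<in> ix X" "j \<in> ix X" "u \<in> homs (idx X) i j" "x \<in> carrier (CS (sp X i))"
  shows "ctr i j u x \<in> carrier (CS (sp X j))"
  using CX.tr_closed[of i j u x] assms by simp

text \<open>A function in \<open>KC b\<close> pushed along u satisfies the equation over i, but only
  at a later index, where \<open>rr\<close> has become natural along u. That index depends on b and
  u and not on the function, so one code c receives all of \<open>KC b\<close>.\<close>

lemma Ob_push:
  assumes b: "b \<in> Ob" and i: "i \<in> ix X" and u: "u \<in> homs (idx X) (oi b) i"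
  obtains c where "c \<in> Ob" "oi c = i" "u \<in> homs (idx KO) b c"
proof -
  note B = ObD[OF b]
  obtain k t s where k: "k \<in> ix X" and t: "t \<in> homs (idx X) (jn (oi b)) k" and s: "s \<in> homs (idx X) (jn i) k"
    and ts: "\<And>x. x \<in> carrier (sp X (oi b)) \<Longrightarrow>
      amap (dgm (cblu_obj U X)) (jn (oi b)) k t (rr (oi b) x) =
      amap (dgm (cblu_obj U X)) (jn i) k s (rr i (X.tr (oi b) i u x))"
    using CX.ev_eqE[OF rr_nat[OF B(1) i u]] by (metis cblu_obj_simps(1))
  have ts: "X.tr (jn (oi b)) k t (fdec U (rr (oi b) x) h) =
      X.tr (jn i) k s (fdec U (rr i (X.tr (oi b) i u x)) h)" if "x \<in> carrier (sp X (oi b))" for x h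
    using ts[OF that] that
    by (simp add: cblu_map_apply rr_closed B i X.tr_closed[OF B(1) i u] fun_eq_iff)
  \<comment> \<open>Joins the comparison arrow \<open>op b\<close> with the arrow t of the
    naturality square of \<open>rr\<close>.\<close>
  obtain m1 w z where m1: "m1 \<in> ix X" and w: "w \<in> homs (idx X) (ol b) m1" and z: "z \<in> homs (idx X) k m1"
    and wz: "\<And>x. x \<in> carrier (sp X (jn (oi b))) \<Longrightarrow>
      X.tr (ol b) m1 w (X.tr (jn (oi b)) (ol b) (op b) x) = X.tr k m1 z (X.tr (jn (oi b)) k t x)"
    by (rule X.tr_span[OF B(5,2) k B(3) t]) blast
  note w1 = category_cmp[OF X.category_idx B(1,2) m1 B(4) w]
  \<comment> \<open>The new comparison arrow has to start at i, whereas \<open>oq b\<close> starts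
    at \<open>oi b\<close>. Here Q is an arrow out of i that, precomposed with u, agrees with the
    pushed \<open>oq b\<close>.\<close>
  obtain m y Q where m: "m \<in> ix X" and y: "y \<in> homs (idx X) m1 m" and Q: "Q \<in> homs (idx X) i m"
    and yQ: "\<And>x. x \<in> carrier (sp X (oi b)) \<Longrightarrow>
      X.tr m1 m y (X.tr (oi b) m1 (cmp (idx X) (oi b) (ol b) m1 w (oq b)) x) =
      X.tr i m Q (X.tr (oi b) i u x)"
    by (rule X.tr_span[OF B(1) m1 i w1 u]) blast
  note zy = category_cmp[OF X.category_idx k m1 m z y]
  let ?P = "cmp (idx X) (jn i) k m (cmp (idx X) k m1 m y z) s"
  have P: "?P \<in> homs (idx X) (jn i) m"
    by (rule category_cmp[OF X.category_idx jn[OF i] k m s zy])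
  obtain c where c: "c \<in> Ob" "oi c = i" "ol c = m" "op c = ?P" "oq c = Q"
    by (rule Ob_code[OF i m P Q])
  have "ctr (oi b) i u x \<in> KC c" if x: "x \<in> KC b" for x
  proof -
    have xc: "x \<in> carrier (CS (sp X (oi b)))" using x KC_subset by auto
    note f = KC_fdec[OF x]
    have "X.tr i m Q (X.tr (oi b) i u (fdec U x (g + h))) =
        X.tr (jn i) m ?P (fdec U (rr i (X.tr (oi b) i u (fdec U x g))) h)" for g h
    proof -
      have r: "fdec U (rr (oi b) (fdec U x g)) h \<in> carrier (sp X (jn (oi b)))"
        by (rule rr_fdec_closed[OF B(1) f])
      have r': "fdec U (rr i (X.tr (oi b) i u (fdec U x g))) h \<in> carrier (sp X (jn i))"
        by (rule rr_fdec_closed[OF i X.tr_closed[OF B(1) i u f]])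
      have "X.tr i m Q (X.tr (oi b) i u (fdec U x (g + h))) =
          X.tr m1 m y (X.tr (ol b) m1 w (X.tr (oi b) (ol b) (oq b) (fdec U x (g + h))))"
        by (simp add: yQ[OF f, symmetric] X.tr_cmp[OF B(1,2) m1 B(4) w f])
      also have "\<dots> = X.tr m1 m y (X.tr k m1 z (X.tr (jn (oi b)) k t (fdec U (rr (oi b) (fdec U x g)) h)))"
        by (simp add: KC_eq[OF x] wz[OF r])
      also have "\<dots> = X.tr m1 m y (X.tr k m1 z (X.tr (jn i) k s (fdec U (rr i (X.tr (oi b) i u (fdec U x g))) h)))"
        by (simp add: ts[OF f])
      also have "\<dots> = X.tr (jn i) m ?P (fdec U (rr i (X.tr (oi b) i u (fdec U x g))) h)"
        by (simp add: X.tr_cmp[OF jn[OF i] k m s zy r'] X.tr_cmp[OF k m1 m z y X.tr_closed[OF jn[OF i] k s r']])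
      finally show ?thesis .
    qed
    with cblu_map_tr_closed[OF B(1) i u xc] show ?thesis
      by (simp add: KC_def c cblu_map_apply xc)
  qed
  then have "u \<in> homs (idx KO) b c" using u c(2) by auto
  with c show thesis using that by blast
qed

text \<open>Over one index two codes may compare along different arrows. A span equates the arrows
  out of \<open>jn (oi b)\<close>, and a coequalizing arrow then equates those out of
  \<open>oi b\<close>; afterwards both defining equations imply the same one.\<close>

lemma Ob_merge:
  assumes a: "a \<in> Ob" and b: "b \<in> Ob" and eq: "oi a = oi b"
  obtains c where "c \<in> Ob" "oi c = oi b" "KC a \<subseteq> KC c" "KC b \<subseteq> KC c"
proof -
  note A = ObD[OF a, unfolded eq] and B = ObD[OF b]
  note C = X.category_idx
  let ?i = "oi b"
  obtain m w z where m: "m \<in> ix X" and w: "w \<in> homs (idx X) (ol a) m" and z: "z \<in> homs (idx X) (ol b) m"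
    and wz: "cmp (idx X) (jn ?i) (ol a) m w (op a) = cmp (idx X) (jn ?i) (ol b) m z (op b)"
    by (rule filtered_span[OF X.filtered_idx B(5) A(2) B(2) A(3) B(3)])
  note wq = category_cmp[OF C B(1) A(2) m A(4) w] and zq = category_cmp[OF C B(1,2) m B(4) z]
    and wp = category_cmp[OF C B(5) A(2) m A(3) w]
  obtain n y where n: "n \<in> ix X" and y: "y \<in> homs (idx X) m n"
    and yy: "cmp (idx X) ?i m n y (cmp (idx X) ?i (ol a) m w (oq a)) =
      cmp (idx X) ?i m n y (cmp (idx X) ?i (ol b) m z (oq b))"
    by (rule filtered_coeq[OF X.filtered_idx B(1) m wq zq])
  let ?P = "cmp (idx X) (jn ?i) m n y (cmp (idx X) (jn ?i) (ol a) m w (op a))"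
    and ?Q = "cmp (idx X) ?i m n y (cmp (idx X) ?i (ol a) m w (oq a))"
  note P = category_cmp[OF C B(5) m n wp y] and Q = category_cmp[OF C B(1) m n wq y]
  obtain c where c: "c \<in> Ob" "oi c = ?i" "ol c = n" "op c = ?P" "oq c = ?Q"
    by (rule Ob_code[OF B(1) n P Q])
  have Pa: "X.tr (jn ?i) n ?P x = X.tr m n y (X.tr (ol a) m w (X.tr (jn ?i) (ol a) (op a) x))"
    and Pb: "X.tr (jn ?i) n ?P x = X.tr m n y (X.tr (ol b) m z (X.tr (jn ?i) (ol b) (op b) x))"
    if "x \<in> carrier (sp X (jn ?i))" for x
    using that X.tr_cmp[OF B(5) m n wp y that] X.tr_cmp[OF B(5) A(2) m A(3) w that]
      X.tr_cmp[OF B(5,2) m B(3) z that] by (simp_all add: wz)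
  have Qa: "X.tr ?i n ?Q x = X.tr m n y (X.tr (ol a) m w (X.tr ?i (ol a) (oq a) x))"
    and Qb: "X.tr ?i n ?Q x = X.tr m n y (X.tr (ol b) m z (X.tr ?i (ol b) (oq b) x))"
    if "x \<in> carrier (sp X ?i)" for x
    using X.tr_cmp[OF B(1) m n wq y that] X.tr_cmp[OF B(1) A(2) m A(4) w that]
      X.tr_cmp[OF B(1) m n zq y that] X.tr_cmp[OF B(1,2) m B(4) z that] by (simp_all add: yy)
  have "x \<in> KC c" if x: "x \<in> KC a" for x
    using x KC_eq[OF x] KC_subset[of a] KC_fdec[OF x] rr_fdec_closed[OF B(1)]
    by (auto simp: KC_def[of c] c Pa Qa eq)
  moreover have "x \<in> KC c" if x: "x \<in> KC b" for x
    using x KC_eq[OF x] KC_subset[of b] KC_fdec[OF x] rr_fdec_closed[OF B(1)]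
    by (auto simp: KC_def[of c] c Pb Qb)
  ultimately show thesis using that[OF c(1,2)] by blast
qed

lemma Ob_span:
  assumes a: "a \<in> Ob" and b: "b \<in> Ob" and i: "i \<in> ix X"
    and u: "u \<in> homs (idx X) (oi a) i" and w: "w \<in> homs (idx X) (oi b) i"
  obtains c where "c \<in> Ob" "oi c = i" "u \<in> homs (idx KO) a c" "w \<in> homs (idx KO) b c"
proof -
  obtain a' where a': "a' \<in> Ob" "oi a' = i" "u \<in> homs (idx KO) a a'" by (rule Ob_push[OF a i u])
  obtain b' where b': "b' \<in> Ob" "oi b' = i" "w \<in> homs (idx KO) b b'" by (rule Ob_push[OF b i w])
  obtain c where c: "c \<in> Ob" "oi c = oi b'" "KC a' \<subseteq> KC c" "KC b' \<subseteq> KC c"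
    by (rule Ob_merge[OF a'(1) b'(1)]) (simp_all add: a' b')
  show thesis
    by (rule that[OF c(1)]) (use a' b' c in auto)
qed

text \<open>For each pair t of group elements the defining equation compares two bounded operators
  with values in one Banach space, so \<open>KC a\<close> is an intersection of equalizers and hence
  closed.\<close>

lemma banach_KS:
  assumes a: "a \<in> Ob"
  shows "banach_module v s (KS a)"
proof -
  note A = ObD[OF a]
  let ?V = "CS (sp X (oi a))" and ?W = "sp X (ol a)"
  note Bi = X.sp_banach[OF A(1)] and Bl = X.sp_banach[OF A(2)] and Bj = X.sp_banach[OF A(5)]
  note BV = banach_cblu_space[OF Bi] and BCj = banach_cblu_space[OF Bj]
  let ?e = "\<lambda>g. \<lambda>x\<in>carrier ?V. fdec U x g"
  define L where "L = (\<lambda>t::'g \<times> 'g. compose (carrier ?V) (X.tr (oi a) (ol a) (oq a)) (?e (fst t + snd t)))"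
  \<comment> \<open>From right to left: evaluate x at \<open>fst t\<close>, take the orbit function
    by \<open>rr\<close>, evaluate it at \<open>snd t\<close>, and push along
    \<open>op a\<close>.\<close>
  define R where "R = (\<lambda>t::'g \<times> 'g. compose (carrier ?V) (X.tr (jn (oi a)) (ol a) (op a))
    (compose (carrier ?V) (\<lambda>y\<in>carrier (CS (sp X (jn (oi a)))). fdec U y (snd t))
      (compose (carrier ?V) (rr (oi a)) (?e (fst t)))))"
  have L: "L t \<in> bhom ?V ?W" for t
    unfolding L_def by (rule bhom_compose[OF fdec_bhom[OF Bi] X.tr_bhom[OF A(1,2,4)] Bi BV])
  have R: "R t \<in> bhom ?V ?W" for t
    unfolding R_def
    by (rule bhom_compose[OF bhom_compose[OF bhom_compose[OF fdec_bhom[OF Bi] rr[OF A(1)] Bi BV]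
            fdec_bhom[OF Bj] BCj BV] X.tr_bhom[OF A(5,2,3)] Bj BV])
  interpret V: banach_module v s ?V by (rule BV)
  have "KC a = {x \<in> carrier ?V. \<forall>t. L t x = R t x}"
    by (auto simp: KC_def L_def R_def compose_eq rr_closed A fdec_closed)
  then show ?thesis
    using V.banach_equalizer[where A = L and B = R, OF Bl L R] valued by (simp add: banach_module_def KS_def)
qed

lemma KO_tr_bhom:
  assumes a: "a \<in> Ob" and b: "b \<in> Ob" and u: "u \<in> homs (idx KO) a b"
  shows "amap (dgm KO) a b u \<in> bhom (KS a) (KS b)"
proof -
  note A = ObD[OF a] and B = ObD[OF b]
  have "ctr (oi a) (oi b) u \<in> bhom (CS (sp X (oi a))) (CS (sp X (oi b)))"
    using CX.tr_bhom[of "oi a" "oi b" u] A B u by simp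
  from bhom_corestrict[OF bhom_restrict[OF banach_KS[OF a, unfolded KS_def] KC_subset this]]
  show ?thesis using u by (auto simp: KS_def)
qed

text \<open>Upper bounds and coequalizing arrows are found in \<open>idx X\<close> and lifted by
  \<open>Ob_span\<close> and \<open>Ob_push\<close>, which supply a target object large enough for
  the given arrows to respect the subspaces.\<close>

lemma filtered_KO: "filtered (idx KO)"
proof -
  note C = X.category_idx
  have "category (idx KO)"
  proof (rule categoryI)
    show "idt (idx KO) a \<in> homs (idx KO) a a" if "a \<in> ix KO" for a
      using that KO_idt by (auto simp: category_idt[OF C] ObD)
    show "cmp (idx KO) a b c w u \<in> homs (idx KO) a c"
      if "a \<in> ix KO" "b \<in> ix KO" "c \<in> ix KO" and u: "u \<in> homs (idx KO) a b" and w: "w \<in> homs (idx KO) b c"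
      for a b c u w
    proof -
      note A = ObD[of a] ObD[of b] ObD[of c]
      have "cblu_map U (sp X (oi a)) (X.tr (oi a) (oi c) (cmp (idx X) (oi a) (oi b) (oi c) w u)) x =
          ctr (oi b) (oi c) w (ctr (oi a) (oi b) u x)"
        if x: "x \<in> KC a" for x
        using that KC_subset[of a] u w A \<open>a \<in> ix KO\<close> \<open>b \<in> ix KO\<close> \<open>c \<in> ix KO\<close>
        by (intro cblu_map_tr_cmp) auto
      moreover have "ctr (oi b) (oi c) w
          (ctr (oi a) (oi b) u x) \<in> KC c" if "x \<in> KC a" for x
        using u w that by (simp add: image_subset_iff)
      ultimately show ?thesis
        using u w A that by (simp add: image_subset_iff category_cmp[OF C])
    qed
    show "cmp (idx KO) a a b u (idt (idx KO) a) = u"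
      if "a \<in> ix KO" "b \<in> ix KO" "u \<in> homs (idx KO) a b" for a b u
      using that by (simp add: ObD category_idt_right[OF C])
    show "cmp (idx KO) a b b (idt (idx KO) b) u = u"
      if "a \<in> ix KO" "b \<in> ix KO" "u \<in> homs (idx KO) a b" for a b u
      using that by (simp add: ObD category_idt_left[OF C])
    show "cmp (idx KO) a b d w (cmp (idx KO) a b' b t u) = cmp (idx KO) a b' d (cmp (idx KO) b' b d w t) u"
      if "a \<in> ix KO" "b' \<in> ix KO" "b \<in> ix KO" "d \<in> ix KO"
        "u \<in> homs (idx KO) a b'" "t \<in> homs (idx KO) b' b" "w \<in> homs (idx KO) b d" for a b b' d u t w
      using that by (simp add: ObD category_assoc[OF C])
  qed
  moreover have "ix KO \<noteq> {}"
  proof -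
    obtain i where "i \<in> ix X" using X.filtered_idx unfolding filtered_def by blast
    then show ?thesis using Ob_over by force
  qed
  moreover have "\<exists>c\<in>ix KO. homs (idx KO) a c \<noteq> {} \<and> homs (idx KO) b c \<noteq> {}"
    if a: "a \<in> ix KO" and b: "b \<in> ix KO" for a b
  proof -
    have a: "a \<in> Ob" and b: "b \<in> Ob" using a b by simp_all
    obtain i u w where i: "i \<in> ix X" "u \<in> homs (idx X) (oi a) i" "w \<in> homs (idx X) (oi b) i"
      by (rule filtered_upper[OF X.filtered_idx ObD(1)[OF a] ObD(1)[OF b]])
    obtain c where "c \<in> Ob" "u \<in> homs (idx KO) a c" "w \<in> homs (idx KO) b c"
      by (rule Ob_span[OF a b i])
    then show ?thesis using KO_simps(1) by blast
  qed
  moreover have "\<exists>c\<in>ix KO. \<exists>r\<in>homs (idx KO) b c. cmp (idx KO) a b c r p = cmp (idx KO) a b c r q"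
    if a: "a \<in> ix KO" and b: "b \<in> ix KO" and p: "p \<in> homs (idx KO) a b" and q: "q \<in> homs (idx KO) a b"
    for a b p q
  proof -
    have a: "a \<in> Ob" and b: "b \<in> Ob" and p: "p \<in> homs (idx X) (oi a) (oi b)"
      and q: "q \<in> homs (idx X) (oi a) (oi b)" using a b p q by simp_all
    obtain l r where l: "l \<in> ix X" "r \<in> homs (idx X) (oi b) l"
      and e: "cmp (idx X) (oi a) (oi b) l r p = cmp (idx X) (oi a) (oi b) l r q"
      by (rule filtered_coeq[OF X.filtered_idx ObD(1)[OF a] ObD(1)[OF b] p q])
    obtain c where c: "c \<in> Ob" "oi c = l" "r \<in> homs (idx KO) b c"
      by (rule Ob_push[OF b l])
    show ?thesis
      by (rule bexI[of _ c], rule bexI[of _ r]) (use c e in simp_all)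
  qed
  ultimately show ?thesis
    unfolding filtered_def by blast
qed

lemma ind_banach_KO: "ind_banach v s KO"
proof -
  have B: "banach_module v s V \<Longrightarrow> V \<in> obs (Ban v s)" for V :: "('k, 'u) nmod"
    by (simp add: Ban_def banach_module_def)
  have "is_functor (idx KO) (Ban v s) (dgm KO)"
    unfolding is_functor_def
  proof (intro conjI ballI)
    show "omap (dgm KO) a \<in> obs (Ban v s)" if "a \<in> ix KO" for a
      using that B[OF banach_KS] by simp
    show "amap (dgm KO) a b u \<in> homs (Ban v s) (omap (dgm KO) a) (omap (dgm KO) b)"
      if "a \<in> ix KO" "b \<in> ix KO" "u \<in> homs (idx KO) a b" for a b u
      using KO_tr_bhom[of a b u] that by (simp add: Ban_def)
    show "amap (dgm KO) a a (idt (idx KO) a) = idt (Ban v s) (omap (dgm KO) a)" if "a \<in> ix KO" for a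
      using that by (auto simp: Ban_def KO_idt intro!: restrict_ext)
    show "amap (dgm KO) a c (cmp (idx KO) a b c w u) =
        cmp (Ban v s) (omap (dgm KO) a) (omap (dgm KO) b) (omap (dgm KO) c)
          (amap (dgm KO) b c w) (amap (dgm KO) a b u)"
      if "a \<in> ix KO" "b \<in> ix KO" "c \<in> ix KO" "u \<in> homs (idx KO) a b" "w \<in> homs (idx KO) b c" for a b c u w
    proof (rule extensionalityI[of _ "KC a"])
      fix x assume x: "x \<in> KC a"
      have "ctr (oi a) (oi b) u x \<in> KC b" using that x by auto
      with that x KC_subset[of a] show "amap (dgm KO) a c (cmp (idx KO) a b c w u) x =
        cmp (Ban v s) (omap (dgm KO) a) (omap (dgm KO) b) (omap (dgm KO) c)
          (amap (dgm KO) b c w) (amap (dgm KO) a b u) x"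
        by (auto simp: Ban_def compose_eq ObD intro!: cblu_map_tr_cmp)
    qed (simp_all add: Ban_def)
  qed
  then show ?thesis
    using valued filtered_KO by (simp add: ind_banach_def ind_object_def)
qed

sublocale KO: ind_banach v s KO
  by (rule ind_banach_KO)


text \<open>Subtraction depends on the carrier through the inverse. The inclusion of the subspace is
  a bounded linear map and so preserves it.\<close>

lemma KS_diff:
  assumes a: "a \<in> Ob" and x: "x \<in> KC a" and y: "y \<in> KC a"
  shows "x \<ominus>\<^bsub>KS a\<^esub> y = x \<ominus>\<^bsub>CS (sp X (oi a))\<^esub> y"
proof -
  note B = banach_KS[OF a] and BC = banach_cblu_space[OF X.sp_banach[OF ObD(1)[OF a]]]
  interpret K: banach_module v s "KS a" by (rule B)
  have "restrict (\<lambda>x\<in>carrier (CS (sp X (oi a))). x) (KC a) \<in> bhom (KS a) (CS (sp X (oi a)))"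
    using bhom_restrict[OF B[unfolded KS_def] KC_subset bhom_idt[OF BC]] by (simp add: KS_def)
  from bhom_diff[OF B BC this, of x y] show ?thesis
    using x y K.minus_closed[of x y] subsetD[OF KC_subset[of a]] by simp
qed

text \<open>Translation shifts the outer variable g and leaves h alone. As the equation is required
  for all g, it is preserved, with no equivariance of \<open>rr\<close> involved.\<close>

lemma translate_KC:
  assumes a: "a \<in> Ob" and x: "x \<in> KC a"
  shows "translate g x \<in> KC a"
proof -
  have "X.tr (oi a) (ol a) (oq a) (fdec U x (- g + (g' + h))) =
      X.tr (jn (oi a)) (ol a) (op a) (fdec U (rr (oi a) (fdec U x (- g + g'))) h)" for g' h
    using KC_eq[OF x, of "- g + g'" h] by (simp only: add.assoc)
  then show ?thesis
    using translate_mem[OF X.sp_banach[OF ObD(1)[OF a]] subsetD[OF KC_subset x]] by (simp add: KC_def)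
qed

section \<open>The isometric action on the equalizer\<close>

definition KT :: "'u \<Rightarrow> 'g \<times> 'u \<Rightarrow> 'u" where
  "KT a = (\<lambda>(g, x). if x \<in> KC a then translate g x else undefined)"

lemma KT_simp [simp]: "x \<in> KC a \<Longrightarrow> KT a (g, x) = translate g x"
  by (simp add: KT_def)

lemma KT_families:
  assumes a: "a \<in> Ob"
  shows "KT a \<in> families (KS a) (KS a)"
proof -
  interpret banach_module v s "KS a" by (rule banach_KS[OF a])
  note BX = X.sp_banach[OF ObD(1)[OF a]] and c = subsetD[OF KC_subset[of a]]
  have "(\<lambda>x. KT a (g, x)) \<in> bhom (KS a) (KS a)" for g
    using a_closed smult_closed
    by (intro bhomI[where M = 1])
      (auto simp: KT_def extensional_def translate_KC[OF a] translate_add[OF c c]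
        translate_smult[OF c] translate_nrm[OF BX c])
  then show ?thesis by (simp add: families_def)
qed

text \<open>The action is represented by translation without leaving the index a. The full class is
  needed for membership in the colimit, and by \<open>KA_mem\<close> its members are the families
  eventually equal to translation.\<close>

definition KA :: "('g, 'u) ind_action" where
  "KA = (\<lambda>a\<in>Ob. colim_rel KO (UNIV \<times> KC a) (\<lambda>b. families (KS a) (KS b)) `` {(a, KT a)})"

lemma KA_mem:
  assumes a: "a \<in> Ob"
  shows "(b, t) \<in> KA a \<longleftrightarrow> b \<in> Ob \<and> t \<in> families (KS a) (KS b) \<and> ev_eq KO (UNIV \<times> KC a) a (KT a) b t"
  using a KT_families[OF a] by (auto simp: KA_def colim_rel_def)

lemma KT_mem: "a \<in> Ob \<Longrightarrow> (a, KT a) \<in> KA a"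
  by (simp add: KA_mem KT_families KO.ev_eq_refl)

lemma families_KS: "t \<in> families (KS a) (KS b) \<Longrightarrow> x \<in> KC a \<Longrightarrow> t (g, x) \<in> KC b"
  using funcset_mem[OF subsetD[OF families_subset], of t "KS a" "KS b" "(g, x)"] by simp

text \<open>Eventual equality in the equalizer may be tested in the function spaces along arbitrary
  arrows of \<open>idx X\<close>, because \<open>Ob_span\<close> lifts two arrows with a common
  target to arrows of \<open>KO\<close>.\<close>

lemma KO_span:
  assumes "a \<in> Ob" "b \<in> Ob" "i \<in> ix X" "u \<in> homs (idx X) (oi a) i" "w \<in> homs (idx X) (oi b) i"
    and "f \<in> D \<rightarrow> KC a" "f' \<in> D \<rightarrow> KC b"
    and "\<And>y. y \<in> D \<Longrightarrow> ctr (oi a) i u (f y) =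
      ctr (oi b) i w (f' y)"
  shows "ev_eq KO D a f b f'"
proof -
  obtain c where c: "c \<in> Ob" "oi c = i" "u \<in> homs (idx KO) a c" "w \<in> homs (idx KO) b c"
    by (rule Ob_span[OF assms(1-5)])
  show ?thesis
    by (rule KO.ev_eqI[of c u _ w]) (use c assms(6-8) in \<open>auto simp: Pi_iff\<close>)
qed

lemma KO_evE:
  assumes "ev_eq KO D a f b f'" and "f \<in> D \<rightarrow> KC a" "f' \<in> D \<rightarrow> KC b"
  obtains c u w where "c \<in> Ob" "u \<in> homs (idx KO) a c" "w \<in> homs (idx KO) b c"
    "\<And>y. y \<in> D \<Longrightarrow> ctr (oi a) (oi c) u (f y) =
      ctr (oi b) (oi c) w (f' y)"
proof -
  obtain c u w where c: "c \<in> ix KO" "u \<in> homs (idx KO) a c" "w \<in> homs (idx KO) b c"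
    and e: "\<And>y. y \<in> D \<Longrightarrow> amap (dgm KO) a c u (f y) = amap (dgm KO) b c w (f' y)"
    using KO.ev_eqE[OF assms(1)] by blast
  show thesis
    by (rule that[of c u w]) (use c e assms(2,3) in \<open>auto simp: Pi_iff\<close>)
qed

lemma iso_action_KA: "iso_action KO KA"
  unfolding iso_action_def KO_simps(1,2) KS_simps(1)
proof (intro conjI ballI)
  show "KA \<in> (\<Pi>\<^sub>E a\<in>Ob. colim_set KO (UNIV \<times> KC a) (\<lambda>b. families (KS a) (KS b)))"
    unfolding PiE_iff
  proof (intro conjI ballI)
    fix a assume a: "a \<in> Ob"
    show "KA a \<in> colim_set KO (UNIV \<times> KC a) (\<lambda>b. families (KS a) (KS b))"
      using a KT_families[OF a] unfolding colim_set_def KA_def by (auto intro!: quotientI)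
  qed (simp add: KA_def)
next
  fix a a' u assume a: "a \<in> Ob" and a': "a' \<in> Ob" and u: "u \<in> homs (idx KO) a a'"
  have uK: "cblu_map U (sp X (oi a)) (X.tr (oi a) (oi a') u) x \<in> KC a'" if "x \<in> KC a" for x
    using u that by auto
  have "(b, \<lambda>(g, x). compose (KC a) (\<lambda>y. t (g, y)) (amap (dgm KO) a a' u) x) \<in> KA a"
    if bt: "(b, t) \<in> KA a'" for b t
  proof -
    have b: "b \<in> Ob" and t: "t \<in> families (KS a') (KS b)" and e: "ev_eq KO (UNIV \<times> KC a') a' (KT a') b t"
      using bt by (simp_all add: KA_mem[OF a'])
    let ?t = "\<lambda>(g, x). compose (KC a) (\<lambda>y. t (g, y)) (amap (dgm KO) a a' u) x"
    have "compose (KC a) (\<lambda>y. t (g, y)) (amap (dgm KO) a a' u) \<in> bhom (KS a) (KS b)" for g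
      using bhom_compose[OF KO_tr_bhom[OF a a' u], of "\<lambda>y. t (g, y)" "KS b"] t banach_KS[OF a] banach_KS[OF a']
      by (simp add: families_def del: KO_simps)
    then have tf: "?t \<in> families (KS a) (KS b)"
      by (simp add: families_def del: KO_simps)
    let ?k = "\<lambda>(g::'g, x). (g, cblu_map U (sp X (oi a)) (X.tr (oi a) (oi a') u) x)"
    \<comment> \<open>Translation commutes strictly with the transition maps, so the representatives
      \<open>KT\<close> are natural without passing to a later index.\<close>
    have 1: "ev_eq KO (UNIV \<times> KC a) a (KT a) a' (\<lambda>y. KT a' (?k y))"
      using a a' u
      by (intro KO.ev_eq_push[of _ _ u])
        (auto simp: translate_KC uK translate_cblu_map X.sp_banach ObD subsetD[OF KC_subset])
    have 2: "ev_eq KO (UNIV \<times> KC a) a' (\<lambda>y. KT a' (?k y)) b ?t"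
      by (rule KO.ev_eq_comp[OF e, where k = ?k]) (auto simp: uK compose_eq)
    have "ev_eq KO (UNIV \<times> KC a) a (KT a) b ?t"
      using a a' b
      by (intro KO.ev_eq_trans[OF _ _ _ _ _ _ 1 2])
        (auto simp: translate_KC uK compose_eq families_KS[OF t])
    then show ?thesis using b tf by (simp add: KA_mem[OF a] del: KO_simps)
  qed
  then show "case p of (b, t) \<Rightarrow>
      (b, \<lambda>(g, x). compose (KC a) (\<lambda>y. t (g, y)) (amap (dgm KO) a a' u) x) \<in> KA a"
    if "p \<in> KA a'" for p
    using that by (cases p) (simp only: prod.case)
next
  fix a assume a: "a \<in> Ob"
  have "ev_eq KO (KC a) b (\<lambda>x. t (0, x)) a (\<lambda>x. x)" if bt: "(b, t) \<in> KA a" for b t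
  proof -
    have e: "ev_eq KO (UNIV \<times> KC a) a (KT a) b t" using bt by (simp add: KA_mem[OF a])
    show ?thesis
      by (rule KO.ev_eq_comp[OF KO.ev_eq_sym[OF e], where k = "\<lambda>x. (0, x)"])
        (auto simp: translate_zero[OF subsetD[OF KC_subset]])
  qed
  then show "case p of (b, t) \<Rightarrow> ev_eq KO (KC a) b (\<lambda>x. t (0, x)) a (\<lambda>x. x)" if "p \<in> KA a" for p
    using that by (cases p) (simp only: prod.case)
next
  fix a assume a: "a \<in> Ob"
  note c = subsetD[OF KC_subset] and sb = X.sp_banach[OF ObD(1)]
  have "ev_eq KO (UNIV \<times> UNIV \<times> KC a) d (\<lambda>(g, h, x). t' (g, t (h, x))) b (\<lambda>(g, h, x). t (g + h, x))"
    if bt: "(b, t) \<in> KA a" and dt: "(d, t') \<in> KA b" for b t d t'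
  proof -
    have b: "b \<in> Ob" and t: "t \<in> families (KS a) (KS b)" and e: "ev_eq KO (UNIV \<times> KC a) a (KT a) b t"
      using bt by (simp_all add: KA_mem[OF a])
    have d: "d \<in> Ob" and t': "t' \<in> families (KS b) (KS d)" and e': "ev_eq KO (UNIV \<times> KC b) b (KT b) d t'"
      using dt by (simp_all add: KA_mem[OF b])
    obtain m u w where m: "m \<in> Ob" and u: "u \<in> homs (idx KO) a m" and w: "w \<in> homs (idx KO) b m"
      and uw: "\<And>y. y \<in> UNIV \<times> KC a \<Longrightarrow> ctr (oi a) (oi m) u (KT a y) =
        ctr (oi b) (oi m) w (t y)"
      by (rule KO_evE[OF e]) (auto simp: translate_KC[OF a] families_KS[OF t])
    let ?u = "ctr (oi a) (oi m) u"
      and ?w = "ctr (oi b) (oi m) w"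
    have uw: "?w (t (g, x)) = ?u (translate g x)" if "x \<in> KC a" for g x
      using uw[of "(g, x)"] that by simp
    \<comment> \<open>The law is required for arbitrary members of the classes. Fact 1 exchanges t'
      for translation, and fact 2 exchanges t for it at the index m, where translation passes
      through the transition maps.\<close>
    have 1: "ev_eq KO (UNIV \<times> UNIV \<times> KC a) d (\<lambda>(g, h, x). t' (g, t (h, x)))
        b (\<lambda>(g, h, x). translate g (t (h, x)))"
      by (rule KO.ev_eq_comp[OF KO.ev_eq_sym[OF e'], where k = "\<lambda>(g, h, x). (g, t (h, x))"])
        (auto simp: families_KS[OF t])
    have 2: "ev_eq KO (UNIV \<times> UNIV \<times> KC a) b (\<lambda>(g, h, x). translate g (t (h, x)))
        b (\<lambda>(g, h, x). t (g + h, x))"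
    proof (rule KO.ev_eqI[of m w _ w])
      fix y :: "'g \<times> 'g \<times> 'u" assume "y \<in> UNIV \<times> UNIV \<times> KC a"
      then obtain g h x where y: "y = (g, h, x)" and x: "x \<in> KC a" by auto
      have "?w (translate g (t (h, x))) = translate g (?w (t (h, x)))"
        by (rule translate_cblu_map[OF sb[OF b] c[OF families_KS[OF t x]]])
      also have "\<dots> = translate g (?u (translate h x))" by (simp add: uw[OF x])
      also have "\<dots> = ?u (translate g (translate h x))"
        by (rule translate_cblu_map[OF sb[OF a] c[OF translate_KC[OF a x]], symmetric])
      also have "\<dots> = ?w (t (g + h, x))" by (simp add: uw[OF x] translate_translate)
      finally show "KO.tr b m w ((\<lambda>(g, h, x). translate g (t (h, x))) y) =
          KO.tr b m w ((\<lambda>(g, h, x). t (g + h, x)) y)"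
        by (simp add: y x families_KS[OF t] translate_KC[OF b])
    qed (use m w in simp_all)
    show ?thesis
      by (rule KO.ev_eq_trans[OF _ _ _ _ _ _ 1 2])
        (use b d in \<open>auto simp: families_KS[OF t] families_KS[OF t'] translate_KC\<close>)
  qed
  then show "case p of (b, t) \<Rightarrow> \<forall>(d, t')\<in>KA b.
      ev_eq KO (UNIV \<times> UNIV \<times> KC a) d (\<lambda>(g, h, x). t' (g, t (h, x))) b (\<lambda>(g, h, x). t (g + h, x))"
    if "p \<in> KA a" for p
    using that by (cases p) (simp only: prod.case, blast)
next
  fix a assume a: "a \<in> Ob"
  note c = subsetD[OF KC_subset] and sb = X.sp_banach[OF ObD(1)[OF a]]
  \<comment> \<open>The representative \<open>KT a\<close> already has both properties at the index
    a itself.\<close>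
  have "isometric_family (KS a) (KS a) (KT a)"
    by (simp add: isometric_family_def translate_nrm[OF sb c] del: cblu_space_simps)
  moreover have "strongly_continuous_family (KS a) (KS a) (KT a)"
    using translate_continuous[OF sb c]
    by (simp add: strongly_continuous_family_def KS_diff[OF a translate_KC[OF a] translate_KC[OF a]])
  ultimately show "\<exists>(b, t)\<in>KA a. isometric_family (KS a) (KS b) t \<and> strongly_continuous_family (KS a) (KS b) t"
    using KT_mem[OF a] by blast
qed

lemma isometric_action_KO: "isometric_action v s U KO KA"
  by unfold_locales (rule iso_action_KA)

section \<open>The isomorphism from the equalizer to the given coalgebra\<close>

definition ev1 :: "'u \<Rightarrow> 'u \<Rightarrow> 'u" where
  "ev1 a = (\<lambda>x\<in>KC a. fdec U x 0)"

definition eps :: "'u indmap" where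
  "eps = (\<lambda>a\<in>Ob. ind_cls KO X a (oi a) (ev1 a))"

lemma ev1_bhom:
  assumes a: "a \<in> Ob"
  shows "ev1 a \<in> bhom (KS a) (sp X (oi a))"
proof -
  have "restrict (\<lambda>x\<in>carrier (CS (sp X (oi a))). fdec U x 0) (KC a) = ev1 a"
    unfolding ev1_def by (rule restrict_ext) (simp add: subsetD[OF KC_subset])
  with bhom_restrict[OF banach_KS[OF a, unfolded KS_def] KC_subset
      fdec_bhom[OF X.sp_banach[OF ObD(1)[OF a]], of 0]]
  show ?thesis by (simp add: KS_def)
qed

lemma eps_hom: "eps \<in> ind_hom KO X"
proof (rule X.ind_homI_transform[OF ind_banach_KO, where J = oi and F = ev1 and A = "\<lambda>a b u. u"])
  fix a b u x assume "a \<in> ix KO" "b \<in> ix KO" "u \<in> homs (idx KO) a b" "x \<in> carrier (sp KO a)"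
  then have x: "x \<in> KC a" and ux: "ctr (oi a) (oi b) u x \<in> KC b" by auto
  then show "ev1 b (amap (dgm KO) a b u x) = X.tr (oi a) (oi b) u (ev1 a x)"
    by (simp add: ev1_def cblu_map_apply[OF subsetD[OF KC_subset]])
qed (use ev1_bhom in \<open>auto simp: eps_def ObD\<close>)

lemma eps_mem: "a \<in> Ob \<Longrightarrow> (oi a, ev1 a) \<in> eps a"
  unfolding eps_def by (simp add: X.ind_cls_self ev1_bhom ObD)

text \<open>The index and the arrows at which coassociativity over i becomes an equality are
  themselves taken as the comparison data of a; the equality then reads as membership in
  \<open>KC a\<close>.\<close>

lemma KC_rr:
  assumes i: "i \<in> ix X"
  obtains a where "a \<in> Ob" "oi a = jn i" "\<And>x. x \<in> carrier (sp X i) \<Longrightarrow> rr i x \<in> KC a"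
proof -
  note j = jn[OF i]
  obtain m q p where m: "m \<in> ix X" and q: "q \<in> homs (idx X) (jn i) m"
    and p: "p \<in> homs (idx X) (jn (jn i)) m"
    and e: "\<And>y. y \<in> UNIV \<times> UNIV \<times> carrier (sp X i) \<Longrightarrow>
      X.tr (jn i) m q ((\<lambda>(h, g, x). fdec U (rr i x) (g + h)) y) =
      X.tr (jn (jn i)) m p ((\<lambda>(h, g, x). fdec U (rr (jn i) (fdec U (rr i x) g)) h) y)"
    by (rule X.ev_eqE[OF rr_coassoc[OF i]]) blast
  obtain a where a: "a \<in> Ob" "oi a = jn i" "ol a = m" "op a = p" "oq a = q"
    by (rule Ob_code[OF j m p q])
  have "X.tr (jn i) m q (fdec U (rr i x) (g + h)) =
      X.tr (jn (jn i)) m p (fdec U (rr (jn i) (fdec U (rr i x) g)) h)" if "x \<in> carrier (sp X i)" for x g h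
    using e[of "(h, g, x)"] that by simp
  then have "rr i x \<in> KC a" if "x \<in> carrier (sp X i)" for x
    using that rr_closed[OF i that] by (simp add: KC_def a)
  with a show thesis using that by blast
qed

definition oj :: "'u \<Rightarrow> 'u" where
  "oj i = (SOME a. a \<in> Ob \<and> oi a = jn i \<and> rr i ` carrier (sp X i) \<subseteq> KC a)"

lemma oj:
  assumes "i \<in> ix X"
  shows "oj i \<in> Ob" "oi (oj i) = jn i" "x \<in> carrier (sp X i) \<Longrightarrow> rr i x \<in> KC (oj i)"
proof -
  have "\<exists>a. a \<in> Ob \<and> oi a = jn i \<and> rr i ` carrier (sp X i) \<subseteq> KC a"
    using KC_rr[OF assms] by (metis image_subsetI)
  from someI_ex[OF this] show "oj i \<in> Ob" "oi (oj i) = jn i" "x \<in> carrier (sp X i) \<Longrightarrow> rr i x \<in> KC (oj i)"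
    unfolding oj_def by auto
qed

lemma rr_bhom_KS:
  assumes i: "i \<in> ix X"
  shows "rr i \<in> bhom (sp X i) (KS (oj i))"
  using bhom_corestrict[OF rr[OF i], of "KC (oj i)"] oj[OF i] by (simp add: KS_def)

definition eta :: "'u indmap" where
  "eta = (\<lambda>i\<in>ix X. ind_cls X KO i (oj i) (rr i))"

lemma eta_mem: "i \<in> ix X \<Longrightarrow> (oj i, rr i) \<in> eta i"
  unfolding eta_def by (simp add: KO.ind_cls_self rr_bhom_KS oj)

text \<open>Naturality of \<rho> is an eventual equality in the function spaces, and
  \<open>KO_span\<close> transfers it to the equalizer.\<close>

lemma eta_hom: "eta \<in> ind_hom X KO"
proof (rule KO.ind_homI[OF X.ind_banach_axioms, where J = oj and F = rr])
  fix i i' u assume i: "i \<in> ix X" and i': "i' \<in> ix X" and u: "u \<in> homs (idx X) i i'"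
  obtain k p q where k: "k \<in> ix X" and p: "p \<in> homs (idx X) (jn i) k" and q: "q \<in> homs (idx X) (jn i') k"
    and pq: "\<And>x. x \<in> carrier (sp X i) \<Longrightarrow>
      amap (dgm (cblu_obj U X)) (jn i) k p (rr i x) =
      amap (dgm (cblu_obj U X)) (jn i') k q (rr i' (X.tr i i' u x))"
    using CX.ev_eqE[OF rr_nat[OF i i' u]] by (metis cblu_obj_simps(1))
  show "ev_eq KO (carrier (sp X i)) (oj i) (rr i) (oj i') (\<lambda>x. rr i' (X.tr i i' u x))"
    by (rule KO_span[of _ _ k p q]) (use k p q pq oj[OF i] oj[OF i'] X.tr_closed[OF i i' u] in auto)
qed (auto simp: eta_def oj rr_bhom_KS)

text \<open>This is the defining equation of \<open>KC a\<close> at g = 0: up to passing to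
  \<open>ol a\<close>, x is the orbit function of its value at the identity.\<close>

lemma rr_ev1:
  assumes a: "a \<in> Ob"
  shows "x \<in> KC a \<Longrightarrow> ctr (jn (oi a)) (ol a) (op a) (rr (oi a) (ev1 a x)) =
    ctr (oi a) (ol a) (oq a) x"
  using KC_eq[of x a 0] subsetD[OF KC_subset[of a]] KC_fdec[of x a]
  by (simp add: ev1_def cblu_map_apply rr_closed ObD[OF a])

text \<open>The inverse is \<open>eta\<close>, the corestriction of \<rho>. Its composite after
  \<open>eps\<close> is the identity by \<open>rr_ev1\<close>, and \<open>eps\<close> after it is
  the identity by the counit law.\<close>

lemma iso_arrow_eps: "iso_arrow (IndBan v s) KO X eps"
  unfolding iso_arrow_def IndBan_simps
proof (intro conjI bexI)
  note idX = idt_IndBan[OF X.ind_banach_axioms] and idK = idt_IndBan[OF ind_banach_KO]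
  interpret A: ind_triple v s KO X KO eps eta by unfold_locales (rule eps_hom eta_hom)+
  interpret B: ind_triple v s X KO X eta eps by unfold_locales (rule eps_hom eta_hom)+
  show "ind_comp KO X KO eta eps = idt (IndBan v s) KO"
  proof (rule KO.ind_hom_eq_evI[OF A.ind_comp_hom idK(1)])
    fix a assume "a \<in> ix KO"
    then have a: "a \<in> Ob" by simp
    note A = ObD[OF a]
    have "ev_eq KO (KC a) (oj (oi a)) (\<lambda>x. rr (oi a) (ev1 a x)) a (\<lambda>x. x)"
      using A oj[OF A(1)] rr_ev1[OF a] bhom_closed[OF ev1_bhom[OF a]]
      by (intro KO_span[of _ _ "ol a" "op a" "oq a"]) (auto simp: a)
    then have "ev_eq KO (carrier (sp KO a)) (oj (oi a)) (compose (carrier (sp KO a)) (rr (oi a)) (ev1 a))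
        a (\<lambda>x\<in>carrier (sp KO a). x)"
      unfolding KO_simps(2) KS_simps(1) by (rule KO.ev_eq_cong) (simp_all add: compose_eq)
    with A.ind_comp_mem[OF _ eps_mem[OF a] eta_mem[OF A(1)]] idK(2)[of a] a
    show "\<exists>j f l h. (j, f) \<in> ind_comp KO X KO eta eps a \<and> (l, h) \<in> idt (IndBan v s) KO a \<and>
        ev_eq KO (carrier (sp KO a)) j f l h"
      unfolding KO_simps(1) by blast
  qed
  show "ind_comp X KO X eps eta = idt (IndBan v s) X"
  proof (rule X.ind_hom_eq_evI[OF B.ind_comp_hom idX(1)])
    fix i assume i: "i \<in> ix X"
    have "ev_eq X (carrier (sp X i)) (jn i) (compose (carrier (sp X i)) (ev1 (oj i)) (rr i))
        i (\<lambda>x\<in>carrier (sp X i). x)"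
      by (rule X.ev_eq_cong[OF rr_counit[OF i]]) (simp_all add: compose_eq ev1_def oj[OF i])
    with B.ind_comp_mem[OF i eta_mem[OF i] eps_mem[OF oj(1)[OF i]]] idX(2)[OF i]
    show "\<exists>j f l h. (j, f) \<in> ind_comp X KO X eps eta i \<and> (l, h) \<in> idt (IndBan v s) X i \<and>
        ev_eq X (carrier (sp X i)) j f l h"
      unfolding oj(2)[OF i] by blast
  qed
qed (rule eps_hom eta_hom)+

text \<open>Along \<rho>, x becomes the orbit function of its value at the identity, which is
  eventually x by \<open>rr_ev1\<close>. Along the coaction of \<open>KO\<close> it becomes the
  function with value (translate (- g) x) (0) = x (g) at g. Both routes are eventually the inclusion
  of \<open>KC a\<close> into the functions.\<close>

lemma eps_coalgebra_hom:
  "ind_comp KO X (cblu_obj U X) \<rho> eps =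
    ind_comp KO (cblu_obj U KO) (cblu_obj U X) (CM KO X eps) (coaction KO KA)"
proof -
  interpret K: isometric_action v s U KO KA by (rule isometric_action_KO)
  note Cmem = CM_mem[OF ind_banach_KO X.ind_banach_axioms eps_hom]
  interpret A: ind_triple v s KO X "cblu_obj U X" eps \<rho> by unfold_locales (rule eps_hom \<rho>_hom)+
  interpret B: ind_triple v s KO "cblu_obj U KO" "cblu_obj U X" "coaction KO KA" "CM KO X eps"
    by unfold_locales (rule K.coaction_hom CM_hom[OF ind_banach_KO X.ind_banach_axioms eps_hom])+
  show ?thesis
  proof (rule CX.ind_hom_eq_evI[OF A.ind_comp_hom B.ind_comp_hom])
    fix a assume aK: "a \<in> ix KO"
    then have a: "a \<in> Ob" by simp
    note A = ObD[OF a] and c = subsetD[OF KC_subset[of a]]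
    obtain b t where bt: "(b, t) \<in> coaction KO KA a" by (rule K.coaction_rep[OF aK])
    have b: "b \<in> Ob" and tb: "t \<in> bhom (KS a) (CS (KS b))" and "(b, family_of (KS a) t) \<in> KA a"
      using K.coactionD[OF aK bt] by auto
    then have e: "ev_eq KO (UNIV \<times> KC a) a (KT a) b (family_of (KS a) t)"
      and tf: "family_of (KS a) t \<in> families (KS a) (KS b)"
      by (simp_all add: KA_mem[OF a])
    have tx: "t x \<in> carrier (CS (KS b))" "fdec U (t x) g \<in> KC b" if "x \<in> KC a" for x g
      using bhom_closed[OF tb, of x] fdec_closed[of "t x" "KS b"] that by simp_all
    obtain d u w where d: "d \<in> Ob" and u: "u \<in> homs (idx KO) a d" and w: "w \<in> homs (idx KO) b d"
      and uw: "\<And>y. y \<in> UNIV \<times> KC a \<Longrightarrow> ctr (oi a) (oi d) u (KT a y) =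
        ctr (oi b) (oi d) w (family_of (KS a) t y)"
      by (rule KO_evE[OF e]) (auto simp: translate_KC[OF a] families_KS[OF tf])
    \<comment> \<open>As t represents the translation action, its value at g is eventually the
      translate of x by - g, and evaluation of that translate at 0 gives x (g).\<close>
    have uw: "X.tr (oi a) (oi d) u (fdec U x g) = X.tr (oi b) (oi d) w (fdec U (fdec U (t x) g) 0)"
      if x: "x \<in> KC a" for x g
    proof -
      have "fdec U (ctr (oi a) (oi d) u (translate (- g) x)) 0 =
          fdec U (ctr (oi b) (oi d) w (fdec U (t x) g)) 0"
        using uw[of "(- g, x)"] x by (simp add: family_of_def)
      then show ?thesis
        by (simp add: cblu_map_apply[OF c[OF translate_KC[OF a x]]]
            cblu_map_apply[OF subsetD[OF KC_subset tx(2)[OF x]]])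
    qed
    note ce = cblu_map_bhom[OF banach_KS[OF b] X.sp_banach[OF ObD(1)[OF b]] ev1_bhom[OF b]]
    have ct: "cblu_map U (KS b) (ev1 b) (t x) = fenc U (\<lambda>g. fdec U (fdec U (t x) g) 0)" if "x \<in> KC a" for x
      by (simp add: cblu_map_apply[OF tx(1)[OF that]] ev1_def tx(2)[OF that])
    have ctc: "cblu_map U (KS b) (ev1 b) (t x) \<in> carrier (CS (sp X (oi b)))" if "x \<in> KC a" for x
      by (rule bhom_closed[OF ce tx(1)[OF that]])
    have 1: "ev_eq (cblu_obj U X) (KC a) (jn (oi a)) (\<lambda>x. rr (oi a) (ev1 a x)) (oi a) (\<lambda>x. x)"
      by (rule CX.ev_eqI[of "ol a" "op a" _ "oq a"]) (simp_all add: A rr_ev1[OF a])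
    have 2: "ev_eq (cblu_obj U X) (KC a) (oi a) (\<lambda>x. x) (oi b) (\<lambda>x. cblu_map U (KS b) (ev1 b) (t x))"
    proof (rule CX.ev_eqI[of "oi d" u _ w])
      fix x assume x: "x \<in> KC a"
      show "CX.tr (oi a) (oi d) u x = CX.tr (oi b) (oi d) w (cblu_map U (KS b) (ev1 b) (t x))"
        using ctc[OF x] by (simp add: cblu_map_apply c[OF x] uw[OF x] ct[OF x])
    qed (use u w d in \<open>simp_all add: ObD\<close>)
    have 3: "ev_eq (cblu_obj U X) (KC a) (jn (oi a)) (\<lambda>x. rr (oi a) (ev1 a x))
        (oi b) (\<lambda>x. cblu_map U (KS b) (ev1 b) (t x))"
      by (rule CX.ev_eq_trans[OF _ _ _ _ _ _ 1 2])
        (use ctc c in \<open>auto simp: A ObD[OF b] intro!: rr_closed bhom_closed[OF ev1_bhom[OF a]]\<close>)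
    have "ev_eq (cblu_obj U X) (carrier (sp KO a)) (jn (oi a)) (compose (carrier (sp KO a)) (rr (oi a)) (ev1 a))
        (oi b) (compose (carrier (sp KO a)) (cblu_map U (sp KO b) (ev1 b)) t)"
      by (rule CX.ev_eq_cong[where D = "carrier (sp KO a)"]) (use 3 in \<open>simp_all add: compose_eq\<close>)
    with A.ind_comp_mem[OF aK eps_mem[OF a] rep[OF A(1)]]
      B.ind_comp_mem[OF aK bt Cmem[OF _ eps_mem[OF b]]] b
    show "\<exists>j f l h. (j, f) \<in> ind_comp KO X (cblu_obj U X) \<rho> eps a \<and>
        (l, h) \<in> ind_comp KO (cblu_obj U KO) (cblu_obj U X) (CM KO X eps) (coaction KO KA) a \<and>
        ev_eq (cblu_obj U X) (carrier (sp KO a)) j f l h"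
      unfolding KO_simps(1) by blast
  qed
qed

end

theorem proposition4p22:
  fixes v :: "'k::field \<Rightarrow> real"
    and strong :: bool
    and U :: "('k, 'g::topological_group_add, 'u) univ"
  assumes "complete_valued_field v"
    and "strong \<longrightarrow> nonarchimedean v"
    and "locally_compact_space (euclidean :: 'g topology)"
    and "universe U"
  shows "equivalent_categories
    (GMod_iso v strong :: (('k, 'u) ind \<times> ('g, 'u) ind_action, 'u indmap) cat)
    (coalgebras (IndBan v strong) (Cblu v strong U))"
proof -
  interpret cblu_universe v strong U
    by (rule cblu_universe.intro[OF assms(1,4)])
  let ?C = "IndBan v strong" and ?T = "Cblu v strong U"
  have C: "category ?C" by (rule category_IndBan[OF valued])
  have GMod: "(X, \<alpha>) \<in> obs (GMod_iso v strong) \<longleftrightarrow> isometric_action v strong U X \<alpha>"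
    for X and \<alpha> :: "('g, 'u) ind_action"
    by (auto simp: GMod_iso_def isometric_action_def isometric_action_axioms_def ind_banach_def
        cblu_universe_def valued universe)
  have coalg: "(X, \<rho>) \<in> obs (coalgebras ?C ?T) \<longleftrightarrow> coalgebra ?C ?T X \<rho>" for X \<rho>
    by (simp add: coalgebras_def)
  show ?thesis
  proof (rule equivalent_categoriesI[where F = "\<lambda>(X, \<alpha>). (X, coaction X \<alpha>)"])
    show "category (coalgebras ?C ?T)"
      by (rule category_coalgebras[OF C functor_Cblu])
    show "(case p of (X, \<alpha>) \<Rightarrow> (X, coaction X \<alpha>)) \<in> obs (coalgebras ?C ?T)"
      if "p \<in> obs (GMod_iso v strong)" for p :: "('k, 'u) ind \<times> ('g, 'u) ind_action"
      using that by (cases p) (simp add: GMod coalg isometric_action.coalgebra_coaction)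
    show "homs (GMod_iso v strong) p q = homs (coalgebras ?C ?T)
        (case p of (X, \<alpha>) \<Rightarrow> (X, coaction X \<alpha>)) (case q of (X, \<alpha>) \<Rightarrow> (X, coaction X \<alpha>))"
      if "p \<in> obs (GMod_iso v strong)" "q \<in> obs (GMod_iso v strong)"
      for p q :: "('k, 'u) ind \<times> ('g, 'u) ind_action"
    proof -
      obtain X \<alpha> Y \<beta> where p: "p = (X, \<alpha>)" and q: "q = (Y, \<beta>)"
        by (cases p, cases q)
      have "isometric_action v strong U X \<alpha>" "isometric_action v strong U Y \<beta>"
        using that by (simp_all only: p q GMod)
      from equivariant_iff_coalgebra_hom[OF this] show ?thesis
        by (auto simp: p q GMod_iso_def coalgebras_def)
    qed
    show "idt (GMod_iso v strong) p = idt (coalgebras ?C ?T) (case p of (X, \<alpha>) \<Rightarrow> (X, coaction X \<alpha>))"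
      for p :: "('k, 'u) ind \<times> ('g, 'u) ind_action"
      by (cases p) (simp add: GMod_iso_def coalgebras_def)
    show "cmp (GMod_iso v strong) p q r = cmp (coalgebras ?C ?T) (case p of (X, \<alpha>) \<Rightarrow> (X, coaction X \<alpha>))
        (case q of (X, \<alpha>) \<Rightarrow> (X, coaction X \<alpha>)) (case r of (X, \<alpha>) \<Rightarrow> (X, coaction X \<alpha>))"
      for p q r :: "('k, 'u) ind \<times> ('g, 'u) ind_action"
      by (cases p; cases q; cases r) (simp add: GMod_iso_def coalgebras_def)
    show "\<exists>p\<in>obs (GMod_iso v strong). \<exists>f. iso_arrow (coalgebras ?C ?T)
        (case p of (X, \<alpha>) \<Rightarrow> (X, coaction X \<alpha>)) c f" if c: "c \<in> obs (coalgebras ?C ?T)" for c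
    proof -
      obtain X \<rho> where X: "c = (X, \<rho>)" by (cases c)
      then have co: "coalgebra ?C ?T X \<rho>" using c by (simp add: coalg)
      interpret X: ind_banach v strong X
        using co by (simp add: coalgebra_def Let_def)
      interpret comonad_coalgebra v strong U X \<rho>
        by unfold_locales (rule co)
      have KO: "(KO, KA) \<in> obs (GMod_iso v strong)"
        by (simp add: GMod isometric_action_KO)
      have "eps \<in> homs (coalgebras ?C ?T) (KO, coaction KO KA) (X, \<rho>)"
        by (simp add: coalgebras_def eps_hom eps_coalgebra_hom)
      \<comment> \<open>\<open>eps\<close> is invertible on underlying ind-objects and respects the
        coactions, which by \<open>iso_arrow_coalgebras\<close> is enough for an isomorphism of
        coalgebras.\<close>
      then have "iso_arrow (coalgebras ?C ?T) (KO, coaction KO KA) (X, \<rho>) eps"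
        using co isometric_action.coalgebra_coaction[OF isometric_action_KO]
        by (intro iso_arrow_coalgebras[OF C functor_Cblu _ _ _ iso_arrow_eps]) (simp_all add: coalg)
      with KO show ?thesis unfolding X by force
    qed
  qed
qed

end
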